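(* Let $n\geq 8$ and let $(\alpha,\alpha_0,\alpha_1,\ldots,\alpha_n)$ be a tuple of independent differential transcendentals over $\mathbb{Q}$. Let $X_\alpha$ be the differential variety defined by $x''+\sum_{i=1}^n\alpha_i x^i=\alpha$. Then $X_\alpha$ is strongly minimal.
   Context: Everything takes place in a saturated differentially closed field $\mathcal U$ of characteristic zero with one derivation ($x'=\delta x$). A definable set is strongly minimal if every definable subset (with parameters from $\mathcal U$) is finite or cofinite. *)

theory Defs
  imports Complex_Main "HOL-Library.Poly_Mapping" "HOL-Library.Equipollence"
begin

definition derivation :: "('a::field_char_0 \<Rightarrow> 'a) \<Rightarrow> bool" where
  "derivation \<delta> \<longleftrightarrow>
     (\<forall>x y. \<delta> (x + y) = \<delta> x + \<delta> y) \<and> (\<forall>x y. \<delta> (x * y) = \<delta> x * y + x * \<delta> y)"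

section \<open>Differential polynomials\<close>

text \<open>The pair \<open>(i, k)\<close> stands for the \<open>k\<close>-th derivative of the \<open>i\<close>-th differential
  indeterminate. A differential polynomial is an ordinary polynomial in these pairs: a finitely
  supported assignment of coefficients to monomials, which are finitely supported assignments of
  exponents to pairs.\<close>

type_synonym ('i, 'a) dpoly = "(('i \<times> nat) \<Rightarrow>\<^sub>0 nat) \<Rightarrow>\<^sub>0 'a"

definition dpoly_eval ::
  "('a::field_char_0 \<Rightarrow> 'a) \<Rightarrow> ('i, 'a) dpoly \<Rightarrow> ('i \<Rightarrow> 'a) \<Rightarrow> 'a" where
  "dpoly_eval \<delta> p x =
     (\<Sum>m\<in>Poly_Mapping.keys p. Poly_Mapping.lookup p m *
        (\<Prod>(i, k)\<in>Poly_Mapping.keys m. ((\<delta> ^^ k) (x i)) ^ Poly_Mapping.lookup m (i, k)))"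

definition dpoly_vars :: "('i, 'a::field_char_0) dpoly \<Rightarrow> ('i \<times> nat) set" where
  "dpoly_vars p = (\<Union>m\<in>Poly_Mapping.keys p. Poly_Mapping.keys m)"

text \<open>Constants, including \<open>0\<close>, have order \<open>-1\<close>.\<close>

definition dpoly_order :: "(unit, 'a::field_char_0) dpoly \<Rightarrow> int" where
  "dpoly_order p = (if dpoly_vars p = {} then -1 else int (Max (snd ` dpoly_vars p)))"

definition diff_independent ::
  "('a::field_char_0 \<Rightarrow> 'a) \<Rightarrow> 'a set \<Rightarrow> 'a list \<Rightarrow> bool" where
  "diff_independent \<delta> K xs \<longleftrightarrow>
     (\<forall>p :: (nat, 'a) dpoly.
        p \<noteq> 0 \<and> (\<forall>m. Poly_Mapping.lookup p m \<in> K) \<and> fst ` dpoly_vars p \<subseteq> {..<length xs}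
        \<longrightarrow> dpoly_eval \<delta> p (\<lambda>i. xs ! i) \<noteq> 0)"

text \<open>Blum's axioms. Algebraic closedness is the case where \<open>f\<close> has order \<open>0\<close> and \<open>g = 1\<close>.\<close>

definition differentially_closed :: "('a::field_char_0 \<Rightarrow> 'a) \<Rightarrow> bool" where
  "differentially_closed \<delta> \<longleftrightarrow> derivation \<delta> \<and>
     (\<forall>f g :: (unit, 'a) dpoly. g \<noteq> 0 \<and> dpoly_order g < dpoly_order f \<longrightarrow>
        (\<exists>x. dpoly_eval \<delta> f (\<lambda>_. x) = 0 \<and> dpoly_eval \<delta> g (\<lambda>_. x) \<noteq> 0))"

section \<open>First-order formulas in the language of differential rings\<close>

datatype (term_params: 'a) dterm =
  Var nat | Param 'a | Zero | One
  | Plus "'a dterm" "'a dterm" | Uminus "'a dterm" | Times "'a dterm" "'a dterm"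
  | Der "'a dterm"

datatype (params: 'a) dform =
  Equal "'a dterm" "'a dterm" | Neg "'a dform" | Conj "'a dform" "'a dform"
  | Exists nat "'a dform"

primrec term_vars :: "'a dterm \<Rightarrow> nat set" where
  "term_vars (Var n) = {n}"
| "term_vars (Param a) = {}"
| "term_vars Zero = {}"
| "term_vars One = {}"
| "term_vars (Plus s t) = term_vars s \<union> term_vars t"
| "term_vars (Uminus t) = term_vars t"
| "term_vars (Times s t) = term_vars s \<union> term_vars t"
| "term_vars (Der t) = term_vars t"

primrec free_vars :: "'a dform \<Rightarrow> nat set" where
  "free_vars (Equal s t) = term_vars s \<union> term_vars t"
| "free_vars (Neg \<phi>) = free_vars \<phi>"
| "free_vars (Conj \<phi> \<psi>) = free_vars \<phi> \<union> free_vars \<psi>"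
| "free_vars (Exists n \<phi>) = free_vars \<phi> - {n}"

primrec term_val :: "('a::field_char_0 \<Rightarrow> 'a) \<Rightarrow> (nat \<Rightarrow> 'a) \<Rightarrow> 'a dterm \<Rightarrow> 'a" where
  "term_val \<delta> v (Var n) = v n"
| "term_val \<delta> v (Param a) = a"
| "term_val \<delta> v Zero = 0"
| "term_val \<delta> v One = 1"
| "term_val \<delta> v (Plus s t) = term_val \<delta> v s + term_val \<delta> v t"
| "term_val \<delta> v (Uminus t) = - term_val \<delta> v t"
| "term_val \<delta> v (Times s t) = term_val \<delta> v s * term_val \<delta> v t"
| "term_val \<delta> v (Der t) = \<delta> (term_val \<delta> v t)"

primrec holds :: "('a::field_char_0 \<Rightarrow> 'a) \<Rightarrow> (nat \<Rightarrow> 'a) \<Rightarrow> 'a dform \<Rightarrow> bool" where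
  "holds \<delta> v (Equal s t) \<longleftrightarrow> term_val \<delta> v s = term_val \<delta> v t"
| "holds \<delta> v (Neg \<phi>) \<longleftrightarrow> \<not> holds \<delta> v \<phi>"
| "holds \<delta> v (Conj \<phi> \<psi>) \<longleftrightarrow> holds \<delta> v \<phi> \<and> holds \<delta> v \<psi>"
| "holds \<delta> v (Exists n \<phi>) \<longleftrightarrow> (\<exists>x. holds \<delta> (v(n := x)) \<phi>)"

text \<open>Formulas over \<open>A\<close> in the single free variable \<open>0\<close>. Their truth depends only on the value of
  that variable, so they are evaluated under constant assignments.\<close>

definition unary_forms :: "'a set \<Rightarrow> 'a dform set" where
  "unary_forms A = {\<phi>. params \<phi> \<subseteq> A \<and> free_vars \<phi> \<subseteq> {0}}"

definition definable :: "('a::field_char_0 \<Rightarrow> 'a) \<Rightarrow> 'a set \<Rightarrow> bool" where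
  "definable \<delta> S \<longleftrightarrow> (\<exists>\<phi>\<in>unary_forms UNIV. S = {x. holds \<delta> (\<lambda>_. x) \<phi>})"

definition saturated :: "('a::field_char_0 \<Rightarrow> 'a) \<Rightarrow> bool" where
  "saturated \<delta> \<longleftrightarrow>
     (\<forall>A :: 'a set. A \<prec> (UNIV :: 'a set) \<longrightarrow>
        (\<forall>\<Phi>. \<Phi> \<subseteq> unary_forms A \<and>
              (\<forall>\<Psi>. finite \<Psi> \<and> \<Psi> \<subseteq> \<Phi> \<longrightarrow> (\<exists>x. \<forall>\<psi>\<in>\<Psi>. holds \<delta> (\<lambda>_. x) \<psi>))
           \<longrightarrow> (\<exists>x. \<forall>\<phi>\<in>\<Phi>. holds \<delta> (\<lambda>_. x) \<phi>)))"

definition strongly_minimal :: "('a::field_char_0 \<Rightarrow> 'a) \<Rightarrow> 'a set \<Rightarrow> bool" where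
  "strongly_minimal \<delta> X \<longleftrightarrow> definable \<delta> X \<and>
     (\<forall>Y. definable \<delta> Y \<and> Y \<subseteq> X \<longrightarrow> finite Y \<or> finite (X - Y))"

end

theory Submission
  imports Defs "HOL-Computational_Algebra.Formal_Laurent_Series" "HOL-Library.Product_Lexorder"
begin

text \<open>Write the equation as \<open>x'' = P x\<close> with \<open>P\<close> of degree \<open>n\<close>. If infinitely many solutions satisfied
  \<open>g x x' = 0\<close> for a nonzero polynomial \<open>g\<close>, then a curve \<open>g = 0\<close> would be invariant under the derivation
  \<open>D\<close> with \<open>D x = y\<close>, \<open>D y = P x\<close>. Put \<open>t = 1 / sqrt x\<close> and \<open>M = n + 1\<close>. A branch at infinity of an
  invariant curve is a series \<open>y = (f 0 + f 1 * t + f 2 * t ^ 2 + ...) / t ^ M\<close> whose coefficients are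
  determined recursively by \<open>P\<close> up to the choice of the sign of \<open>f 0\<close>; at order \<open>2 * M\<close> the recursion leaves
  \<open>f (2 * M)\<close> free and imposes the condition \<open>\<delta> (f (M + 2)) = 0\<close> instead, because an exact derivative
  has no residue. The second derivative of the coefficient of \<open>x ^ (n - 2)\<close> occurs linearly in
  \<open>\<delta> (f (M + 2))\<close>, which therefore does not vanish for generic coefficients. A Newton polygon
  argument replaces the expansion of the curve into Puiseux series.

  Hence every relation of order one has finitely many solutions, and all other solutions have the
  same quantifier-free type. By a back-and-forth argument, which combines saturation with Blum's
  axioms, they have the same type, so definable subsets are finite or cofinite.\<close>

unbundle fps_syntax

text \<open>Let p be the leading coefficient of P. The dominant balance y ^ 2 = (2 / M) * p * x ^ M
  gives f 0 = c with c ^ 2 = 2 * p / M, and M may be odd, whence powers of sqrt x. The resonance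
  sits at order 2 * M because a change of the energy y ^ 2 / 2 - (integral of P) first alters y at t
  ^ M, that is, t ^ M * y at t ^ (2 * M). In t ^ (M - 2) * D the derivation of the coefficients
  carries the factor t ^ (M - 2). Hence \<delta> (f j) enters at order j + M - 2: the resonance sees
  \<delta> (f (M + 2)), and f (M + 2) contains \<delta> (f 4). The coefficient of x ^ (n - 2) is
  first met in f 4, four powers of t below the top, which explains the second derivative. The f i
  involve, besides the coefficients of P and their derivatives, only c and 1 / p. As c is quadratic
  over the coefficients, independence is applied to quadratic relations. A branch of the curve
  itself could require fractional powers of t, so only orders of the coefficients of its equation
  are compared.\<close>

definition ring_derivation :: "('r::comm_ring_1 \<Rightarrow> 'r) \<Rightarrow> bool" where
  "ring_derivation d \<longleftrightarrow>
     (\<forall>x y. d (x + y) = d x + d y) \<and> (\<forall>x y. d (x * y) = d x * y + x * d y)"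

lemma ring_derivation_if_derivation: "derivation \<delta> \<Longrightarrow> ring_derivation \<delta>"
  by (simp add: derivation_def ring_derivation_def)

context
  fixes d :: "'r::idom \<Rightarrow> 'r"
  assumes d: "ring_derivation d"
begin

lemma rd_add: "d (x + y) = d x + d y"
  using d by (simp add: ring_derivation_def)

lemma rd_mult: "d (x * y) = d x * y + x * d y"
  using d by (simp add: ring_derivation_def)

lemma rd_0 [simp]: "d 0 = 0"
  using rd_mult[of 0 0] by simp

lemma rd_1 [simp]: "d 1 = 0"
  using rd_mult[of 1 1] by (metis add_cancel_right_right mult_1 mult_1_right)

lemma rd_minus: "d (- x) = - d x"
  using rd_add[of x "- x"] by (simp add: eq_neg_iff_add_eq_0 add.commute)

lemma rd_diff: "d (x - y) = d x - d y"
  using rd_add[of x "- y"] by (simp add: rd_minus)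

lemma rd_sum: "d (sum f I) = (\<Sum>i\<in>I. d (f i))"
  by (induction I rule: infinite_finite_induct) (simp_all add: rd_add)

lemma rd_of_nat [simp]: "d (of_nat k) = 0"
  by (induction k) (simp_all add: rd_add)

lemma rd_power_Suc: "d (x ^ Suc k) = of_nat (Suc k) * x ^ k * d x"
proof (induction k)
  case (Suc k)
  have "d (x ^ Suc (Suc k)) = d x * x ^ Suc k + x * d (x ^ Suc k)"
    by (simp add: rd_mult)
  also have "\<dots> = of_nat (Suc (Suc k)) * x ^ Suc k * d x"
    unfolding Suc.IH by (simp add: algebra_simps)
  finally show ?case .
qed simp

lemma ring_derivation_map_poly: "ring_derivation (map_poly d)"
  unfolding ring_derivation_def
proof (intro conjI allI)
  fix p q :: "'r poly"
  show "map_poly d (p + q) = map_poly d p + map_poly d q"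
    by (intro poly_eqI) (simp add: coeff_map_poly rd_add)
  show "map_poly d (p * q) = map_poly d p * q + p * map_poly d q"
    by (intro poly_eqI) (simp add: coeff_map_poly coeff_mult rd_sum rd_mult sum.distrib)
qed

lemma rd_poly:
  "d (poly p x) = poly (map_poly d p) x + poly (pderiv p) x * d x"
  by (induction p) (simp_all add: rd_add rd_mult map_poly_pCons pderiv_pCons algebra_simps)

end

lemma rd_inverse:
  fixes x :: "'r::field"
  assumes "ring_derivation d" "x \<noteq> 0"
  shows "d (inverse x) = - d x / x\<^sup>2"
proof -
  have "0 = d (x * inverse x)"
    using assms by simp
  also have "\<dots> = d x * inverse x + x * d (inverse x)"
    by (rule rd_mult[OF assms(1)])
  finally show ?thesis
    using assms(2) by (simp add: field_simps power2_eq_square eq_neg_iff_add_eq_0)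
qed

section \<open>Laurent series\<close>

text \<open>A lower bound on the order that also holds for the zero series, whose
  \<open>fls_subdegree\<close> is 0 by convention. Orders of sums and products can then be estimated
  without case distinctions.\<close>

definition vanishes_below :: "'a::zero fls \<Rightarrow> int \<Rightarrow> bool" where
  "vanishes_below f k \<longleftrightarrow> (\<forall>i<k. f $$ i = 0)"

lemma vanishes_below_mono: "vanishes_below f k \<Longrightarrow> j \<le> k \<Longrightarrow> vanishes_below f j"
  by (auto simp: vanishes_below_def)

lemma vanishes_below_subdegree: "vanishes_below f (fls_subdegree f)"
  by (auto simp: vanishes_below_def)

lemma vanishes_below_0 [simp]: "vanishes_below 0 k"
  by (simp add: vanishes_below_def)

lemma vanishes_below_iff: "f \<noteq> 0 \<Longrightarrow> vanishes_below f k \<longleftrightarrow> k \<le> fls_subdegree f"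
  by (metis fls_subdegree_geI linorder_not_less nth_fls_subdegree_nonzero vanishes_below_def
      vanishes_below_mono vanishes_below_subdegree)

lemma fls_nth_mult:
  fixes f g :: "'a::comm_semiring_0 fls"
  assumes "vanishes_below f a" "vanishes_below g b"
  shows "(f * g) $$ n = (\<Sum>i=a..n - b. f $$ i * g $$ (n - i))"
proof -
  let ?S = "{min a (fls_subdegree f)..max (n - b) (n - fls_subdegree g)}"
  have "(f * g) $$ n = (\<Sum>i=fls_subdegree f..n - fls_subdegree g. f $$ i * g $$ (n - i))"
    by (rule fls_times_nth(2))
  also have "\<dots> = (\<Sum>i\<in>?S. f $$ i * g $$ (n - i))"
    by (intro sum.mono_neutral_left) (auto simp: not_le)
  also have "\<dots> = (\<Sum>i=a..n - b. f $$ i * g $$ (n - i))"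
    using assms by (intro sum.mono_neutral_right) (auto simp: not_le vanishes_below_def)
  finally show ?thesis .
qed

lemma vanishes_below_mult:
  fixes f g :: "'a::comm_semiring_0 fls"
  assumes "vanishes_below f a" "vanishes_below g b"
  shows "vanishes_below (f * g) (a + b)"
  using assms by (auto simp: vanishes_below_def fls_nth_mult[OF assms])

lemma fls_nth_mult_base:
  fixes f g :: "'a::comm_semiring_0 fls"
  assumes "vanishes_below f a" "vanishes_below g b" "n = a + b"
  shows "(f * g) $$ n = f $$ a * g $$ b"
  by (simp add: fls_nth_mult[OF assms(1,2)] assms(3))

lemma fls_nth_mult_0:
  fixes f g :: "'a::comm_semiring_0 fls"
  assumes "vanishes_below f a" "vanishes_below g b" "n < a + b"
  shows "(f * g) $$ n = 0"
  using vanishes_below_mult[OF assms(1,2)] assms(3) by (simp add: vanishes_below_def)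

definition fls_map :: "('a::zero \<Rightarrow> 'a) \<Rightarrow> 'a fls \<Rightarrow> 'a fls" where
  "fls_map h f = Abs_fls (\<lambda>i. h (f $$ i))"

lemma fls_map_nth [simp]: "h 0 = 0 \<Longrightarrow> fls_map h f $$ i = h (f $$ i)"
  unfolding fls_map_def by (rule nth_Abs_fls_lower_bound[of "fls_subdegree f"]) auto

text \<open>The Euler operator t * d/dt. It does not lower orders, and as D t is a multiple of t,
  the vector field can be written with it.\<close>

definition fls_theta :: "'a::comm_ring_1 fls \<Rightarrow> 'a fls" where
  "fls_theta f = fls_X * fls_deriv f"

lemma fls_theta_nth [simp]: "fls_theta f $$ i = of_int i * f $$ i"
  by (simp add: fls_theta_def fls_X_times_conv_shift)

lemma ring_derivation_fls_map:
  fixes d :: "'a::idom \<Rightarrow> 'a"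
  assumes d: "ring_derivation d"
  shows "ring_derivation (fls_map d)"
  unfolding ring_derivation_def
proof (intro conjI allI fls_eqI)
  fix f g :: "'a fls" and i
  have [simp]: "d 0 = 0"
    by (rule rd_0[OF d])
  let ?a = "fls_subdegree f" and ?b = "fls_subdegree g"
  show "fls_map d (f + g) $$ i = (fls_map d f + fls_map d g) $$ i"
    by (simp add: rd_add[OF d])
  have v: "vanishes_below f ?a" "vanishes_below g ?b"
    by (rule vanishes_below_subdegree)+
  have v': "vanishes_below (fls_map d f) ?a" "vanishes_below (fls_map d g) ?b"
    by (simp_all add: vanishes_below_def)
  show "fls_map d (f * g) $$ i = (fls_map d f * g + f * fls_map d g) $$ i"
    by (simp add: fls_nth_mult[OF v] fls_nth_mult[OF v'(1) v(2)] fls_nth_mult[OF v(1) v'(2)]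
        rd_sum[OF d] rd_mult[OF d] sum.distrib)
qed

lemma ring_derivation_fls_theta: "ring_derivation fls_theta"
  unfolding ring_derivation_def
proof (intro conjI allI fls_eqI)
  fix f g :: "'a fls" and i
  let ?a = "fls_subdegree f" and ?b = "fls_subdegree g"
  show "fls_theta (f + g) $$ i = (fls_theta f + fls_theta g) $$ i"
    by (simp add: algebra_simps)
  have v: "vanishes_below f ?a" "vanishes_below g ?b"
    by (rule vanishes_below_subdegree)+
  have v': "vanishes_below (fls_theta f) ?a" "vanishes_below (fls_theta g) ?b"
    by (simp_all add: vanishes_below_def)
  show "fls_theta (f * g) $$ i = (fls_theta f * g + f * fls_theta g) $$ i"
    unfolding fls_plus_nth fls_theta_nth fls_nth_mult[OF v] fls_nth_mult[OF v'(1) v(2)]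
      fls_nth_mult[OF v(1) v'(2)] sum.distrib[symmetric] sum_distrib_left
    by (intro sum.cong) (simp_all add: algebra_simps)
qed

lemma vanishes_below_theta: "vanishes_below f k \<Longrightarrow> vanishes_below (fls_theta f) k"
  by (simp add: vanishes_below_def)

section \<open>Newton polygons of invariant curves\<close>

lemma finite_minimiser:
  fixes f :: "'i \<Rightarrow> 'b::linorder"
  assumes "finite J" "J \<noteq> {}"
  obtains j where "j \<in> J" "\<And>i. i \<in> J \<Longrightarrow> f j \<le> f i"
proof -
  have "Min (f ` J) \<in> f ` J"
    using assms by simp
  then obtain j where "j \<in> J" "f j = Min (f ` J)"
    by (metis imageE)
  with assms that show ?thesis
    by simp
qed

text \<open>In the coordinates \<open>t = 1 / sqrt x\<close> and \<open>v\<close> with \<open>y = (F + v) / t ^ M\<close>, the left-hand side is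
  \<open>t ^ (M - 2) * D G\<close>: one has \<open>D t = - t ^ 3 * y / 2\<close>, and the quadratic factor is
  \<open>t ^ (M - 2) * D v\<close>.\<close>

definition invariant_at_inf ::
  "('a::field_char_0 \<Rightarrow> 'a) \<Rightarrow> nat \<Rightarrow> 'a fls \<Rightarrow> 'a fls \<Rightarrow> 'a fls \<Rightarrow> 'a fls \<Rightarrow> 'a fls \<Rightarrow>
     'a fls poly \<Rightarrow> bool" where
  "invariant_at_inf \<delta> M F A B h0 h1 G \<longleftrightarrow>
     smult (fls_X ^ (M - 2)) (map_poly (fls_map \<delta>) G)
       - smult (fls_const (1/2)) ([:F, 1:] * map_poly fls_theta G)
       + [:A, B, fls_const (- of_nat M / 2):] * pderiv G
     = [:h0, h1:] * G"

context
  fixes \<delta> :: "'a::field_char_0 \<Rightarrow> 'a" and M :: nat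
    and F A B h0 h1 :: "'a fls" and G :: "'a fls poly"
  assumes \<delta>: "ring_derivation \<delta>" and M: "M > 2"
    and inv: "invariant_at_inf \<delta> M F A B h0 h1 G"
begin

private abbreviation prev :: "nat \<Rightarrow> 'a fls" where
  "prev j \<equiv> coeff (pCons 0 G) j"

text \<open>Comparison of the coefficients of v ^ j * t ^ k; \<open>prev\<close> lists the
  coefficients of v * G. The later arguments evaluate this identity at pairs (j, k) on an edge or a
  vertex of a Newton polygon, where most terms vanish.\<close>

lemma invariant_at_inf_nth:
  "\<delta> (coeff G j $$ (k - (int M - 2))) - 1/2 * (F * fls_theta (coeff G j)) $$ k
     - 1/2 * of_int k * prev j $$ k
     + of_nat (Suc j) * (A * coeff G (Suc j)) $$ k + of_nat j * (B * coeff G j) $$ k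
     - of_nat M / 2 * (of_nat j - 1) * prev j $$ k
   = (h0 * coeff G j) $$ k + (h1 * prev j) $$ k"
proof -
  have [simp]: "\<delta> 0 = 0" "fls_map \<delta> 0 = 0" "fls_theta (0::'a fls) = 0"
    using rd_0[OF \<delta>] rd_0[OF ring_derivation_fls_map[OF \<delta>]]
      rd_0[OF ring_derivation_fls_theta] by auto
  have sh: "fls_X ^ (M - 2) * f = fls_shift (2 - int M) f" for f :: "'a fls"
    using M by (simp add: fls_X_power_times_conv_shift of_nat_diff)
  have main: "coeff (smult (fls_X ^ (M - 2)) (map_poly (fls_map \<delta>) G)
       - smult (fls_const (1/2)) ([:F, 1:] * map_poly fls_theta G)
       + [:A, B, fls_const (- of_nat M / 2):] * pderiv G) j $$ k
     = coeff ([:h0, h1:] * G) j $$ k"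
    using inv by (simp add: invariant_at_inf_def)
  have e1: "coeff ([:h0, h1:] * G) j $$ k = (h0 * coeff G j) $$ k + (h1 * prev j) $$ k"
    by (simp add: mult_pCons_left coeff_pCons split: nat.split)
  have e2: "coeff ([:A, B, fls_const (- of_nat M / 2):] * pderiv G) j $$ k
     = of_nat (Suc j) * (A * coeff G (Suc j)) $$ k + of_nat j * (B * coeff G j) $$ k
       - of_nat M / 2 * (of_nat j - 1) * prev j $$ k"
  proof -
    have *: "(a * (of_nat m * b)) $$ k = of_nat m * (a * b) $$ k" for a b :: "'a fls" and m k
      by (metis fls_mult_of_nat_nth(1) mult.left_commute)
    have c: "coeff ([:A, B, fls_const (- of_nat M / 2):] * pderiv G) j =
      A * (of_nat (Suc j) * coeff G (Suc j)) + B * (of_nat j * coeff G j)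
        + fls_const (- of_nat M / 2) * (of_nat (j - 1) * prev j)"
      by (cases j) (auto simp: mult_pCons_left coeff_pCons coeff_pderiv split: nat.split
          simp del: of_nat_Suc)
    \<comment> \<open>The natural number j - 1 comes from the coefficient of v ^ 2 *
      \<open>pderiv G\<close>. Since \<open>prev 0 = 0\<close>, the truncated difference at j = 0
      may be replaced by the difference in the field.\<close>
    have "j = 0 \<Longrightarrow> prev j = 0" by simp
    then have "of_nat (j - 1) * prev j = (of_nat j - 1) * prev j"
      by (cases j) auto
    then have "(fls_const (- of_nat M / 2) * (of_nat (j - 1) * prev j)) $$ k
       = - (of_nat M / 2 * (of_nat j - 1) * prev j $$ k)"
      by (cases j) (simp_all add: fls_of_nat mult.assoc)
    with c show ?thesis
      by (simp add: * del: of_nat_Suc)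
  qed
  have e3: "coeff (smult (fls_const (1/2)) ([:F, 1:] * map_poly fls_theta G)) j $$ k
     = 1/2 * (F * fls_theta (coeff G j)) $$ k + 1/2 * of_int k * prev j $$ k"
  proof -
    have "coeff ([:F, 1:] * map_poly fls_theta G) j = F * fls_theta (coeff G j) + fls_theta (prev j)"
      by (simp add: mult_pCons_left coeff_pCons coeff_map_poly split: nat.split)
    then show ?thesis
      by (simp add: distrib_left)
  qed
  have e4: "coeff (smult (fls_X ^ (M - 2)) (map_poly (fls_map \<delta>) G)) j $$ k
     = \<delta> (coeff G j $$ (k - (int M - 2)))"
    by (simp add: coeff_map_poly sh add_diff_eq diff_diff_eq2)
  show ?thesis
    using main unfolding coeff_add coeff_diff fls_plus_nth fls_minus_nth e1 e2 e3 e4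
    by (simp only: diff_diff_eq add_diff_eq add.assoc)
qed

text \<open>At the power of v one above the degree of \<open>G\<close> only the leading coefficient
  g occurs, and every term except \<open>h1 * g\<close> is a scalar multiple of g. So
  \<open>h1 * g\<close> has at least the order of g.\<close>

lemma vanishes_below_h1:
  assumes "degree G > 0"
  shows "vanishes_below h1 0"
proof (cases "h1 = 0")
  case False
  let ?d = "degree G" and ?g = "lead_coeff G"
  have g: "?g \<noteq> 0" using assms by auto
  have "(h1 * ?g) $$ k = 0" if "k < fls_subdegree ?g" for k
    using invariant_at_inf_nth[of "Suc ?d" k] that rd_0[OF \<delta>]
    by (simp add: coeff_eq_0 rd_0[OF ring_derivation_fls_theta])
  then have "fls_subdegree ?g \<le> fls_subdegree (h1 * ?g)"
    using g False by (intro fls_subdegree_geI) auto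
  then show ?thesis
    using g False by (simp add: vanishes_below_iff)
qed simp

text \<open>The index j is chosen such that the j-th coefficient of \<open>G\<close> has the
  smallest order of all. Below that order all other terms of the identity vanish, hence so does
  \<open>h0 * coeff G j\<close>.\<close>

lemma vanishes_below_h0:
  assumes "degree G > 0" "vanishes_below F 0" "vanishes_below A 0" "vanishes_below B 0"
  shows "vanishes_below h0 0"
proof (cases "h0 = 0")
  case False
  define J where "J = {j. coeff G j \<noteq> 0}"
  have J: "finite J" "J \<noteq> {}"
    using assms(1) MOST_coeff_eq_0[of G] by (auto simp: J_def eventually_cofinite)
      (metis degree_0 leading_coeff_0_iff less_irrefl)
  then obtain j where j: "j \<in> J" and min: "\<And>i. i \<in> J \<Longrightarrow> fls_subdegree (coeff G j) \<le> fls_subdegree (coeff G i)"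
    using finite_minimiser[of J "\<lambda>i. fls_subdegree (coeff G i)"] by blast
  define \<mu> where "\<mu> = fls_subdegree (coeff G j)"
  have v: "vanishes_below (coeff G i) \<mu>" for i
    using min[of i] by (cases "i \<in> J") (auto simp: J_def \<mu>_def vanishes_below_iff)
  have vp: "vanishes_below (prev i) \<mu>" for i
    using v by (cases i) auto
  have "(h0 * coeff G j) $$ k = 0" if "k < \<mu>" for k
  proof -
    have "coeff G j $$ (k - (int M - 2)) = 0" "prev j $$ k = 0"
      using that v[of j] vp[of j] M unfolding vanishes_below_def by auto
    moreover have "(F * fls_theta (coeff G j)) $$ k = 0" "(A * coeff G (Suc j)) $$ k = 0"
      "(B * coeff G j) $$ k = 0" "(h1 * prev j) $$ k = 0"
      using that assms(2-4) v vp vanishes_below_h1[OF assms(1)]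
      by (auto intro!: fls_nth_mult_0[where a = 0 and b = \<mu>] vanishes_below_theta)
    ultimately show ?thesis
      using invariant_at_inf_nth[of j k] by (simp add: rd_0[OF \<delta>])
  qed
  then have "\<mu> \<le> fls_subdegree (h0 * coeff G j)"
    using False j by (intro fls_subdegree_geI) (auto simp: J_def)
  then show ?thesis
    using j False by (simp add: vanishes_below_iff \<mu>_def J_def)
qed simp

text \<open>Had the curve a branch tangent to \<open>F\<close> at infinity, the coefficient \<open>r\<close> would force a
  logarithm into its expansion.\<close>

lemma no_branch_at_inf:
  assumes d: "degree G > 0"
    and F: "vanishes_below F 0" "F $$ 0 = c" and c: "c \<noteq> 0"
    and A: "vanishes_below A (2 * int M)" "A $$ (2 * int M) = - r"
    and B: "vanishes_below B 0" "B $$ 0 = - of_nat M * c"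
    and G0: "vanishes_below (coeff G 0) (fls_subdegree (lead_coeff G) + 1)"
  shows "r = 0"
proof (rule ccontr)
  assume r: "r \<noteq> 0"
  define J where "J = {j. coeff G j \<noteq> 0}"
  have J: "finite J" "degree G \<in> J"
    using d MOST_coeff_eq_0[of G] by (auto simp: J_def eventually_cofinite)
  define o' where "o' j = fls_subdegree (coeff G j)" for j
  \<comment> \<open>Newton polygon with v given the weight 2 * M, the order of \<open>A\<close>. The
    smallest weight is \<nu>, and \<open>g\<close> below collects the coefficients on that
    edge.\<close>
  obtain j1 where j1: "j1 \<in> J" "\<And>i. i \<in> J \<Longrightarrow> o' j1 + 2 * int M * int j1 \<le> o' i + 2 * int M * int i"
    using finite_minimiser[of J "\<lambda>i. o' i + 2 * int M * int i"] J by blast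
  define \<nu> where "\<nu> = o' j1 + 2 * int M * int j1"
  have v: "vanishes_below (coeff G i) (\<nu> - 2 * int M * int i)" for i
    using j1(2)[of i] by (cases "i \<in> J") (auto simp: J_def \<nu>_def o'_def vanishes_below_iff)
  have vp: "vanishes_below (prev i) (\<nu> - 2 * int M * int i + 1)" for i
    using v[of "i - 1"] M by (cases i) (auto elim!: vanishes_below_mono simp: algebra_simps)
  have h1: "vanishes_below h1 0"
    using vanishes_below_h1 d by blast
  have h0: "vanishes_below h0 0"
    using vanishes_below_h0 d F A B vanishes_below_mono[of A "2 * int M" 0] by auto
  define g where "g j = coeff G j $$ (\<nu> - 2 * int M * int j)" for j
  \<comment> \<open>At the exponent \<nu> - 2 * M * j the multiples of j coming from
    \<open>fls_theta\<close> and from \<open>B\<close> cancel. They do so for the weight 2 * M only: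
    this is the resonance.\<close>
  have eq: "- (of_nat (Suc j) * r * g (Suc j)) = (h0 $$ 0 + 1/2 * c * of_int \<nu>) * g j" for j
  proof -
    let ?k = "\<nu> - 2 * int M * int j"
    have z0: "coeff G j $$ (?k - (int M - 2)) = 0" "prev j $$ ?k = 0"
      using v[of j] vp[of j] M unfolding vanishes_below_def by auto
    have z1: "(F * fls_theta (coeff G j)) $$ ?k = c * (of_int ?k * g j)"
      using fls_nth_mult_base[OF F(1) vanishes_below_theta[OF v[of j]]] F(2) by (simp add: g_def)
    have z2: "(A * coeff G (Suc j)) $$ ?k = - r * g (Suc j)"
      using fls_nth_mult_base[OF A(1) v[of "Suc j"], of ?k] A(2)
      by (simp add: g_def algebra_simps)
    have z3: "(B * coeff G j) $$ ?k = - of_nat M * c * g j"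
      using fls_nth_mult_base[OF B(1) v[of j]] B(2) by (simp add: g_def)
    have z4: "(h0 * coeff G j) $$ ?k = h0 $$ 0 * g j"
      using fls_nth_mult_base[OF h0 v[of j]] by (simp add: g_def)
    have z5: "(h1 * prev j) $$ ?k = 0"
      using fls_nth_mult_0[OF h1 vp[of j]] by simp
    show ?thesis
      using invariant_at_inf_nth[of j ?k] unfolding z0 z1 z2 z3 z4 z5
      by (simp add: rd_0[OF \<delta>] algebra_simps)
  qed
  have "finite {j. g j \<noteq> 0}" "g j1 \<noteq> 0"
    using J(1) j1(1) unfolding J_def
    by (auto simp: g_def \<nu>_def o'_def elim!: rev_finite_subset)
  then obtain j2 where j2: "g j2 \<noteq> 0" "\<And>i. g i \<noteq> 0 \<Longrightarrow> i \<le> j2"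
    by (metis (mono_tags, lifting) Max_ge Max_in empty_iff mem_Collect_eq)
  \<comment> \<open>At the largest index of the edge the left-hand side of \<open>eq\<close> is 0,
    which fixes the constant term of \<open>h0\<close>. Then the right-hand side is 0 at every
    index, and since r is nonzero, only the index 0 remains on the edge.\<close>
  have "g (Suc j2) = 0"
    using j2(2)[of "Suc j2"] by auto
  with eq[of j2] j2(1) have h00: "h0 $$ 0 = - 1/2 * c * of_int \<nu>"
    by (simp add: add_eq_0_iff2)
  have "g (Suc j) = 0" for j
    using eq[of j] r unfolding h00 by (simp del: of_nat_Suc)
  then have g_pos: "g j = 0" if "j > 0" for j
    using that by (metis gr0_implies_Suc)
  with \<open>g j1 \<noteq> 0\<close> have "j1 = 0" by auto
  then have \<nu>: "\<nu> = o' 0" and J0: "0 \<in> J"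
    using j1 by (auto simp: \<nu>_def)
  have strict: "o' 0 < o' j + 2 * int M * int j" if "j \<in> J" "j > 0" for j
  proof -
    have "o' j \<noteq> \<nu> - 2 * int M * int j"
      using g_pos[of j] that by (auto simp: g_def o'_def J_def nth_fls_subdegree_zero_iff dest: sym)
    moreover have "\<nu> - 2 * int M * int j \<le> o' j"
      using v[of j] that by (simp add: J_def vanishes_below_iff o'_def)
    ultimately show ?thesis
      by (simp add: \<nu>)
  qed
  \<comment> \<open>The polygon descends from index 0, as for a root v of positive order, and by
    \<open>strict\<close> this order would be less than 2 * M. An index of largest slope seen from 0
    will show that it equals 2 * M.\<close>
  have "o' (degree G) < o' 0"
    using G0 J0 by (simp add: vanishes_below_iff J_def o'_def)
  define S where "S = J - {0}"
  have S: "finite S" "degree G \<in> S"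
    using J d by (auto simp: S_def)
  define slope :: "nat \<Rightarrow> rat" where "slope j = of_int (o' 0 - o' j) / of_nat j" for j
  obtain j where j: "j \<in> S" "\<And>i. i \<in> S \<Longrightarrow> slope i \<le> slope j"
    using finite_minimiser[of S "\<lambda>i. - slope i"] S by auto
  then have jpos: "j > 0" "j \<in> J" by (auto simp: S_def)
  have max: "(o' 0 - o' i) * int j \<le> (o' 0 - o' j) * int i" if "i \<in> S" for i
  proof -
    have "i > 0" using that by (auto simp: S_def)
    then have "of_int (o' 0 - o' i) * (of_nat j :: rat) \<le> of_int (o' 0 - o' j) * of_nat i"
      using j(2)[OF that] jpos by (simp add: slope_def divide_simps mult_ac)
    then have "(of_int ((o' 0 - o' i) * int j) :: rat) \<le> of_int ((o' 0 - o' j) * int i)"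
      by simp
    then show ?thesis
      by (simp only: of_int_le_iff)
  qed
  define e where "e = o' 0 - o' j"
  have e: "e < 2 * int M * int j"
    using strict[of j] jpos by (simp add: e_def)
  have e0: "e > 0"
  proof -
    have "0 < (o' 0 - o' (degree G)) * int j"
      using \<open>o' (degree G) < o' 0\<close> jpos by simp
    also have "\<dots> \<le> e * int (degree G)"
      using max[OF S(2)] by (simp add: e_def)
    finally show ?thesis
      using d by (simp add: zero_less_mult_iff)
  qed
  \<comment> \<open>The slope e / j lies strictly between 0 and 2 * M. The upper bound keeps the
    term with \<open>A\<close> and index j + 1 out of the order \<open>o' j\<close>, the lower bound
    does the same for index j - 1. So the identity at (j, o' j) involves \<open>coeff G j\<close>
    alone, and it yields e = 2 * M * j.\<close>
  have vnext: "vanishes_below (coeff G (Suc j)) (o' j - 2 * int M + 1)"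
  proof (cases "Suc j \<in> J")
    case True
    then have "(o' 0 - o' (Suc j)) * int j \<le> e * (int j + 1)"
      using max[of "Suc j"] by (simp add: S_def e_def algebra_simps)
    then have "(o' 0 - o' (Suc j)) * int j < (e + 2 * int M) * int j"
      using e by (simp add: algebra_simps)
    then have "o' 0 - o' (Suc j) < e + 2 * int M"
      using jpos by simp
    then show ?thesis
      using True by (simp add: vanishes_below_iff J_def o'_def e_def)
  qed (simp add: J_def)
  have vprev: "vanishes_below (prev j) (o' j + 1)"
  proof (cases j)
    case (Suc i)
    show ?thesis
    proof (cases "i \<in> J")
      case True
      have "o' j < o' i"
      proof (cases "i = 0")
        case False
        with True have "i \<in> S" by (simp add: S_def)
        from max[OF this] have "(o' 0 - o' i) * int j \<le> e * int j - e"
          using Suc by (simp add: e_def algebra_simps)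
        also have "\<dots> < e * int j" using e0 by simp
        finally have "o' 0 - o' i < e"
          using jpos by simp
        then show ?thesis by (simp add: e_def)
      qed (use e0 in \<open>simp add: e_def\<close>)
      with True Suc show ?thesis
        by (simp add: vanishes_below_iff J_def o'_def)
    qed (use Suc in \<open>simp add: J_def\<close>)
  qed (use jpos in simp)
  have vj: "vanishes_below (coeff G j) (o' j)"
    unfolding o'_def by (rule vanishes_below_subdegree)
  let ?g = "coeff G j $$ o' j"
  have g: "?g \<noteq> 0"
    using jpos by (simp add: o'_def J_def)
  have z0: "coeff G j $$ (o' j - (int M - 2)) = 0" "prev j $$ o' j = 0"
    using vj vprev M unfolding vanishes_below_def by auto
  have z1: "(F * fls_theta (coeff G j)) $$ o' j = c * (of_int (o' j) * ?g)"
    using fls_nth_mult_base[OF F(1) vanishes_below_theta[OF vj]] F(2) by simp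
  have z2: "(A * coeff G (Suc j)) $$ o' j = 0"
    using fls_nth_mult_0[OF A(1) vnext] by simp
  have z3: "(B * coeff G j) $$ o' j = - of_nat M * c * ?g"
    using fls_nth_mult_base[OF B(1) vj] B(2) by simp
  have z4: "(h0 * coeff G j) $$ o' j = h0 $$ 0 * ?g"
    using fls_nth_mult_base[OF h0 vj] by simp
  have z5: "(h1 * prev j) $$ o' j = 0"
    using fls_nth_mult_0[OF h1 vprev] by simp
  have "(- of_nat j * of_nat M * c) * ?g = (h0 $$ 0 + 1/2 * c * of_int (o' j)) * ?g"
    using invariant_at_inf_nth[of j "o' j"] unfolding z0 z1 z2 z3 z4 z5
    by (simp add: rd_0[OF \<delta>] algebra_simps)
  then have "- of_nat j * of_nat M * c = - 1/2 * c * of_int (o' 0) + 1/2 * c * of_int (o' j)"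
    unfolding h00 \<nu> mult_right_cancel[OF g] .
  then have "2 * (- of_nat j * of_nat M * c) = - c * of_int (o' 0) + c * of_int (o' j)"
    by (simp only: distrib_left) simp
  then have "c * (of_int (o' 0) - of_int (o' j) - 2 * of_nat M * of_nat j) = 0"
    by algebra
  then have "(of_int (o' 0 - o' j - 2 * int M * int j) :: 'a) = 0"
    using c by simp
  then have "o' 0 - o' j - 2 * int M * int j = 0"
    by (simp only: of_int_eq_0_iff)
  with e show False by (simp add: e_def)
qed

text \<open>As \<open>F = 0\<close>, v stands for y * t ^ M. The part q of \<open>G\<close> of
  lowest order in t satisfies (A 0 - M / 2 * v ^ 2) * q' = (linear factor) * q, where A 0 is the
  constant term of \<open>A\<close>. A root of q loses exactly one multiplicity in q', so it is a
  root of the quadratic factor. That q has a root follows by comparing top coefficients, which shows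
  that q has the full degree of \<open>G\<close>.\<close>

lemma leading_form_at_inf:
  assumes d: "degree G > 0" and F: "F = 0" "B = 0" and A: "vanishes_below A 0"
    and closed: "\<And>q :: 'a poly. degree q > 0 \<Longrightarrow> \<exists>x. poly q x = 0"
  obtains c where "A $$ 0 = of_nat M / 2 * c\<^sup>2"
    "\<And>j. vanishes_below (coeff G j) (fls_subdegree (lead_coeff G))"
    "poly (map_poly (\<lambda>f. f $$ fls_subdegree (lead_coeff G)) G) c = 0"
proof -
  define J where "J = {j. coeff G j \<noteq> 0}"
  have J: "finite J" "degree G \<in> J"
    using d MOST_coeff_eq_0[of G] by (auto simp: J_def eventually_cofinite)
  then obtain j1 where j1: "j1 \<in> J" "\<And>i. i \<in> J \<Longrightarrow> fls_subdegree (coeff G j1) \<le> fls_subdegree (coeff G i)"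
    using finite_minimiser[of J "\<lambda>i. fls_subdegree (coeff G i)"] by blast
  define \<mu> where "\<mu> = fls_subdegree (coeff G j1)"
  define k where "k = fls_subdegree (lead_coeff G)"
  define \<eta> where "\<eta> = h1 $$ 0"
  define q where "q = map_poly (\<lambda>f. f $$ \<mu>) G"
  have coeff_q: "coeff q j = coeff G j $$ \<mu>" for j
    by (simp add: q_def coeff_map_poly)
  have v: "vanishes_below (coeff G i) \<mu>" for i
    using j1(2)[of i] by (cases "i \<in> J") (auto simp: J_def \<mu>_def vanishes_below_iff)
  have vp: "vanishes_below (prev i) \<mu>" for i
    using v by (cases i) auto
  have h1: "vanishes_below h1 0"
    using vanishes_below_h1 d by blast
  have h0: "vanishes_below h0 0"
    using vanishes_below_h0 d F A by auto
  have "q \<noteq> 0"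
    using j1(1) by (auto simp: poly_eq_iff coeff_q J_def \<mu>_def intro!: exI[of _ j1])
  have "degree q \<le> degree G"
    by (rule degree_le) (simp add: coeff_q coeff_eq_0)
  have "\<mu> \<le> k"
    using j1(2)[OF J(2)] by (simp add: \<mu>_def k_def)
  have eq: "[:A $$ 0, 0, - of_nat M / 2:] * pderiv q = [:h0 $$ 0, 1/2 * of_int \<mu> + \<eta>:] * q"
  proof (rule poly_eqI)
    fix j
    have z0: "coeff G j $$ (\<mu> - (int M - 2)) = 0"
      using v[of j] M unfolding vanishes_below_def by auto
    have z1: "(A * coeff G (Suc j)) $$ \<mu> = A $$ 0 * coeff q (Suc j)"
      using fls_nth_mult_base[OF A v[of "Suc j"]] by (simp add: coeff_q)
    have z2: "(h0 * coeff G j) $$ \<mu> = h0 $$ 0 * coeff q j"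
      using fls_nth_mult_base[OF h0 v[of j]] by (simp add: coeff_q)
    have z3: "(h1 * prev j) $$ \<mu> = \<eta> * coeff (pCons 0 q) j"
      using fls_nth_mult_base[OF h1 vp[of j]] by (cases j) (simp_all add: coeff_q \<eta>_def)
    have z4: "prev j $$ \<mu> = coeff (pCons 0 q) j"
      by (cases j) (simp_all add: coeff_q)
    have l: "coeff ([:A $$ 0, 0, - of_nat M / 2:] * pderiv q) j
      = of_nat (Suc j) * (A $$ 0 * coeff q (Suc j)) - of_nat M / 2 * (of_nat j - 1) * coeff (pCons 0 q) j"
      by (cases j) (auto simp: mult_pCons_left coeff_pCons coeff_pderiv simp del: of_nat_Suc
          split: nat.split, simp add: algebra_simps)
    have r: "coeff ([:h0 $$ 0, 1/2 * of_int \<mu> + \<eta>:] * q) j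
      = h0 $$ 0 * coeff q j + (1/2 * of_int \<mu> + \<eta>) * coeff (pCons 0 q) j"
      by (simp add: mult_pCons_left coeff_pCons split: nat.split)
    have "of_nat (Suc j) * (A $$ 0 * coeff q (Suc j)) - 1/2 * of_int \<mu> * coeff (pCons 0 q) j
       - of_nat M / 2 * (of_nat j - 1) * coeff (pCons 0 q) j = h0 $$ 0 * coeff q j + \<eta> * coeff (pCons 0 q) j"
      using invariant_at_inf_nth[of j \<mu>] unfolding z0 z1 z2 z3 z4 F
      by (simp add: rd_0[OF \<delta>])
    then show "coeff ([:A $$ 0, 0, - of_nat M / 2:] * pderiv q) j
       = coeff ([:h0 $$ 0, 1/2 * of_int \<mu> + \<eta>:] * q) j"
      unfolding l r by (simp add: algebra_simps)
  qed
  have top: "- (of_nat M / 2 * of_nat (degree q)) * lead_coeff q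
      = (1/2 * of_int \<mu> + \<eta>) * lead_coeff q"
  proof -
    have "coeff ([:A $$ 0, 0, - of_nat M / 2:] * pderiv q) (Suc (degree q))
      = coeff ([:h0 $$ 0, 1/2 * of_int \<mu> + \<eta>:] * q) (Suc (degree q))"
      by (simp only: eq)
    then show ?thesis
      by (cases "degree q") (simp_all add: mult_pCons_left coeff_pCons coeff_pderiv coeff_eq_0 mult.assoc)
  qed
  \<comment> \<open>While \<open>top\<close> expresses \<eta> by the order \<mu> and the degree of
    q, the leading coefficient of \<open>G\<close> expresses it by k and the degree of
    \<open>G\<close>.\<close>
  have \<eta>: "\<eta> = - (of_int k + of_nat M * of_nat (degree G)) / 2"
  proof -
    let ?g = "lead_coeff G $$ k"
    have "?g \<noteq> 0" using J(2) by (simp add: J_def k_def)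
    have vk: "vanishes_below (lead_coeff G) k"
      unfolding k_def by (rule vanishes_below_subdegree)
    have "(h1 * lead_coeff G) $$ k = \<eta> * ?g"
      using fls_nth_mult_base[OF h1 vk] by (simp add: \<eta>_def)
    then have "(- (1/2 * of_int k) - of_nat M / 2 * of_nat (degree G)) * ?g = \<eta> * ?g"
      using invariant_at_inf_nth[of "Suc (degree G)" k]
      by (simp add: coeff_eq_0 rd_0[OF \<delta>] rd_0[OF ring_derivation_fls_theta] F left_diff_distrib)
    then have "- (1/2 * of_int k) - of_nat M / 2 * of_nat (degree G) = \<eta>"
      by (rule iffD1[OF mult_right_cancel[OF \<open>?g \<noteq> 0\<close>]])
    then show ?thesis by (simp add: field_simps)
  qed
  have "- (of_nat M / 2 * of_nat (degree q)) = 1/2 * of_int \<mu> + \<eta>"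
    using top \<open>q \<noteq> 0\<close> by (metis leading_coeff_0_iff mult_right_cancel)
  then have "of_int k + of_nat M * of_nat (degree G) = (of_int \<mu> + of_nat M * of_nat (degree q) :: 'a)"
    unfolding \<eta> by (simp add: field_simps)
  then have "(of_int (int M * int (degree q)) :: 'a) = of_int (k + int M * int (degree G) - \<mu>)"
    by (simp add: algebra_simps)
  then have "int M * int (degree q) = k + int M * int (degree G) - \<mu>"
    by (simp only: of_int_eq_iff)
  moreover have "int M * int (degree q) \<le> int M * int (degree G)"
    using \<open>degree q \<le> degree G\<close> by (simp add: mult_left_mono)
  \<comment> \<open>The balance k + M * degree G = \<mu> + M * degree q together with \<mu> \<le> k
    and degree q \<le> degree G forces both equalities.\<close>
  ultimately have "\<mu> = k" "int M * int (degree q) = int M * int (degree G)"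
    using \<open>\<mu> \<le> k\<close> by linarith+
  then have "degree q = degree G"
    using M by simp
  then obtain c where c: "poly q c = 0"
    using closed d by metis
  have "poly [:A $$ 0, 0, - of_nat M / 2:] c = 0"
  proof (rule ccontr)
    let ?l = "[:A $$ 0, 0, - of_nat M / 2:]"
    assume nz: "poly ?l c \<noteq> 0"
    have q': "pderiv q \<noteq> 0"
      using \<open>degree q = degree G\<close> d by (simp add: pderiv_eq_0_iff)
    have "?l \<noteq> 0" using nz by auto
    then have nz': "?l * pderiv q \<noteq> 0" using q' by (rule no_zero_divisors)
    then have "order c (?l * pderiv q) = order c (pderiv q)"
      using nz order_mult[OF nz'] order_0I[of ?l c] by simp
    moreover have "order c q \<le> order c ([:h0 $$ 0, 1/2 * of_int \<mu> + \<eta>:] * q)"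
      using order_mult[OF nz'[unfolded eq]] by (metis le_add2)
    ultimately show False
      using order_pderiv[OF \<open>q \<noteq> 0\<close> c] unfolding eq by simp
  qed
  then have "A $$ 0 = of_nat M / 2 * c\<^sup>2"
    by (simp add: power2_eq_square algebra_simps)
  with c v that show ?thesis
    unfolding \<open>\<mu> = k\<close> q_def k_def by blast
qed

end

text \<open>If c is a root of the leading form, the value at a series with constant term c has order
  above k. This provides the hypothesis on the constant coefficient in
  \<open>no_branch_at_inf\<close>.\<close>

lemma poly_fls_leading:
  assumes "\<And>j. vanishes_below (coeff G j) k" "vanishes_below F 0" "F $$ 0 = c"
  shows "vanishes_below (poly G F) k \<and>
    poly G F $$ k = poly (map_poly (\<lambda>f. f $$ k) G) (c::'a::comm_ring_1)"
  using assms(1)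
proof (induction G)
  case (pCons a G)
  have a: "vanishes_below a k" and "\<And>j. vanishes_below (coeff G j) k"
    using pCons.prems[of 0] pCons.prems[of "Suc _"] by simp_all
  with pCons have *: "vanishes_below (poly G F) k"
    "poly G F $$ k = poly (map_poly (\<lambda>f. f $$ k) G) c" by blast+
  have "vanishes_below (F * poly G F) (0 + k)" "(F * poly G F) $$ k = c * poly G F $$ k"
    using vanishes_below_mult[OF assms(2) *(1)] fls_nth_mult_base[OF assms(2) *(1)] assms(3) by simp_all
  with a * show ?case
    by (simp add: map_poly_pCons vanishes_below_def)
qed simp

section \<open>Expansion of plane curves at infinity\<close>

text \<open>The substitution x = t ^ (-2). Two powers of t for each power of x give y, which has
  size x ^ (M / 2), an integral exponent also for odd M.\<close>

definition poly_at_inf :: "'a::field_char_0 poly \<Rightarrow> 'a fls" where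
  "poly_at_inf p = poly (map_poly fls_const p) (fls_X_inv\<^sup>2)"

lemma poly_at_inf_0 [simp]: "poly_at_inf 0 = 0"
  by (simp add: poly_at_inf_def)

lemma poly_at_inf_pCons [simp]:
  "poly_at_inf (pCons b p) = fls_const b + fls_X_inv\<^sup>2 * poly_at_inf p"
  by (simp add: poly_at_inf_def map_poly_pCons)

lemma poly_at_inf_nth:
  "poly_at_inf p $$ k = (if k \<le> 0 \<and> even k then coeff p (nat (- k) div 2) else 0)"
proof (induction p arbitrary: k)
  case (pCons b p)
  have "(fls_X_inv\<^sup>2 * poly_at_inf p) $$ k = poly_at_inf p $$ (k + 2)"
    by (simp add: fls_X_inv_power_times_conv_shift)
  moreover consider "k > 0" | "k = 0" | "k = -1" | "k \<le> -2" by linarith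
  then have "(if k = 0 then b else 0)
      + (if k + 2 \<le> 0 \<and> even (k + 2) then coeff p (nat (- (k + 2)) div 2) else 0)
      = (if k \<le> 0 \<and> even k then coeff (pCons b p) (nat (- k) div 2) else 0)"
  proof cases
    case 4
    then have "nat (- k) = Suc (Suc (nat (- (k + 2))))" by simp
    then have "nat (- k) div 2 = Suc (nat (- (k + 2)) div 2)" by simp
    then show ?thesis using 4 by simp
  qed auto
  ultimately show ?case
    by (simp add: pCons.IH)
qed simp

lemma poly_at_inf_nth_even: "poly_at_inf p $$ (- 2 * int i) = coeff p i"
  by (simp add: poly_at_inf_nth nat_mult_distrib)

lemma poly_at_inf_eq_0_iff [simp]: "poly_at_inf p = 0 \<longleftrightarrow> p = 0"
proof
  assume "poly_at_inf p = 0"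
  then have "poly_at_inf p $$ (- 2 * int i) = 0" for i by simp
  then show "p = 0"
    unfolding poly_at_inf_nth_even by (intro poly_eqI) simp
qed simp

lemma poly_at_inf_add: "poly_at_inf (p + q) = poly_at_inf p + poly_at_inf q"
  by (rule fls_eqI) (simp add: poly_at_inf_nth)

lemma poly_at_inf_smult: "poly_at_inf (smult b p) = fls_const b * poly_at_inf p"
  by (rule fls_eqI) (simp add: poly_at_inf_nth)

lemma poly_at_inf_mult: "poly_at_inf (p * q) = poly_at_inf p * poly_at_inf q"
  by (induction p) (simp_all add: poly_at_inf_add poly_at_inf_smult algebra_simps)

lemma poly_at_inf_map_poly:
  assumes "\<delta> 0 = 0"
  shows "poly_at_inf (map_poly \<delta> p) = fls_map \<delta> (poly_at_inf p)"
  using assms by (intro fls_eqI) (simp add: poly_at_inf_nth coeff_map_poly)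

text \<open>The chain rule for x = t ^ (-2): the Euler operator of t is -2 times that of x.\<close>

lemma theta_poly_at_inf:
  "fls_theta (poly_at_inf p) = fls_const (-2) * (fls_X_inv\<^sup>2 * poly_at_inf (pderiv p))"
proof (rule fls_eqI)
  fix k
  have "(fls_X_inv\<^sup>2 * poly_at_inf (pderiv p)) $$ k = poly_at_inf (pderiv p) $$ (k + 2)"
    by (simp add: fls_X_inv_power_times_conv_shift)
  then have r: "(fls_const (-2) * (fls_X_inv\<^sup>2 * poly_at_inf (pderiv p))) $$ k
      = (-2) * poly_at_inf (pderiv p) $$ (k + 2)"
    by (simp only: fls_mult_const_nth)
  have "k \<le> -2 \<and> even k \<or> k > 0 \<or> k = 0 \<or> odd k" by presburger
  then consider "k \<le> -2" "even k" | "k > 0" | "k = 0" | "odd k" by blast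
  then show "fls_theta (poly_at_inf p) $$ k
      = (fls_const (-2) * (fls_X_inv\<^sup>2 * poly_at_inf (pderiv p))) $$ k"
  proof cases
    case 1
    from 1(2) obtain l where l: "k = 2 * l" by (elim evenE)
    define i where "i = nat (- l - 1)"
    have k: "k = - 2 * int (Suc i)" and k2: "k + 2 = - 2 * int i"
      using 1(1) l by (simp_all add: i_def)
    show ?thesis
      unfolding r k2 fls_theta_nth poly_at_inf_nth_even coeff_pderiv
      unfolding k poly_at_inf_nth_even by (simp add: algebra_simps)
  qed (unfold r, auto simp: poly_at_inf_nth)
qed

section \<open>Plane curves and the vector field in the coordinates at infinity\<close>

lemma map_poly_at_inf_add:
  "map_poly poly_at_inf (p + q) = map_poly poly_at_inf p + map_poly poly_at_inf q"
  by (intro poly_eqI) (simp add: coeff_map_poly poly_at_inf_add)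

lemma map_poly_at_inf_smult:
  "map_poly poly_at_inf (smult b p) = smult (poly_at_inf b) (map_poly poly_at_inf p)"
  by (intro poly_eqI) (simp add: coeff_map_poly poly_at_inf_mult)

lemma map_poly_at_inf_mult:
  "map_poly poly_at_inf (p * q) = map_poly poly_at_inf p * map_poly poly_at_inf q"
  by (induction p)
    (simp_all add: map_poly_at_inf_add map_poly_at_inf_smult map_poly_pCons)

text \<open>A curve is a polynomial in y over the polynomials in x. With x = t ^ (-2) and y = (F +
  v) / t ^ M it becomes a polynomial in v.\<close>

definition curve_at_inf :: "nat \<Rightarrow> 'a::field_char_0 fls \<Rightarrow> 'a poly poly \<Rightarrow> 'a fls poly" where
  "curve_at_inf M F g = pcompose (map_poly poly_at_inf g) (smult (fls_X_inv ^ M) [:F, 1:])"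

lemma curve_at_inf_0 [simp]: "curve_at_inf M F 0 = 0"
  by (simp add: curve_at_inf_def)

lemma curve_at_inf_pCons:
  "curve_at_inf M F (pCons a g)
     = [:poly_at_inf a:] + smult (fls_X_inv ^ M) [:F, 1:] * curve_at_inf M F g"
  by (simp add: curve_at_inf_def map_poly_pCons pcompose_pCons)

lemma curve_at_inf_add:
  "curve_at_inf M F (g + h) = curve_at_inf M F g + curve_at_inf M F h"
  by (simp add: curve_at_inf_def map_poly_at_inf_add pcompose_add)

lemma curve_at_inf_smult:
  "curve_at_inf M F (smult a g) = smult (poly_at_inf a) (curve_at_inf M F g)"
  by (simp add: curve_at_inf_def map_poly_at_inf_smult pcompose_smult)

lemma curve_at_inf_mult:
  "curve_at_inf M F (g * h) = curve_at_inf M F g * curve_at_inf M F h"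
  by (simp add: curve_at_inf_def map_poly_at_inf_mult pcompose_mult)

lemma degree_map_poly_at_inf: "degree (map_poly poly_at_inf g) = degree g"
  by (rule degree_map_poly) simp

lemma degree_curve_at_inf: "degree (curve_at_inf M F g) = degree g"
  by (simp add: curve_at_inf_def degree_pcompose degree_map_poly_at_inf)

lemma curve_at_inf_shift:
  "curve_at_inf M F g = pcompose (curve_at_inf M 0 g) [:F, 1:]"
  by (simp add: curve_at_inf_def pcompose_assoc[symmetric] pcompose_pCons)

text \<open>The summands are \<delta> on the coefficients, y * dg/dx and P * dg/dy.\<close>

definition flow_derivation ::
  "('a::field_char_0 \<Rightarrow> 'a) \<Rightarrow> 'a poly \<Rightarrow> 'a poly poly \<Rightarrow> 'a poly poly" where
  "flow_derivation \<delta> P g =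
     map_poly (map_poly \<delta>) g + pCons 0 (map_poly pderiv g) + smult P (pderiv g)"

lemma flow_derivation_pCons:
  assumes "\<delta> 0 = 0"
  shows "flow_derivation \<delta> P (pCons a g)
    = pCons (map_poly \<delta> a) 0 + pCons 0 (pCons (pderiv a) 0) + smult P g
      + pCons 0 (flow_derivation \<delta> P g)"
  using assms by (simp add: flow_derivation_def map_poly_pCons pderiv_pCons smult_add_right)

text \<open>For y = F / t ^ M this is t ^ (2 * M - 2) * (P - D y), the defect of \<open>F\<close> as
  a formal solution. The quadratic terms stem from D t = - t ^ 3 * y / 2.\<close>

definition residual ::
  "('a::field_char_0 \<Rightarrow> 'a) \<Rightarrow> 'a poly \<Rightarrow> nat \<Rightarrow> 'a fls \<Rightarrow> 'a fls" where
  "residual \<delta> P M F = fls_X ^ (2 * M - 2) * poly_at_inf P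
     + fls_const (1/2) * (F * fls_theta F) - fls_const (of_nat M / 2) * (F * F)
     - fls_X ^ (M - 2) * fls_map \<delta> F"

text \<open>The coefficient of v in t ^ (M - 2) * D v, obtained by expanding at F + v with v
  independent of t.\<close>

definition linear_part :: "nat \<Rightarrow> 'a::field_char_0 fls \<Rightarrow> 'a fls" where
  "linear_part M F = fls_const (1/2) * fls_theta F - fls_const (of_nat M) * F"

text \<open>\<open>E\<close> is t ^ (M - 2) * D in the coordinates t and v. It is a derivation, and
  the substitution is a ring homomorphism, so it suffices to compute \<open>E\<close> on polynomials
  in x and on y; the rest is an induction along the Horner form of g.\<close>

lemma flow_derivation_at_inf:
  fixes \<delta> :: "'a::field_char_0 \<Rightarrow> 'a" and P :: "'a poly" and F :: "'a fls" and M :: nat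
  assumes \<delta>: "ring_derivation \<delta>" and M: "M > 2"
  defines "C \<equiv> fls_const (- of_nat M / 2)"
  defines "A \<equiv> residual \<delta> P M F" and "B \<equiv> linear_part M F"
  defines "E \<equiv> (\<lambda>G. smult (fls_X ^ (M - 2)) (map_poly (fls_map \<delta>) G)
       - smult (fls_const (1/2)) ([:F, 1:] * map_poly fls_theta G) + [:A, B, C:] * pderiv G)"
  shows "E (curve_at_inf M F g)
     = smult (fls_X ^ (M - 2)) (curve_at_inf M F (flow_derivation \<delta> P g))"
proof -
  have \<delta>0 [simp]: "\<delta> 0 = 0" by (rule rd_0[OF \<delta>])
  have d1: "ring_derivation (map_poly (fls_map \<delta>))"
    by (intro ring_derivation_map_poly ring_derivation_fls_map \<delta>)
  have d2: "ring_derivation (map_poly (fls_theta :: 'a fls \<Rightarrow> 'a fls))"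
    by (intro ring_derivation_map_poly ring_derivation_fls_theta)
  have m0 [simp]: "fls_map \<delta> 0 = 0" "fls_theta (0 :: 'a fls) = 0"
    using rd_0[OF ring_derivation_fls_map[OF \<delta>]] rd_0[OF ring_derivation_fls_theta] by auto
  have E_add: "E (G + H) = E G + E H" for G H
    by (simp add: E_def rd_add[OF d1] rd_add[OF d2] pderiv_add smult_add_right algebra_simps)
  have E_mult: "E (G * H) = E G * H + G * E H" for G H
    by (simp add: E_def rd_mult[OF d1] rd_mult[OF d2] pderiv_mult smult_add_right algebra_simps)
  define Y where "Y = smult (fls_X_inv ^ M) [:F, 1:]"
  have XX: "fls_X ^ (M - 2) * fls_X_inv ^ M = (fls_X_inv\<^sup>2 :: 'a fls)"
    using M by (intro fls_eqI) (auto simp: fls_X_power_times_conv_shift of_nat_diff)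
  have X4: "fls_X_inv ^ M * fls_X ^ (2 * M - 2) = (fls_X ^ (M - 2) :: 'a fls)"
    using M by (intro fls_eqI) (auto simp: fls_X_inv_power_times_conv_shift of_nat_diff)
  have E_const: "E [:poly_at_inf a:] = smult (fls_X ^ (M - 2))
      ([:poly_at_inf (map_poly \<delta> a):] + smult (poly_at_inf (pderiv a)) Y)" for a
  proof -
    have h: "fls_const (1/2) * fls_theta (poly_at_inf a) = - (fls_X_inv\<^sup>2 * poly_at_inf (pderiv a))"
      unfolding theta_poly_at_inf
      by (simp only: mult.assoc[symmetric] fls_const_mult_const) simp
    have "smult (fls_const (1/2)) ([:F, 1:] * [:fls_theta (poly_at_inf a):])
      = smult (fls_const (1/2) * fls_theta (poly_at_inf a)) [:F, 1:]"
      by (simp add: algebra_simps)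
    then show ?thesis
      unfolding E_def Y_def h
      by (simp add: map_poly_pCons poly_at_inf_map_poly smult_add_right XX[symmetric] mult_ac
          distrib_left)
  qed
  \<comment> \<open>The constants 1/2 and M are hidden so that normalisation treats them as ring
    elements; the halves are recombined by hf * f + hf * f = f.\<close>
  define hf m :: "'a fls" where "hf = fls_const (1/2)" and "m = fls_const (of_nat M)"
  have hm: "fls_const (of_nat M / 2) = hf * m" "C = - (hf * m)"
    by (simp_all add: hf_def m_def C_def)
  have hf: "hf * f + hf * f = f" for f
    by (simp only: hf_def distrib_right[symmetric] fls_plus_const) simp
  have E_def': "E G = smult (fls_X ^ (M - 2)) (map_poly (fls_map \<delta>) G)
       - smult hf ([:F, 1:] * map_poly fls_theta G) + [:A, B, - (hf * m):] * pderiv G" for G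
    by (simp only: E_def hm hf_def)
  have E_Y: "E Y = smult (fls_X ^ (M - 2)) [:poly_at_inf P:]"
  proof -
    have th: "fls_theta (fls_X_inv ^ M :: 'a fls) = - m * fls_X_inv ^ M"
      by (rule fls_eqI) (simp add: m_def)
    have dm: "fls_map \<delta> (fls_X_inv ^ M * F) = fls_X_inv ^ M * fls_map \<delta> F"
      by (rule fls_eqI) (simp add: fls_X_inv_power_times_conv_shift)
    have dm1: "fls_map \<delta> (fls_X_inv ^ M) = 0"
      using rd_1[OF \<delta>] by (intro fls_eqI) simp
    have thF: "fls_theta (fls_X_inv ^ M * F) = fls_X_inv ^ M * (fls_theta F - m * F)"
      by (simp add: rd_mult[OF ring_derivation_fls_theta] th algebra_simps)
    have Y: "Y = [:fls_X_inv ^ M * F, fls_X_inv ^ M:]"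
      by (simp add: Y_def)
    have B: "B = hf * fls_theta F - m * F"
      by (simp only: B_def linear_part_def hf_def m_def)
    have A: "A = fls_X ^ (2 * M - 2) * poly_at_inf P + hf * (F * fls_theta F)
        - hf * m * (F * F) - fls_X ^ (M - 2) * fls_map \<delta> F"
      by (simp only: A_def residual_def hm hf_def[symmetric])
    have "E Y = smult (fls_X_inv ^ M)
      [:fls_X ^ (M - 2) * fls_map \<delta> F - hf * (F * (fls_theta F - m * F)) + A,
        - (hf * (fls_theta F - m * F)) + hf * (m * F) + B, 0:]"
      unfolding E_def' Y
      by (simp add: map_poly_pCons pderiv_pCons dm dm1 thF th) (simp add: algebra_simps)
    also have "- (hf * (fls_theta F - m * F)) + hf * (m * F) + B = 0"
      unfolding B using hf[of "m * F"] by (simp add: algebra_simps)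
    also have "fls_X ^ (M - 2) * fls_map \<delta> F - hf * (F * (fls_theta F - m * F)) + A
        = fls_X ^ (2 * M - 2) * poly_at_inf P"
      unfolding A by (simp add: algebra_simps)
    finally show ?thesis
      by (simp add: X4 flip: mult.assoc)
  qed
  show ?thesis
  proof (induction g)
    case 0
    show ?case by (simp add: E_def flow_derivation_def)
  next
    case (pCons a g)
    have c: "curve_at_inf M F (pCons a g) = [:poly_at_inf a:] + Y * curve_at_inf M F g" for a g
      by (simp only: curve_at_inf_pCons Y_def)
    have "E (curve_at_inf M F (pCons a g))
        = E [:poly_at_inf a:] + (E Y * curve_at_inf M F g + Y * E (curve_at_inf M F g))"
      by (simp only: c E_add E_mult)
    also have "\<dots> = smult (fls_X ^ (M - 2)) (curve_at_inf M F (flow_derivation \<delta> P (pCons a g)))"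
      unfolding pCons.IH E_const E_Y flow_derivation_pCons[of \<delta>, OF \<delta>0] curve_at_inf_add c curve_at_inf_smult
      by (simp add: smult_add_right algebra_simps)
    finally show ?case .
  qed
qed

text \<open>The formal power series \<open>\<Sum>i. f i * t ^ i\<close> solves the equation up to order \<open>2 * M\<close>, the first
  order at which its coefficient is not determined by the previous ones.\<close>

definition formal_solution ::
  "('a::field_char_0 \<Rightarrow> 'a) \<Rightarrow> 'a poly \<Rightarrow> nat \<Rightarrow> (nat \<Rightarrow> 'a) \<Rightarrow> bool" where
  "formal_solution \<delta> P M f \<longleftrightarrow> (\<forall>i<2 * M.
     (if even i \<and> i \<le> 2 * M - 2 then coeff P (M - 1 - i div 2) else 0)
     + (of_nat i - 2 * of_nat M) / 4 * (\<Sum>j\<le>i. f j * f (i - j))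
     - (if M - 2 \<le> i then \<delta> (f (i - (M - 2))) else 0) = 0)"

text \<open>Since F * theta F is half of theta (F ^ 2), the quadratic terms combine into (i - 2 * M)
  / 4 times the coefficient of F ^ 2. At i = 2 * M this factor is 0 and P no longer contributes, so
  that only \<delta> (f (M + 2)) is left.\<close>

lemma residual_nth:
  fixes \<delta> :: "'a::field_char_0 \<Rightarrow> 'a"
  assumes "\<delta> 0 = 0" "M > 2"
  shows "residual \<delta> P M (fps_to_fls (Abs_fps f)) $$ int i =
     (if even i \<and> i \<le> 2 * M - 2 then coeff P (M - 1 - i div 2) else 0)
     + (of_nat i - 2 * of_nat M) / 4 * (\<Sum>j\<le>i. f j * f (i - j))
     - (if M - 2 \<le> i then \<delta> (f (i - (M - 2))) else 0)"
proof -
  let ?F = "fps_to_fls (Abs_fps f)"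
  have FF: "(?F * ?F) $$ int i = (\<Sum>j\<le>i. f j * f (i - j))"
    by (simp add: fls_times_fps_to_fls[symmetric] fps_mult_nth atLeast0AtMost)
  have "fls_theta (?F * ?F) = ?F * fls_theta ?F + ?F * fls_theta ?F"
    by (simp add: rd_mult[OF ring_derivation_fls_theta])
  then have "fls_theta (?F * ?F) $$ int i = 2 * (?F * fls_theta ?F) $$ int i"
    by simp
  then have th: "(?F * fls_theta ?F) $$ int i = of_nat i / 2 * (\<Sum>j\<le>i. f j * f (i - j))"
    by (simp add: FF)
  have P: "(fls_X ^ (2 * M - 2) * poly_at_inf P) $$ int i
      = (if even i \<and> i \<le> 2 * M - 2 then coeff P (M - 1 - i div 2) else 0)"
  proof -
    have "(fls_X ^ (2 * M - 2) * poly_at_inf P) $$ int i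
        = poly_at_inf P $$ (int i - (2 * int M - 2))"
      using assms(2) by (simp add: fls_X_power_times_conv_shift of_nat_diff add_diff_eq diff_diff_eq2)
    moreover have "nat (- (int i - (2 * int M - 2))) div 2 = M - 1 - i div 2"
      if "even i"
      using that assms(2) by (auto elim!: evenE)
    moreover have "int i - (2 * int M - 2) \<le> 0 \<longleftrightarrow> i \<le> 2 * M - 2"
      using assms(2) by linarith
    ultimately show ?thesis
      by (simp add: poly_at_inf_nth)
  qed
  have D: "(fls_X ^ (M - 2) * fls_map \<delta> ?F) $$ int i
      = (if M - 2 \<le> i then \<delta> (f (i - (M - 2))) else 0)"
  proof -
    have "(fls_X ^ (M - 2) * fls_map \<delta> ?F) $$ int i = \<delta> (?F $$ (int i - int (M - 2)))"
      using assms(1) by (simp add: fls_X_power_times_conv_shift)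
    then show ?thesis
      using assms(1) by (auto simp: nat_diff_distrib simp flip: of_nat_diff)
  qed
  show ?thesis
    unfolding residual_def fls_plus_nth fls_minus_nth P D fls_mult_const_nth th FF
    by (simp add: algebra_simps diff_divide_distrib)
qed

text \<open>The bound on the degree of P removes the negative powers of t from t ^ (2 * M - 2) *
  P.\<close>

lemma residual_vanishes_below_0:
  fixes \<delta> :: "'a::field_char_0 \<Rightarrow> 'a"
  assumes "\<delta> 0 = 0" "M > 2" "degree P \<le> M - 1" "vanishes_below F 0"
  shows "vanishes_below (residual \<delta> P M F) 0"
  unfolding vanishes_below_def
proof (intro allI impI)
  fix k :: int
  assume k: "k < 0"
  have "(fls_X ^ (2 * M - 2) * poly_at_inf P) $$ k = poly_at_inf P $$ (k - (2 * int M - 2))"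
    using assms(2) by (simp add: fls_X_power_times_conv_shift of_nat_diff add_diff_eq diff_diff_eq2)
  also have "\<dots> = 0"
  proof (cases "even k")
    case True
    then have "degree P < nat (- (k - (2 * int M - 2))) div 2"
      using k assms(2,3) by (auto elim!: evenE)
    then show ?thesis
      by (simp add: poly_at_inf_nth coeff_eq_0)
  qed (simp add: poly_at_inf_nth)
  finally have P: "(fls_X ^ (2 * M - 2) * poly_at_inf P) $$ k = 0" .
  have D: "(fls_X ^ (M - 2) * fls_map \<delta> F) $$ k = 0"
    using assms(1,4) k by (simp add: fls_X_power_times_conv_shift vanishes_below_def)
  have F: "(F * F) $$ k = 0" "(F * fls_theta F) $$ k = 0"
    using fls_nth_mult_0[OF assms(4,4)] fls_nth_mult_0[OF assms(4) vanishes_below_theta[OF assms(4)]] k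
    by auto
  show "residual \<delta> P M F $$ k = 0"
    unfolding residual_def fls_plus_nth fls_minus_nth P D fls_mult_const_nth F by simp
qed

text \<open>The curve g = 0 is invariant, with l as a denominator in x. It is expanded twice: around
  \<open>F = 0\<close>, where its leading form has a root c, and around a formal solution starting
  with c. The second time the constant coefficient has larger order than the leading one, so
  \<open>no_branch_at_inf\<close> applies with r = \<delta> (f (M + 2)).\<close>

lemma darboux_obstruction:
  fixes \<delta> :: "'a::field_char_0 \<Rightarrow> 'a"
  assumes \<delta>: "ring_derivation \<delta>" and M: "M > 2"
    and P: "degree P \<le> M - 1" "coeff P (M - 1) \<noteq> 0"
    and g: "degree g > 0" and l: "l \<noteq> 0"
    and inv: "smult l (flow_derivation \<delta> P g) = w * g"
    and closed: "\<And>q :: 'a poly. degree q > 0 \<Longrightarrow> \<exists>x. poly q x = 0"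
  obtains c where "coeff P (M - 1) = of_nat M / 2 * c\<^sup>2"
    "\<And>f. f 0 = c \<Longrightarrow> formal_solution \<delta> P M f \<Longrightarrow> \<delta> (f (M + 2)) = 0"
proof -
  have \<delta>0 [simp]: "\<delta> 0 = 0" by (rule rd_0[OF \<delta>])
  \<comment> \<open>D raises the degree in y by at most one, so the cofactor is linear in y, as in
    \<open>invariant_at_inf\<close>.\<close>
  have "degree w \<le> 1"
  proof (cases "w = 0")
    case False
    have "degree (flow_derivation \<delta> P g) \<le> Suc (degree g)"
    proof (rule degree_le, intro allI impI)
      fix i assume "Suc (degree g) < i"
      then show "coeff (flow_derivation \<delta> P g) i = 0"
        by (simp add: flow_derivation_def coeff_map_poly coeff_eq_0 coeff_pCons coeff_pderiv split: nat.split)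
    qed
    then have "degree (w * g) \<le> Suc (degree g)"
      using l by (simp flip: inv)
    then show ?thesis
      using g degree_mult_eq[OF False, of g] by (cases "g = 0") auto
  qed simp
  define h where "h F = smult (fls_X ^ (M - 2) / poly_at_inf l) (curve_at_inf M F w)" for F
  have invF: "invariant_at_inf \<delta> M F (residual \<delta> P M F) (linear_part M F)
      (coeff (h F) 0) (coeff (h F) 1) (curve_at_inf M F g)" for F
  proof -
    have "degree (h F) \<le> 1"
      using \<open>degree w \<le> 1\<close> degree_smult_le[of _ "curve_at_inf M F w"]
      by (metis degree_curve_at_inf h_def order_trans)
    then have h: "h F = [:coeff (h F) 0, coeff (h F) 1:]"
      by (intro poly_eqI) (auto simp: coeff_pCons coeff_eq_0 split: nat.split)
    have "smult (poly_at_inf l) (curve_at_inf M F (flow_derivation \<delta> P g))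
        = curve_at_inf M F w * curve_at_inf M F g"
      by (simp flip: curve_at_inf_smult curve_at_inf_mult inv)
    then have "smult (fls_X ^ (M - 2) / poly_at_inf l)
          (smult (poly_at_inf l) (curve_at_inf M F (flow_derivation \<delta> P g)))
        = h F * curve_at_inf M F g"
      by (simp add: h_def)
    then have "smult (fls_X ^ (M - 2)) (curve_at_inf M F (flow_derivation \<delta> P g))
        = h F * curve_at_inf M F g"
      using l by simp
    with flow_derivation_at_inf[OF \<delta> M, where F = F and P = P and g = g] h show ?thesis
      unfolding invariant_at_inf_def by simp
  qed
  let ?G = "curve_at_inf M 0 g"
  define k where "k = fls_subdegree (lead_coeff ?G)"
  have d: "degree (curve_at_inf M F g) > 0" for F
    using g by (simp add: degree_curve_at_inf)
  have [simp]: "fls_theta (0 :: 'a fls) = 0" "fls_map \<delta> 0 = 0"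
    using rd_0[OF ring_derivation_fls_theta] rd_0[OF ring_derivation_fls_map[OF \<delta>]] by auto
  have F0: "fps_to_fls (Abs_fps (\<lambda>_. 0)) = (0 :: 'a fls)"
    by (rule fls_eqI) simp
  have A0: "residual \<delta> P M 0 $$ 0 = coeff P (M - 1)"
    using residual_nth[where i = 0 and f = "\<lambda>_. 0" and \<delta> = \<delta> and M = M and P = P] M by (simp add: F0)
  obtain c where c: "residual \<delta> P M 0 $$ 0 = of_nat M / 2 * c\<^sup>2"
    "\<And>j. vanishes_below (coeff ?G j) k"
    "poly (map_poly (\<lambda>f. f $$ k) ?G) c = 0"
    unfolding k_def
    by (rule leading_form_at_inf[OF \<delta> M invF d refl])
      (use closed residual_vanishes_below_0[of \<delta> M P 0] M P in \<open>auto simp: linear_part_def\<close>)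
  show thesis
  proof
    show "coeff P (M - 1) = of_nat M / 2 * c\<^sup>2"
      using A0 c(1) by simp
  next
    fix f assume f: "f 0 = c" "formal_solution \<delta> P M f"
    let ?F = "fps_to_fls (Abs_fps f)" and ?H = "curve_at_inf M (fps_to_fls (Abs_fps f)) g"
    have F: "vanishes_below ?F 0" "?F $$ 0 = c"
      using f by (simp_all add: vanishes_below_def)
    have "c \<noteq> 0"
      using P(2) A0 c(1) by auto
    have A: "vanishes_below (residual \<delta> P M ?F) (2 * int M)"
      unfolding vanishes_below_def
    proof (intro allI impI)
      fix i :: int assume i: "i < 2 * int M"
      show "residual \<delta> P M ?F $$ i = 0"
      proof (cases "i < 0")
        case True
        then show ?thesis
          using residual_vanishes_below_0[of \<delta> M P ?F] M P F by (simp add: vanishes_below_def)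
      next
        case False
        then obtain n where n: "i = int n" using nonneg_int_cases[of i] by auto
        show ?thesis
          using f(2) i unfolding n residual_nth[of \<delta>, OF \<delta>0 M] by (simp add: formal_solution_def)
      qed
    qed
    have "2 * M - (M - 2) = M + 2" "\<not> 2 * M \<le> 2 * M - 2" "M - 2 \<le> 2 * M"
      using M by auto
    then have A': "residual \<delta> P M ?F $$ (2 * int M) = - \<delta> (f (M + 2))"
      using residual_nth[where i = "2 * M" and f = f and \<delta> = \<delta> and M = M and P = P] M
      by simp
    have B: "vanishes_below (linear_part M ?F) 0" "linear_part M ?F $$ 0 = - of_nat M * c"
      using F by (simp_all add: linear_part_def vanishes_below_def)
    have H: "?H = pcompose ?G [:?F, 1:]"
      by (rule curve_at_inf_shift)
    \<comment> \<open>Translating v by a series keeps the leading coefficient. The constant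
      coefficient becomes the value at that series, whose coefficient of t ^ k is the leading form
      at c, hence 0.\<close>
    have lead: "lead_coeff ?H = lead_coeff ?G"
      unfolding H by (subst lead_coeff_comp) simp_all
    have H0: "coeff ?H 0 = poly ?G ?F"
      unfolding H by (simp add: pcompose_coeff_0)
    have "vanishes_below (coeff ?H 0) k" "coeff ?H 0 $$ k = 0"
      using poly_fls_leading[OF c(2) F] c(3) unfolding H0 by auto
    then have "vanishes_below (coeff ?H 0) (fls_subdegree (lead_coeff ?H) + 1)"
      unfolding lead k_def[symmetric] vanishes_below_def by (metis zless_add1_eq)
    from no_branch_at_inf[OF \<delta> M invF d F \<open>c \<noteq> 0\<close> A A' B this]
    show "\<delta> (f (M + 2)) = 0" .
  qed
qed

section \<open>Differential polynomials\<close>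

definition subring :: "'r::comm_ring_1 set \<Rightarrow> bool" where
  "subring S \<longleftrightarrow> 1 \<in> S \<and> (\<forall>x\<in>S. \<forall>y\<in>S. x + y \<in> S \<and> x * y \<in> S) \<and> (\<forall>x\<in>S. - x \<in> S)"

context
  fixes S :: "'r::comm_ring_1 set"
  assumes S: "subring S"
begin

lemma subring_1: "1 \<in> S"
  and subring_add: "x \<in> S \<Longrightarrow> y \<in> S \<Longrightarrow> x + y \<in> S"
  and subring_mult: "x \<in> S \<Longrightarrow> y \<in> S \<Longrightarrow> x * y \<in> S"
  and subring_minus: "x \<in> S \<Longrightarrow> - x \<in> S"
  using S by (auto simp: subring_def)

lemma subring_0: "0 \<in> S"
  using subring_add[of 1 "- 1"] subring_1 subring_minus by simp

lemma subring_diff: "x \<in> S \<Longrightarrow> y \<in> S \<Longrightarrow> x - y \<in> S"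
  using subring_add[of x "- y"] subring_minus by simp

lemma subring_sum: "(\<And>i. i \<in> I \<Longrightarrow> f i \<in> S) \<Longrightarrow> sum f I \<in> S"
  by (induction I rule: infinite_finite_induct) (auto intro: subring_0 subring_add)

lemma subring_prod: "(\<And>i. i \<in> I \<Longrightarrow> f i \<in> S) \<Longrightarrow> prod f I \<in> S"
  by (induction I rule: infinite_finite_induct) (auto intro: subring_1 subring_mult)

lemma subring_power: "x \<in> S \<Longrightarrow> x ^ k \<in> S"
  by (induction k) (auto intro: subring_1 subring_mult)

lemma subring_of_nat: "of_nat k \<in> S"
  by (induction k) (auto intro: subring_0 subring_1 subring_add)

lemma subring_poly: "(\<And>k. coeff p k \<in> S) \<Longrightarrow> x \<in> S \<Longrightarrow> poly p x \<in> S"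
  by (simp add: poly_altdef subring_sum subring_mult subring_power)

end

subsection \<open>Evaluation\<close>

abbreviation "lookup \<equiv> Poly_Mapping.lookup"
abbreviation "keys \<equiv> Poly_Mapping.keys"
abbreviation "single \<equiv> Poly_Mapping.single"

definition dvar :: "'i \<times> nat \<Rightarrow> ('i, 'a::field_char_0) dpoly" where
  "dvar v = single (single v 1) 1"

abbreviation dconst :: "'a::field_char_0 \<Rightarrow> ('i, 'a) dpoly" where
  "dconst a \<equiv> single 0 a"

definition dmonom_eval :: "('a::field_char_0 \<Rightarrow> 'a) \<Rightarrow> ('i \<times> nat \<Rightarrow>\<^sub>0 nat) \<Rightarrow> ('i \<Rightarrow> 'a) \<Rightarrow> 'a" where
  "dmonom_eval \<delta> m x =
     (\<Prod>(i, k)\<in>keys m. ((\<delta> ^^ k) (x i)) ^ lookup m (i, k))"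

lemma dpoly_eval_altdef:
  "dpoly_eval \<delta> p x =
     (\<Sum>m\<in>keys p. lookup p m * dmonom_eval \<delta> m x)"
  by (simp add: dpoly_eval_def dmonom_eval_def)

lemma dmonom_eval_superset:
  assumes "finite V" "keys m \<subseteq> V"
  shows "dmonom_eval \<delta> m x = (\<Prod>(i, k)\<in>V. ((\<delta> ^^ k) (x i)) ^ lookup m (i, k))"
  unfolding dmonom_eval_def using assms
  by (intro prod.mono_neutral_left) (auto simp: in_keys_iff)

lemma dmonom_eval_add: "dmonom_eval \<delta> (m + m') x = dmonom_eval \<delta> m x * dmonom_eval \<delta> m' x"
proof -
  let ?V = "keys m \<union> keys m'"
  have fin: "finite ?V" by simp
  show ?thesis
    unfolding dmonom_eval_superset[OF fin keys_add]
      dmonom_eval_superset[OF fin Un_upper1] dmonom_eval_superset[OF fin Un_upper2]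
      prod.distrib[symmetric]
    by (intro prod.cong) (auto simp: lookup_add power_add)
qed

lemma dmonom_eval_0 [simp]: "dmonom_eval \<delta> 0 x = 1"
  by (simp add: dmonom_eval_def)

lemma dmonom_eval_single [simp]:
  "dmonom_eval \<delta> (single (i, k) e) x = ((\<delta> ^^ k) (x i)) ^ e"
  by (simp add: dmonom_eval_def)

lemma dpoly_eval_superset:
  assumes "finite V" "keys p \<subseteq> V"
  shows "dpoly_eval \<delta> p x = (\<Sum>m\<in>V. lookup p m * dmonom_eval \<delta> m x)"
  unfolding dpoly_eval_altdef using assms
  by (intro sum.mono_neutral_left) (auto simp: in_keys_iff)

lemma dpoly_eval_0 [simp]: "dpoly_eval \<delta> 0 x = 0"
  by (simp add: dpoly_eval_def)

lemma dpoly_eval_add: "dpoly_eval \<delta> (p + q) x = dpoly_eval \<delta> p x + dpoly_eval \<delta> q x"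
proof -
  let ?V = "keys p \<union> keys q"
  have fin: "finite ?V" by simp
  show ?thesis
    unfolding dpoly_eval_superset[OF fin keys_add]
      dpoly_eval_superset[OF fin Un_upper1] dpoly_eval_superset[OF fin Un_upper2]
    by (simp add: lookup_add distrib_right sum.distrib)
qed

lemma dpoly_eval_sum: "dpoly_eval \<delta> (sum f I) x = (\<Sum>i\<in>I. dpoly_eval \<delta> (f i) x)"
  by (induction I rule: infinite_finite_induct) (simp_all add: dpoly_eval_add)

lemma dpoly_eval_single [simp]:
  "dpoly_eval \<delta> (single m a) x = a * dmonom_eval \<delta> m x"
  by (simp add: dpoly_eval_altdef)

lemma dpoly_sum_singles:
  "p = (\<Sum>m\<in>keys p. single m (lookup p m))"
  by (rule poly_mapping_eqI)
    (auto simp: lookup_sum lookup_single when_def in_keys_iff)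

lemma dpoly_mult_singles:
  fixes p q :: "('i, 'a::field_char_0) dpoly"
  shows "p * q = (\<Sum>m\<in>keys p. \<Sum>m'\<in>keys q.
     single (m + m') (lookup p m * lookup q m'))"
  using arg_cong2[OF dpoly_sum_singles[of p] dpoly_sum_singles[of q], of "(*)"]
  by (simp only: sum_product mult_single)

lemma dpoly_eval_mult:
  fixes p q :: "('i, 'a::field_char_0) dpoly"
  shows "dpoly_eval \<delta> (p * q) x = dpoly_eval \<delta> p x * dpoly_eval \<delta> q x"
  unfolding dpoly_mult_singles[of p q] dpoly_eval_altdef[of \<delta> p] dpoly_eval_altdef[of \<delta> q]
  by (simp only: dpoly_eval_sum sum_product dmonom_eval_add dpoly_eval_single)
    (simp add: mult_ac)

lemma dpoly_eval_1 [simp]: "dpoly_eval \<delta> 1 x = 1"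
  by (simp flip: single_one)

lemma dpoly_eval_prod: "dpoly_eval \<delta> (prod f I) x = (\<Prod>i\<in>I. dpoly_eval \<delta> (f i) x)"
  by (induction I rule: infinite_finite_induct) (simp_all add: dpoly_eval_mult)

lemma dpoly_eval_dvar [simp]: "dpoly_eval \<delta> (dvar (i, k)) x = (\<delta> ^^ k) (x i)"
  by (simp add: dvar_def)

lemma dpoly_eval_poly_dvar:
  fixes Q :: "('i, 'a::field_char_0) dpoly poly"
  shows "dpoly_eval \<delta> (poly Q (dvar (i, k))) x
     = poly (map_poly (\<lambda>q. dpoly_eval \<delta> q x) Q) ((\<delta> ^^ k) (x i))"
  by (induction Q) (simp_all add: dpoly_eval_add dpoly_eval_mult map_poly_pCons)

subsection \<open>Coefficients and variables\<close>

text \<open>The polynomial ring over a subring \<open>S\<close> in the variables \<open>V\<close>,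
  as a subset of one type: \<open>S\<close> and \<open>V\<close> vary during the arguments, the type
  does not.\<close>

definition dpolys :: "'a::field_char_0 set \<Rightarrow> ('i \<times> nat) set \<Rightarrow> ('i, 'a) dpoly set" where
  "dpolys S V = {p. (\<forall>m. lookup p m \<in> S) \<and> dpoly_vars p \<subseteq> V}"

lemma dpolys_mono: "p \<in> dpolys S V \<Longrightarrow> S \<subseteq> S' \<Longrightarrow> V \<subseteq> V' \<Longrightarrow> p \<in> dpolys S' V'"
  by (auto simp: dpolys_def)

lemma dpolys_keys:
  "p \<in> dpolys S V \<Longrightarrow> m \<in> keys p \<Longrightarrow> keys m \<subseteq> V"
  by (auto simp: dpolys_def dpoly_vars_def)

context
  fixes S :: "'a::field_char_0 set" and V :: "('i \<times> nat) set"
  assumes S: "subring S"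
begin

lemma dpolys_single:
  assumes "a \<in> S" "keys m \<subseteq> V"
  shows "single m a \<in> dpolys S V"
  using assms subring_0[OF S]
  by (auto simp: dpolys_def dpoly_vars_def lookup_single when_def split: if_splits)

lemma dpolys_add:
  assumes "p \<in> dpolys S V" "q \<in> dpolys S V"
  shows "p + q \<in> dpolys S V"
proof -
  have "keys m \<subseteq> V" if "m \<in> keys (p + q)" for m
    using that keys_add[of p q] dpolys_keys[OF assms(1)] dpolys_keys[OF assms(2)] by blast
  then show ?thesis
    using assms by (auto simp: dpolys_def dpoly_vars_def lookup_add intro: subring_add[OF S])
qed

lemma dpolys_0: "0 \<in> dpolys S V"
  using subring_0[OF S] by (simp add: dpolys_def dpoly_vars_def)

lemma dpolys_sum: "(\<And>i. i \<in> I \<Longrightarrow> f i \<in> dpolys S V) \<Longrightarrow> sum f I \<in> dpolys S V"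
  by (induction I rule: infinite_finite_induct) (auto intro: dpolys_0 dpolys_add)

lemma dpolys_mult:
  assumes "p \<in> dpolys S V" "q \<in> dpolys S V"
  shows "p * q \<in> dpolys S V"
  unfolding dpoly_mult_singles[of p q]
proof (intro dpolys_sum dpolys_single)
  fix m m' assume m: "m \<in> keys p" "m' \<in> keys q"
  show "lookup p m * lookup q m' \<in> S"
    using assms by (auto simp: dpolys_def intro: subring_mult[OF S])
  show "keys (m + m') \<subseteq> V"
    using keys_add[of m m'] dpolys_keys[OF assms(1) m(1)] dpolys_keys[OF assms(2) m(2)] by blast
qed

lemma dpolys_const: "a \<in> S \<Longrightarrow> dconst a \<in> dpolys S V"
  by (rule dpolys_single) auto

lemma dpolys_dvar: "v \<in> V \<Longrightarrow> dvar v \<in> dpolys S V"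
  unfolding dvar_def by (rule dpolys_single) (auto intro: subring_1[OF S])

lemma subring_dpolys: "subring (dpolys S V)"
proof -
  have "1 \<in> dpolys S V"
    using dpolys_const[OF subring_1[OF S]] by simp
  moreover have "- p \<in> dpolys S V" if "p \<in> dpolys S V" for p
    using dpolys_mult[OF dpolys_const that, of "- 1"] subring_minus[OF S subring_1[OF S]]
    by (simp add: single_uminus)
  ultimately show ?thesis
    by (simp add: subring_def dpolys_add dpolys_mult)
qed

text \<open>One variable is isolated so that degrees and roots of univariate polynomials become
  available. Polynomials in v are closed under sums, and each monomial splits into a power of v and
  a monomial without v.\<close>

lemma dpolys_decompose:
  assumes "p \<in> dpolys S (insert v V)"
  obtains Q where "\<And>k. coeff Q k \<in> dpolys S V" "p = poly Q (dvar v)"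
proof -
  define R where "R = {poly Q (dvar v) | Q. \<forall>k. coeff Q k \<in> dpolys S V}"
  have R_add: "a + b \<in> R" if ab: "a \<in> R" "b \<in> R" for a b
  proof -
    from ab obtain Q Q' where "a = poly Q (dvar v)" "b = poly Q' (dvar v)"
      "\<forall>k. coeff Q k \<in> dpolys S V" "\<forall>k. coeff Q' k \<in> dpolys S V"
      unfolding R_def by blast
    then have "a + b = poly (Q + Q') (dvar v)" "\<forall>k. coeff (Q + Q') k \<in> dpolys S V"
      by (auto intro: dpolys_add)
    then show ?thesis unfolding R_def by blast
  qed
  have R_single: "single m a \<in> R"
    if "a \<in> S" "keys m \<subseteq> insert v V" for m a
  proof -
    define e where "e = lookup m v"
    define m' where "m' = m - single v e"
    have m: "m = m' + single v e"
      by (rule poly_mapping_eqI) (simp add: m'_def lookup_add lookup_minus lookup_single e_def when_def)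
    have m'v: "lookup m' v = 0"
      by (simp add: m'_def lookup_minus e_def)
    have "keys m' \<subseteq> insert v V"
    proof
      fix u assume "u \<in> keys m'"
      then have "u \<in> keys m"
        by (auto simp: m'_def in_keys_iff lookup_minus simp del: split_paired_All)
      with that(2) show "u \<in> insert v V" by blast
    qed
    moreover have "v \<notin> keys m'"
      using m'v by (simp add: in_keys_iff)
    ultimately have m': "keys m' \<subseteq> V"
      by blast
    have "(dvar v :: ('i, 'a) dpoly) ^ e = single (single v e) 1" for e
      by (induction e) (simp_all add: dvar_def mult_single flip: single_add)
    then have "single m a = poly (monom (single m' a) e) (dvar v)"
      by (simp add: poly_monom mult_single m)
    moreover have "\<forall>k. coeff (monom (single m' a) e) k \<in> dpolys S V"
      using dpolys_single[OF that(1) m'] dpolys_0 by simp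
    ultimately show ?thesis
      unfolding R_def by blast
  qed
  have R_0: "0 \<in> R"
    unfolding R_def using dpolys_0 by (auto intro!: exI[of _ 0])
  have R_sum: "(\<And>i. i \<in> I \<Longrightarrow> f i \<in> R) \<Longrightarrow> sum f I \<in> R" for f :: "'b \<Rightarrow> _" and I
    by (induction I rule: infinite_finite_induct) (auto intro: R_0 R_add)
  have "p \<in> R"
    by (subst dpoly_sum_singles)
      (use assms dpolys_keys[OF assms] in \<open>auto simp: dpolys_def intro!: R_sum R_single\<close>)
  then show ?thesis
    using that unfolding R_def by blast
qed

end

lemma lookup_dvar_mult:
  fixes p :: "('i, 'a::field_char_0) dpoly"
  shows "lookup (dvar v * p) (single v 1 + m) = lookup p m"
    and "lookup m v = 0 \<Longrightarrow> lookup (dvar v * p) m = 0"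
proof -
  let ?v = "single v (1::nat)"
  have *: "dvar v * p = (\<Sum>m'\<in>keys p.
      single (?v + m') (lookup p m'))"
    unfolding dvar_def dpoly_mult_singles[of _ p] by simp
  have l: "lookup (dvar v * p) m'' = (\<Sum>m'\<in>keys p.
      if ?v + m' = m'' then lookup p m' else 0)" for m''
    unfolding * lookup_sum by (simp only: lookup_single when_def)
  have "lookup (dvar v * p) (?v + m) = (\<Sum>m'\<in>keys p.
      if m' = m then lookup p m' else 0)"
    unfolding l by (simp only: add_left_cancel)
  then show "lookup (dvar v * p) (?v + m) = lookup p m"
    by (simp add: in_keys_iff)
  assume "lookup m v = 0"
  then have "?v + m' \<noteq> m" for m'
    by (metis add_is_0 lookup_add lookup_single_eq zero_neq_one)
  then show "lookup (dvar v * p) m = 0"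
    unfolding l by simp
qed

text \<open>As v occurs neither in the coefficients nor in m, the monomial v ^ k * m can only come
  from the k-th coefficient.\<close>

lemma lookup_poly_dvar:
  fixes Q :: "('i, 'a::field_char_0) dpoly poly"
  assumes "\<And>k. v \<notin> dpoly_vars (coeff Q k)" "lookup m v = 0"
  shows "lookup (poly Q (dvar v)) (single v k + m)
    = lookup (coeff Q k) m"
  using assms(1)
proof (induction Q arbitrary: k)
  case (pCons a Q)
  have a: "v \<notin> dpoly_vars a" and Q: "\<And>k. v \<notin> dpoly_vars (coeff Q k)"
    using pCons.prems[of 0] pCons.prems[of "Suc _"] by simp_all
  show ?case
  proof (cases k)
    case 0
    then show ?thesis
      using assms(2) by (simp add: lookup_add lookup_dvar_mult(2))
  next
    case (Suc l)
    have "v \<in> keys (single v k + m)"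
      using Suc by (simp add: in_keys_iff lookup_add)
    then have "lookup a (single v k + m) = 0"
      using a unfolding dpoly_vars_def by (metis UN_I in_keys_iff)
    moreover have "single v k + m = single v 1 + (single v l + m)"
      using Suc by (simp flip: single_add add: add.assoc[symmetric])
    ultimately show ?thesis
      using pCons.IH[OF Q, of l] Suc by (simp add: lookup_add lookup_dvar_mult(1)[unfolded One_nat_def])
  qed
qed simp

lemma dpolys_vars_notin: "q \<in> dpolys S V \<Longrightarrow> v \<notin> V \<Longrightarrow> v \<notin> dpoly_vars q"
  by (auto simp: dpolys_def)

text \<open>Different powers of v cannot cancel. This gives the uniqueness of the expansion in v and
  also shows that v really occurs, which determines orders.\<close>

lemma poly_dvar_key:
  fixes Q :: "('i, 'a::field_char_0) dpoly poly"
  assumes "\<And>k. coeff Q k \<in> dpolys S V" "v \<notin> V" "coeff Q k \<noteq> 0"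
  obtains m where "m \<in> keys (poly Q (dvar v))" "lookup m v = k"
proof -
  obtain m where m: "m \<in> keys (coeff Q k)"
    using assms(3) by (metis all_not_in_conv keys_eq_empty)
  then have "v \<notin> keys m"
    using dpolys_keys[OF assms(1) m] assms(2) by auto
  then have mv: "lookup m v = 0"
    by (simp add: in_keys_iff)
  have "lookup (poly Q (dvar v)) (single v k + m) \<noteq> 0"
    using m lookup_poly_dvar[OF dpolys_vars_notin[OF assms(1,2)] mv] by (simp add: in_keys_iff)
  then show ?thesis
    using that mv by (simp add: in_keys_iff lookup_add)
qed

lemma poly_dvar_eq_0_iff:
  fixes Q :: "('i, 'a::field_char_0) dpoly poly"
  assumes "\<And>k. coeff Q k \<in> dpolys S V" "v \<notin> V"
  shows "poly Q (dvar v) = 0 \<longleftrightarrow> Q = 0"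
proof
  assume "poly Q (dvar v) = 0"
  then have "coeff Q k = 0" for k
    using poly_dvar_key[OF assms, of k] by (metis empty_iff keys_zero)
  then show "Q = 0"
    by (simp add: poly_eq_iff)
qed simp

subsection \<open>Blum's axioms\<close>

definition below :: "nat \<Rightarrow> (unit \<times> nat) set" where
  "below N = {()} \<times> {..<N}"

lemma dpoly_order_less:
  assumes "g \<in> dpolys S (below N)"
  shows "dpoly_order g < int N"
proof -
  have "finite (dpoly_vars g)"
    by (simp add: dpoly_vars_def)
  moreover have "snd ` dpoly_vars g \<subseteq> {..<N}"
    using assms by (auto simp: dpolys_def below_def)
  ultimately show ?thesis
    by (auto simp: dpoly_order_def)
qed

lemma dpoly_order_ge:
  assumes "((), N) \<in> dpoly_vars f"
  shows "int N \<le> dpoly_order f"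
proof -
  have "finite (dpoly_vars f)"
    by (simp add: dpoly_vars_def)
  then have "N \<le> Max (snd ` dpoly_vars f)"
    using assms by (intro Max_ge) force+
  then show ?thesis
    using assms by (auto simp: dpoly_order_def)
qed

text \<open>The form used for extensions. Positive degree of Q makes the N-th derivative occur, so
  the order of the equation is at least N and exceeds that of g.\<close>

lemma blum:
  assumes "differentially_closed \<delta>" "g \<noteq> 0" "g \<in> dpolys UNIV (below N)"
    and "\<And>k. coeff Q k \<in> dpolys UNIV (below N)" "degree Q > 0"
  obtains x where "dpoly_eval \<delta> (poly Q (dvar ((), N))) (\<lambda>_. x) = 0" "dpoly_eval \<delta> g (\<lambda>_. x) \<noteq> 0"
proof -
  have "lead_coeff Q \<noteq> 0"
    using assms(5) by auto
  then obtain m where "m \<in> keys (poly Q (dvar ((), N)))"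
    "lookup m ((), N) = degree Q"
    using poly_dvar_key[OF assms(4), of "((), N)" "degree Q"] by (auto simp: below_def)
  then have "((), N) \<in> dpoly_vars (poly Q (dvar ((), N)))"
    using assms(5) by (auto simp: dpoly_vars_def in_keys_iff intro!: bexI[of _ m])
  then have "dpoly_order g < dpoly_order (poly Q (dvar ((), N)))"
    using dpoly_order_less[OF assms(3)] dpoly_order_ge by fastforce
  then show ?thesis
    using assms(1,2) that unfolding differentially_closed_def by blast
qed

lemma algebraically_closed:
  fixes \<delta> :: "'a::field_char_0 \<Rightarrow> 'a" and q :: "'a poly"
  assumes "differentially_closed \<delta>" "degree q > 0"
  shows "\<exists>x. poly q x = 0"
proof -
  have sub: "subring (UNIV :: 'a set)"
    by (simp add: subring_def)
  define Q :: "(unit, 'a) dpoly poly" where "Q = map_poly dconst q"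
  have "degree Q = degree q"
    unfolding Q_def by (rule degree_map_poly) (metis lookup_single_eq lookup_zero)
  moreover have "coeff Q k \<in> dpolys UNIV (below 0)" for k
    by (simp add: Q_def coeff_map_poly dpolys_const[OF sub])
  moreover have "(1 :: (unit, 'a) dpoly) \<in> dpolys UNIV (below 0)"
    by (rule subring_1[OF subring_dpolys[OF sub]])
  ultimately obtain x where "dpoly_eval \<delta> (poly Q (dvar ((), 0))) (\<lambda>_. x) = 0"
    using blum[OF assms(1), of 1 0 Q] assms(2) by (metis zero_neq_one)
  then have "poly (map_poly (\<lambda>c. dpoly_eval \<delta> c (\<lambda>_. x)) Q) x = 0"
    by (simp add: dpoly_eval_poly_dvar)
  moreover have "map_poly (\<lambda>c. dpoly_eval \<delta> c (\<lambda>_. x)) Q = q"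
    by (simp add: Q_def map_poly_map_poly o_def)
  ultimately show ?thesis
    by auto
qed

section \<open>The obstruction is nonzero for generic coefficients\<close>

text \<open>The equation at order i solved for f i, which occurs in the sum of products with the
  factor 2 * f 0 = 2 * c. The value 0 for 2 * M \<le> i is a default: at i = 2 * M the recursion
  would divide by 0, and \<open>formal_solution\<close> stops before. M > 2 makes i - (M - 2) less
  than i, so the recursion ends.\<close>

function formal_coeff :: "('a::field_char_0 \<Rightarrow> 'a) \<Rightarrow> 'a poly \<Rightarrow> nat \<Rightarrow> 'a \<Rightarrow> nat \<Rightarrow> 'a" where
  "formal_coeff \<delta> P M c i =
     (if i = 0 then c else if 2 * M \<le> i \<or> M \<le> 2 then 0 else
       (4 / (2 * of_nat M - of_nat i) *
          ((if even i \<and> i \<le> 2 * M - 2 then coeff P (M - 1 - i div 2) else 0)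
           - (if M - 2 \<le> i then \<delta> (formal_coeff \<delta> P M c (i - (M - 2))) else 0))
        - (\<Sum>j\<in>{1..<i}. formal_coeff \<delta> P M c j * formal_coeff \<delta> P M c (i - j))) / (2 * c))"
  by pat_completeness auto
termination
  by (relation "measure (\<lambda>(\<delta>, P, M, c, i). i)") auto

declare formal_coeff.simps [simp del]

lemma formal_solution_formal_coeff:
  assumes "M > 2" "c \<noteq> 0" "coeff P (M - 1) = of_nat M / 2 * c\<^sup>2"
  shows "formal_solution \<delta> P M (formal_coeff \<delta> P M c)"
  unfolding formal_solution_def
proof (intro allI impI)
  fix i assume i: "i < 2 * M"
  let ?f = "formal_coeff \<delta> P M c"
  let ?p = "if even i \<and> i \<le> 2 * M - 2 then coeff P (M - 1 - i div 2) else 0"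
  let ?d = "if M - 2 \<le> i then \<delta> (?f (i - (M - 2))) else 0"
  show "?p + (of_nat i - 2 * of_nat M) / 4 * (\<Sum>j\<le>i. ?f j * ?f (i - j)) - ?d = 0"
  proof (cases "i = 0")
    case True
    then show ?thesis
      using assms by (simp add: formal_coeff.simps[of _ _ _ _ 0] power2_eq_square field_simps)
  next
    case False
    let ?s = "\<Sum>j\<in>{1..<i}. ?f j * ?f (i - j)"
    have "{..i} = insert 0 (insert i {1..<i})"
      using False by auto
    then have "(\<Sum>j\<le>i. ?f j * ?f (i - j)) = 2 * c * ?f i + ?s"
      using False by (simp add: formal_coeff.simps[of _ _ _ _ 0])
    also have "2 * c * ?f i = 4 / (2 * of_nat M - of_nat i) * (?p - ?d) - ?s"
      using False i assms by (subst formal_coeff.simps) (simp add: not_le)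
    finally have *: "(\<Sum>j\<le>i. ?f j * ?f (i - j)) = 4 / (2 * of_nat M - of_nat i) * (?p - ?d)"
      by simp
    have "(of_nat (2 * M) :: 'a) \<noteq> of_nat i"
      using i by (simp only: of_nat_eq_iff)
    then have "(2 * of_nat M :: 'a) - of_nat i \<noteq> 0" by simp
    then have "(of_nat i - 2 * of_nat M) / 4 * (4 / (2 * of_nat M - of_nat i) * (?p - ?d)) = - (?p - ?d)"
      by (simp add: field_simps)
    then show ?thesis
      unfolding * by simp
  qed
qed

section \<open>The differential ring generated by the coefficients\<close>

lemma dpoly_eval_in_subring:
  assumes "subring W" "\<And>m. lookup p m \<in> W"
    and "\<And>i k. (i, k) \<in> dpoly_vars p \<Longrightarrow> (\<delta> ^^ k) (x i) \<in> W"
  shows "dpoly_eval \<delta> p x \<in> W"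
proof -
  have "(\<delta> ^^ k) (x i) ^ e \<in> W" if "m \<in> keys p" "(i, k) \<in> keys m" for m i k e
    using that assms(3)[of i k] by (auto simp: dpoly_vars_def intro: subring_power[OF assms(1)])
  then show ?thesis
    unfolding dpoly_eval_def
    by (intro subring_sum[OF assms(1)] subring_mult[OF assms(1)]
        subring_prod[OF assms(1)] assms(2)) auto
qed

lemma subring_Rats: "subring \<rat>"
  by (auto simp: subring_def)

lemma rd_Rats:
  fixes \<delta> :: "'a::field_char_0 \<Rightarrow> 'a"
  assumes "ring_derivation \<delta>" "r \<in> \<rat>"
  shows "\<delta> r = 0"
proof -
  obtain q where q: "r = of_rat q"
    using assms(2) by (elim Rats_cases)
  obtain i j where "q = Fract i j" "j > 0"
    by (rule Rat_cases)
  with q have r: "r = of_int i / of_int j" "j \<noteq> 0"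
    by (simp_all add: of_rat_rat)
  have int: "\<delta> (of_int i) = 0" for i
    by (cases i rule: int_cases2) (simp_all add: rd_of_nat[OF assms(1)] rd_minus[OF assms(1)])
  have "of_int j * r = of_int i"
    using r by simp
  then have "\<delta> (of_int j * r) = 0"
    by (simp add: int)
  then show ?thesis
    using r(2) by (simp add: rd_mult[OF assms(1)] int)
qed

definition force :: "'a::field_char_0 \<Rightarrow> (nat \<Rightarrow> 'a) \<Rightarrow> nat \<Rightarrow> 'a poly" where
  "force \<alpha> a n = [:\<alpha>:] - (\<Sum>i=1..n. monom (a i) i)"

lemma poly_force: "poly (force \<alpha> a n) x = \<alpha> - (\<Sum>i=1..n. a i * x ^ i)"
  by (simp add: force_def poly_sum poly_monom)

lemma coeff_force:
  "coeff (force \<alpha> a n) i = (if i = 0 then \<alpha> else if i \<le> n then - a i else 0)"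
  by (auto simp: force_def coeff_sum coeff_pCons split: nat.split)

lemma degree_force: "degree (force \<alpha> a n) \<le> n"
  by (rule degree_le) (auto simp: coeff_force)

locale generic_coefficients =
  fixes \<delta> :: "'a::field_char_0 \<Rightarrow> 'a" and n :: nat and \<alpha> :: 'a and a :: "nat \<Rightarrow> 'a"
  assumes \<delta>: "ring_derivation \<delta>" and n: "n \<ge> 8"
    and indep: "diff_independent \<delta> \<rat> (\<alpha> # map a [0..<Suc n])"
begin

abbreviation "xs \<equiv> \<alpha> # map a [0..<Suc n]"

text \<open>The index \<open>n - 1\<close> in \<open>xs\<close> belongs to \<open>a (n - 2)\<close>; the ring \<open>R k\<close> omits its derivatives of
  order at least \<open>k\<close>.\<close>

definition V :: "nat \<Rightarrow> (nat \<times> nat) set" where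
  "V k = {(l, e). l < n + 2 \<and> (l = n - 1 \<longrightarrow> e < k)}"

definition R :: "nat \<Rightarrow> 'a set" where
  "R k = (\<lambda>p. dpoly_eval \<delta> p ((!) xs)) ` dpolys \<rat> (V k)"

lemma subring_R: "subring (R k)"
proof -
  have sub: "subring (dpolys \<rat> (V k))"
    by (rule subring_dpolys[OF subring_Rats])
  have minus: "dpoly_eval \<delta> (- p) x = - dpoly_eval \<delta> p x" for p :: "(nat, 'a) dpoly" and x
    using dpoly_eval_add[of \<delta> p "- p" x] by (simp add: eq_neg_iff_add_eq_0 add.commute)
  have "dpoly_eval \<delta> 1 ((!) xs) \<in> R k"
    unfolding R_def by (rule imageI[OF subring_1[OF sub]])
  moreover have "x + y \<in> R k \<and> x * y \<in> R k" if "x \<in> R k" "y \<in> R k" for x y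
    using that unfolding R_def
    by (auto simp flip: dpoly_eval_add dpoly_eval_mult
        intro: imageI subring_add[OF sub] subring_mult[OF sub])
  moreover have "- x \<in> R k" if "x \<in> R k" for x
    using that unfolding R_def by (auto simp flip: minus intro: imageI subring_minus[OF sub])
  ultimately show ?thesis
    by (simp add: subring_def)
qed

lemma R_Rats: "r \<in> \<rat> \<Longrightarrow> r \<in> R k"
  unfolding R_def by (rule image_eqI[OF _ dpolys_const[OF subring_Rats]]) simp_all

lemma R_mono: "k \<le> k' \<Longrightarrow> x \<in> R k \<Longrightarrow> x \<in> R k'"
  unfolding R_def V_def by (rule subsetD[OF image_mono]) (auto elim!: dpolys_mono)

lemma R_var: "(l, e) \<in> V k \<Longrightarrow> (\<delta> ^^ e) (xs ! l) \<in> R k"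
  unfolding R_def by (rule image_eqI[OF _ dpolys_dvar[OF subring_Rats]]) simp_all

text \<open>The elements of R (Suc k) whose derivative lies in R (Suc k) form a subring. It contains
  the rationals and the generators of R k.\<close>

lemma R_\<delta>:
  assumes "x \<in> R k"
  shows "\<delta> x \<in> R (Suc k)"
proof -
  define W where "W = {s \<in> R (Suc k). \<delta> s \<in> R (Suc k)}"
  have W: "subring W"
    unfolding subring_def W_def using subring_R[of "Suc k"]
    by (auto simp: rd_add[OF \<delta>] rd_mult[OF \<delta>] rd_minus[OF \<delta>] rd_1[OF \<delta>]
        intro: subring_1 subring_add subring_mult subring_minus subring_0)
  obtain p where p: "p \<in> dpolys \<rat> (V k)" "x = dpoly_eval \<delta> p ((!) xs)"
    using assms by (auto simp: R_def)
  have "x \<in> W"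
    unfolding p(2)
  proof (rule dpoly_eval_in_subring[OF W])
    fix m
    have "lookup p m \<in> \<rat>"
      using p(1) by (simp add: dpolys_def)
    then show "lookup p m \<in> W"
      by (simp add: W_def R_Rats rd_Rats[OF \<delta>])
  next
    fix i e assume "(i, e) \<in> dpoly_vars p"
    then have "(i, e) \<in> V k"
      using p(1) by (auto simp: dpolys_def)
    then have "(i, e) \<in> V (Suc k)" "(i, Suc e) \<in> V (Suc k)"
      by (auto simp: V_def)
    then show "(\<delta> ^^ e) (xs ! i) \<in> W"
      using R_var[of i e "Suc k"] R_var[of i "Suc e" "Suc k"] by (simp add: W_def)
  qed
  then show ?thesis
    by (simp add: W_def)
qed

lemma xs_nth: "i \<le> n \<Longrightarrow> xs ! Suc i = a i"
  by (simp del: upt_Suc)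

lemma force_in_R:
  assumes "i \<noteq> n - 2 \<or> k > 0"
  shows "coeff (force \<alpha> a n) i \<in> R k"
proof (cases "i = 0")
  case True
  have "(0, 0) \<in> V k"
    using n by (simp add: V_def)
  from R_var[OF this] show ?thesis
    using True by (simp add: coeff_force)
next
  case False
  show ?thesis
  proof (cases "i \<le> n")
    case True
    then have "(Suc i, 0) \<in> V k"
      using assms n by (auto simp: V_def)
    from R_var[OF this] have "a i \<in> R k"
      using xs_nth[OF True] by simp
    then show ?thesis
      using False True by (simp add: coeff_force subring_minus[OF subring_R])
  qed (simp add: coeff_force subring_0[OF subring_R])
qed

lemma indep_eval:
  assumes "p \<in> dpolys \<rat> (V k)" "dpoly_eval \<delta> p ((!) xs) = 0"
  shows "p = 0"
proof (rule ccontr)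
  assume "p \<noteq> 0"
  moreover have "fst ` dpoly_vars p \<subseteq> {..<length xs}"
    using assms(1) by (auto simp: dpolys_def V_def)
  ultimately show False
    using indep assms unfolding diff_independent_def dpolys_def by (auto simp del: upt_Suc)
qed

text \<open>The k-th derivative of a (n - 2) is a variable foreign to R k, so the relation is the
  zero polynomial in it. Degree two is what arises when the square root c is eliminated.\<close>

lemma quadratic_independence:
  assumes "s0 \<in> R k" "s1 \<in> R k" "s2 \<in> R k"
    and "s2 * ((\<delta> ^^ k) (a (n - 2)))\<^sup>2 + s1 * (\<delta> ^^ k) (a (n - 2)) + s0 = 0"
  shows "s2 = 0"
proof -
  obtain q0 q1 q2 where q: "q0 \<in> dpolys \<rat> (V k)" "q1 \<in> dpolys \<rat> (V k)" "q2 \<in> dpolys \<rat> (V k)"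
    "s0 = dpoly_eval \<delta> q0 ((!) xs)" "s1 = dpoly_eval \<delta> q1 ((!) xs)" "s2 = dpoly_eval \<delta> q2 ((!) xs)"
    using assms(1-3) by (auto simp: R_def)
  let ?v = "(n - 1, k)" and ?Q = "[:q0, q1, q2:]"
  have x: "xs ! (n - 1) = a (n - 2)"
    using xs_nth[of "n - 2"] n by (simp add: Suc_diff_Suc numeral_2_eq_2 del: upt_Suc)
  have V: "V k \<subseteq> V (Suc k)" "?v \<in> V (Suc k)" "?v \<notin> V k"
    using n by (auto simp: V_def)
  have sub: "subring (dpolys \<rat> (V (Suc k)) :: (nat, 'a) dpoly set)"
    by (rule subring_dpolys[OF subring_Rats])
  have "(0 :: (nat, 'a) dpoly) \<in> dpolys \<rat> (V k)"
    by (rule dpolys_0[OF subring_Rats])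
  then have co: "coeff ?Q j \<in> dpolys \<rat> (V k)" for j
    using q by (simp add: coeff_pCons split: nat.split)
  then have "poly ?Q (dvar ?v) \<in> dpolys \<rat> (V (Suc k))"
    using V by (intro subring_poly[OF sub] dpolys_dvar[OF subring_Rats])
      (meson dpolys_mono order_refl)
  moreover have "dpoly_eval \<delta> (poly ?Q (dvar ?v)) ((!) xs) = 0"
    using assms(4) unfolding dpoly_eval_poly_dvar x q(4-6)
    by (simp add: map_poly_pCons algebra_simps power2_eq_square)
  ultimately have "poly ?Q (dvar ?v) = 0"
    by (rule indep_eval)
  then have "?Q = 0"
    using poly_dvar_eq_0_iff[OF co V(3)] by blast
  then show ?thesis
    using q(6) by simp
qed

definition p where "p = coeff (force \<alpha> a n) n"

lemma p_in_R: "p \<in> R k"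
  unfolding p_def using n by (intro force_in_R) auto

lemma p_neq_0: "p \<noteq> 0"
proof
  assume "p = 0"
  then have "a n = 0"
    using n by (simp add: p_def coeff_force)
  moreover have "dvar (Suc n, 0) \<in> dpolys \<rat> (V 0)"
    using n by (intro dpolys_dvar[OF subring_Rats]) (simp add: V_def)
  moreover have "dpoly_eval \<delta> (dvar (Suc n, 0)) ((!) xs) = a n"
    using xs_nth[of n] by simp
  ultimately have "(dvar (Suc n, 0) :: (nat, 'a) dpoly) = 0"
    using indep_eval by metis
  then have "lookup (dvar (Suc n, 0) :: (nat, 'a) dpoly) (single (Suc n, 0) 1) = 0"
    by simp
  then show False
    by (simp add: dvar_def)
qed

context
  fixes c :: 'a and M :: nat
  assumes M: "M = Suc n" and c: "p = of_nat M / 2 * c\<^sup>2"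
begin

lemma c_neq_0: "c \<noteq> 0"
  using c p_neq_0 by auto

text \<open>The ring R k [c, 1 / p]. As c ^ 2 is a rational multiple of p, elements u + w * c over
  powers of p suffice. Division by c stays inside because 1 / c = (M / 2) * c / p.\<close>

definition K :: "nat \<Rightarrow> 'a set" where
  "K k = {x. \<exists>N. \<exists>u\<in>R k. \<exists>w\<in>R k. p ^ N * x = u + w * c}"

lemma K_I: "u \<in> R k \<Longrightarrow> w \<in> R k \<Longrightarrow> p ^ N * x = u + w * c \<Longrightarrow> x \<in> K k"
  unfolding K_def by blast

lemma c_sq: "c\<^sup>2 = 2 / of_nat M * p" "2 / of_nat M * p \<in> R k"
proof -
  show "c\<^sup>2 = 2 / of_nat M * p"
    unfolding c using M by (simp del: of_nat_Suc)
  show "2 / of_nat M * p \<in> R k"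
    by (intro subring_mult[OF subring_R] p_in_R R_Rats) auto
qed

lemma K_subring: "subring (K k)"
  unfolding subring_def
proof (intro conjI ballI)
  note ring = subring_add[OF subring_R] subring_mult[OF subring_R]
    subring_minus[OF subring_R] subring_power[OF subring_R] p_in_R c_sq(2)
  show "1 \<in> K k"
    by (rule K_I[of 1 _ 0 0]) (auto intro: subring_1[OF subring_R] subring_0[OF subring_R])
  fix x assume "x \<in> K k"
  then obtain N u w where x: "u \<in> R k" "w \<in> R k" "p ^ N * x = u + w * c"
    unfolding K_def by blast
  show "- x \<in> K k"
    by (rule K_I[of "- u" _ "- w" N]) (use x in \<open>auto intro: ring simp: algebra_simps\<close>)
  fix y assume "y \<in> K k"
  then obtain N' u' w' where y: "u' \<in> R k" "w' \<in> R k" "p ^ N' * y = u' + w' * c"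
    unfolding K_def by blast
  show "x + y \<in> K k"
  proof (rule K_I[of "p ^ N' * u + p ^ N * u'" _ "p ^ N' * w + p ^ N * w'" "N + N'"])
    have "p ^ (N + N') * (x + y) = p ^ N' * (p ^ N * x) + p ^ N * (p ^ N' * y)"
      by (simp add: power_add algebra_simps)
    then show "p ^ (N + N') * (x + y) = p ^ N' * u + p ^ N * u' + (p ^ N' * w + p ^ N * w') * c"
      unfolding x y by (simp add: algebra_simps)
  qed (intro ring x y)+
  show "x * y \<in> K k"
  proof (rule K_I[of "u * u' + w * w' * (2 / of_nat M * p)" _ "u * w' + w * u'" "N + N'"])
    have "p ^ (N + N') * (x * y) = (p ^ N * x) * (p ^ N' * y)"
      by (simp add: power_add algebra_simps)
    then show "p ^ (N + N') * (x * y)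
        = u * u' + w * w' * (2 / of_nat M * p) + (u * w' + w * u') * c"
      unfolding x y c_sq(1)[symmetric] by (simp add: algebra_simps power2_eq_square)
  qed (intro ring x y)+
qed

lemma R_K: "x \<in> R k \<Longrightarrow> x \<in> K k"
  by (rule K_I[of x _ 0 0]) (auto intro: subring_0[OF subring_R])

lemma K_Rats: "r \<in> \<rat> \<Longrightarrow> r \<in> K k"
  by (intro R_K R_Rats)

lemma K_c: "c \<in> K k"
  by (rule K_I[of 0 _ 1 0]) (auto intro: subring_1[OF subring_R] subring_0[OF subring_R])

lemma K_inverse_c: "inverse c \<in> K k"
proof (rule K_I[of 0 _ "of_nat M / 2" 1])
  show "of_nat M / 2 \<in> R k"
    by (intro R_Rats) auto
  show "p ^ 1 * inverse c = 0 + of_nat M / 2 * c"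
    using c_neq_0 unfolding c by (simp add: power2_eq_square)
qed (rule subring_0[OF subring_R])

lemma K_mono: "k \<le> k' \<Longrightarrow> x \<in> K k \<Longrightarrow> x \<in> K k'"
  unfolding K_def using R_mono by blast

text \<open>Since p * \<delta> c = (\<delta> p / 2) * c, differentiating c costs one factor p, and
  so does differentiating p ^ N; hence the exponent N + 1.\<close>

lemma K_\<delta>:
  assumes "x \<in> K k"
  shows "\<delta> x \<in> K (Suc k)"
proof -
  obtain N u w where x: "u \<in> R k" "w \<in> R k" "p ^ N * x = u + w * c"
    using assms unfolding K_def by blast
  have "\<delta> (of_nat M / 2) = 0"
    by (rule rd_Rats[OF \<delta>]) auto
  then have "\<delta> p = of_nat M / 2 * (2 * c * \<delta> c)"
    unfolding c power2_eq_square rd_mult[OF \<delta>, of "of_nat M / 2"] rd_mult[OF \<delta>, of c]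
    by (simp add: mult_ac)
  then have pc: "p * \<delta> c = \<delta> p / 2 * c"
    unfolding c by (simp add: power2_eq_square)
  have pN: "p * \<delta> (p ^ N) = of_nat N * \<delta> p * p ^ N"
    by (cases N) (simp_all only: rd_power_Suc[OF \<delta>], simp_all add: rd_1[OF \<delta>] algebra_simps)
  have "p * \<delta> (p ^ N * x) = of_nat N * \<delta> p * (p ^ N * x) + p ^ Suc N * \<delta> x"
    using pN by (simp add: rd_mult[OF \<delta>] distrib_left flip: mult.assoc)
  moreover have "p * \<delta> (p ^ N * x) = p * \<delta> u + (p * \<delta> w + \<delta> p / 2 * w) * c"
    unfolding x(3) using pc by (simp add: rd_add[OF \<delta>] rd_mult[OF \<delta>] algebra_simps)
  ultimately have "p ^ Suc N * \<delta> x = p * \<delta> u + (p * \<delta> w + \<delta> p / 2 * w) * c - of_nat N * \<delta> p * (u + w * c)"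
    unfolding x(3) by (simp add: algebra_simps)
  then have eq: "p ^ Suc N * \<delta> x = (p * \<delta> u - of_nat N * \<delta> p * u)
      + (p * \<delta> w + \<delta> p * (1/2) * w - of_nat N * \<delta> p * w) * c"
    by (simp add: algebra_simps)
  have \<delta>p: "\<delta> p \<in> R (Suc k)"
    using R_\<delta>[OF p_in_R[of k]] .
  have half: "1/2 \<in> R (Suc k)"
    by (intro R_Rats) auto
  note ring = subring_add[OF subring_R] subring_mult[OF subring_R]
    subring_diff[OF subring_R] p_in_R \<delta>p half subring_of_nat[OF subring_R]
    R_mono[OF le_SucI[OF order_refl] x(1)] R_mono[OF le_SucI[OF order_refl] x(2)]
    R_\<delta>[OF x(1)] R_\<delta>[OF x(2)]
  show ?thesis
    by (rule K_I[OF _ _ eq]) (intro ring)+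
qed

text \<open>Isolating w * c and squaring removes c. What remains is a relation of degree two over R
  k whose leading coefficient is a power of p.\<close>

lemma not_in_K: "(\<delta> ^^ k) (a (n - 2)) \<notin> K k"
proof
  let ?y = "(\<delta> ^^ k) (a (n - 2))"
  assume "?y \<in> K k"
  then obtain N u w where x: "u \<in> R k" "w \<in> R k" "p ^ N * ?y = u + w * c"
    unfolding K_def by blast
  have "(p ^ N * ?y - u)\<^sup>2 = w\<^sup>2 * c\<^sup>2"
    unfolding x(3) by (simp add: power_mult_distrib)
  then have eq: "(p ^ N)\<^sup>2 * ?y\<^sup>2 + (- (2 * p ^ N * u)) * ?y + (u\<^sup>2 - w\<^sup>2 * (2 / of_nat M * p)) = 0"
    unfolding c_sq(1) by (simp add: power2_eq_square algebra_simps)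
  note ring = subring_diff[OF subring_R] subring_mult[OF subring_R]
    subring_power[OF subring_R] subring_minus[OF subring_R]
  have two: "2 \<in> R k"
    by (intro R_Rats) auto
  have "(p ^ N)\<^sup>2 = 0"
    by (rule quadratic_independence[OF _ _ _ eq]) (intro ring x p_in_R c_sq(2) two)+
  then show False
    using p_neq_0 by simp
qed

text \<open>The coefficient y of x ^ (n - 2) is followed through the recursion: f 0 to f 3 do not
  contain it, f 4 contains it linearly, no f i with i < M + 2 contains a derivative of it, and f (M
  + 2) contains \<delta> y linearly through \<delta> (f 4). So \<delta> (f (M + 2)) is a unit times
  \<delta> (\<delta> y) plus an element of K 2, whereas \<delta> (\<delta> y) is not in K 2.\<close>

lemma generic_obstruction:
  "\<delta> (formal_coeff \<delta> (force \<alpha> a n) M c (M + 2)) \<noteq> 0"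
proof
  define P where "P = force \<alpha> a n"
  define f where "f = formal_coeff \<delta> P M c"
  define y where "y = coeff P (n - 2)"
  assume "\<delta> (formal_coeff \<delta> (force \<alpha> a n) M c (M + 2)) = 0"
  then have zero: "\<delta> (f (M + 2)) = 0"
    by (simp add: f_def P_def)
  have M9: "M \<ge> 9" "M - 1 = n"
    using M n by simp_all
  have half: "x / (2 * c) = x * (1/2) * inverse c" for x
    by (simp add: field_simps)
  have f_rec: "f i = (4 / (2 * of_nat M - of_nat i) *
          ((if even i \<and> i \<le> 2 * M - 2 then coeff P (n - i div 2) else 0)
           - (if M - 2 \<le> i then \<delta> (f (i - (M - 2))) else 0))
        - (\<Sum>j\<in>{1..<i}. f j * f (i - j))) * (1/2) * inverse c" if "0 < i" "i < 2 * M" for i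
  proof -
    have i: "i \<noteq> 0" "\<not> (2 * M \<le> i \<or> M \<le> 2)"
      using that M9 by auto
    show ?thesis
      unfolding f_def half[symmetric] M9(2)[symmetric]
      by (rule trans[OF formal_coeff.simps]) (simp only: i if_False)
  qed
  have f0: "f 0 = c"
    by (simp add: f_def formal_coeff.simps[of _ _ _ _ 0])
  note K = subring_add[OF K_subring] subring_mult[OF K_subring]
    subring_minus[OF K_subring] subring_diff[OF K_subring] K_inverse_c K_c
  note K0 = subring_0[OF K_subring] and K_sum = subring_sum[OF K_subring]
  have rat: "4 / (2 * of_nat M - of_nat i) \<in> K k" "1/2 \<in> K k" for i k
    by (auto intro!: K_Rats)
  have P0: "coeff P i \<in> K 0" if "i \<noteq> n - 2" for i
    unfolding P_def using that by (intro R_K force_in_R) auto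
  have P1: "coeff P i \<in> K 1" for i
    unfolding P_def by (intro R_K force_in_R) auto
  \<comment> \<open>Even indices below 4 meet only the coefficients of x ^ n and x ^ (n - 1), and
    derivatives enter from index M - 2 on, which is beyond 4.\<close>
  have low: "f i \<in> K 0" if "i < 4" for i
    using that
  proof (induction i rule: less_induct)
    case (less i)
    show ?case
    proof (cases "i = 0")
      case False
      have "n - i div 2 \<noteq> n - 2"
        using less.prems n by auto
      moreover have "\<not> M - 2 \<le> i"
        using less.prems M9 by auto
      moreover have "(\<Sum>j\<in>{1..<i}. f j * f (i - j)) \<in> K 0"
        using less by (intro K_sum K) auto
      ultimately have "(if even i \<and> i \<le> 2 * M - 2 then coeff P (n - i div 2) else 0) \<in> K 0"
        "(if M - 2 \<le> i then \<delta> (f (i - (M - 2))) else 0) \<in> K 0"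
        "(\<Sum>j\<in>{1..<i}. f j * f (i - j)) \<in> K 0"
        using P0 K0 by auto
      moreover have "0 < i" "i < 2 * M"
        using False less.prems M9 by auto
      ultimately show ?thesis
        by (subst f_rec) (assumption | intro K rat)+
    qed (simp add: f0 K)
  qed
  define e4 where "e4 = - (\<Sum>j\<in>{1..<4}. f j * f (4 - j)) * (1/2) * inverse c"
  have e4: "e4 \<in> K 0"
    unfolding e4_def by (intro K K_sum rat low) auto
  define \<kappa> :: 'a where "\<kappa> = 4 / (2 * of_nat M - of_nat 4) * (1/2)"
  have \<kappa>: "\<kappa> \<in> \<rat>" "\<kappa> \<noteq> 0"
  proof -
    have "(of_nat (2 * M) :: 'a) \<noteq> of_nat 4"
      using M9 by (simp only: of_nat_eq_iff)
    then have "(2 * of_nat M :: 'a) - of_nat 4 \<noteq> 0" by simp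
    then show "\<kappa> \<noteq> 0" unfolding \<kappa>_def by simp
  qed (simp add: \<kappa>_def)
  have f4: "f 4 = \<kappa> * inverse c * y + e4"
    using M9 by (subst f_rec) (auto simp: \<kappa>_def e4_def y_def algebra_simps)
  have y1: "y \<in> K 1"
    unfolding y_def by (rule P1)
  \<comment> \<open>For i < M + 2 only f j with j < 4 are differentiated, which keeps the
    derivatives of y out.\<close>
  have mid: "f i \<in> K 1" if "i < M + 2" for i
    using that
  proof (induction i rule: less_induct)
    case (less i)
    show ?case
    proof (cases "i = 0")
      case False
      have "\<delta> (f (i - (M - 2))) \<in> K 1"
        using K_\<delta>[OF low[of "i - (M - 2)"]] less.prems M9 by simp
      moreover have "(\<Sum>j\<in>{1..<i}. f j * f (i - j)) \<in> K 1"
        using less by (intro K_sum K) auto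
      ultimately have "(if even i \<and> i \<le> 2 * M - 2 then coeff P (n - i div 2) else 0) \<in> K 1"
        "(if M - 2 \<le> i then \<delta> (f (i - (M - 2))) else 0) \<in> K 1"
        "(\<Sum>j\<in>{1..<i}. f j * f (i - j)) \<in> K 1"
        using P1 K0 by auto
      moreover have "0 < i" "i < 2 * M"
        using False less.prems M9 by auto
      ultimately show ?thesis
        by (subst f_rec) (assumption | intro K rat)+
    qed (simp add: f0 K)
  qed
  define \<rho> :: 'a where "\<rho> = 4 / (2 * of_nat M - of_nat (M + 2)) * (1/2)"
  have \<rho>: "\<rho> \<in> \<rat>" "\<rho> \<noteq> 0"
  proof -
    have "(of_nat (2 * M) :: 'a) \<noteq> of_nat (M + 2)"
      using M9 by (simp only: of_nat_eq_iff)
    then have "(2 * of_nat M :: 'a) - of_nat (M + 2) \<noteq> 0" by (simp del: of_nat_add)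
    then show "\<rho> \<noteq> 0" unfolding \<rho>_def by simp
  qed (simp add: \<rho>_def)
  define e where "e = (\<rho> * (if even (M + 2) \<and> M + 2 \<le> 2 * M - 2 then coeff P (n - (M + 2) div 2) else 0)
      - (\<Sum>j\<in>{1..<M + 2}. f j * f (M + 2 - j)) * (1/2)) * inverse c"
  have "(if even (M + 2) \<and> M + 2 \<le> 2 * M - 2 then coeff P (n - (M + 2) div 2) else 0) \<in> K 1"
    using P1 K0 by auto
  moreover have "(\<Sum>j\<in>{1..<M + 2}. f j * f (M + 2 - j)) \<in> K 1"
    by (intro K_sum K mid) auto
  moreover have "\<rho> \<in> K 1"
    using \<rho> by (intro K_Rats)
  ultimately have e1: "e \<in> K 1"
    unfolding e_def by (assumption | intro K rat)+
  have "M + 2 - (M - 2) = 4" "M - 2 \<le> M + 2"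
    using M9 by auto
  then have "f (M + 2) = (\<rho> * ((if even (M + 2) \<and> M + 2 \<le> 2 * M - 2 then coeff P (n - (M + 2) div 2) else 0)
           - \<delta> (f 4)) - (\<Sum>j\<in>{1..<M + 2}. f j * f (M + 2 - j)) * (1/2)) * inverse c"
    using M9 by (subst f_rec) (auto simp: \<rho>_def algebra_simps simp del: of_nat_add even_add)
  then have fM: "f (M + 2) = e - \<rho> * inverse c * \<delta> (f 4)"
    by (simp add: e_def algebra_simps)
  define ic where "ic = inverse c"
  have ic: "ic \<in> K k" for k
    by (simp add: ic_def K)
  have ic1: "\<delta> ic \<in> K 1"
    using K_\<delta>[OF ic[of 0]] by simp
  have c\<kappa>: "\<delta> \<kappa> = 0" "\<delta> \<rho> = 0"
    using rd_Rats[OF \<delta>] \<kappa> \<rho> by auto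
  define e5 where "e5 = \<kappa> * \<delta> ic * y + \<delta> e4"
  have e5: "e5 \<in> K 1"
    unfolding e5_def using K_\<delta>[OF e4] y1 ic1 \<kappa> by (intro K) (simp_all add: K_Rats)
  have \<delta>f4: "\<delta> (f 4) = \<kappa> * ic * \<delta> y + e5"
    unfolding f4 e5_def by (simp add: rd_add[OF \<delta>] rd_mult[OF \<delta>] c\<kappa> ic_def algebra_simps)
  define e6 where "e6 = e - \<rho> * ic * e5"
  have e6: "e6 \<in> K 1"
    unfolding e6_def using e1 e5 ic \<rho> by (intro K) (simp_all add: K_Rats)
  have fM': "f (M + 2) = e6 - \<rho> * \<kappa> * (ic * ic) * \<delta> y"
    unfolding fM \<delta>f4 e6_def by (simp add: ic_def algebra_simps)
  have "0 = \<delta> e6 - \<rho> * \<kappa> * (\<delta> ic * ic + ic * \<delta> ic) * \<delta> y - \<rho> * \<kappa> * (ic * ic) * \<delta> (\<delta> y)"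
    using zero unfolding fM' by (simp add: rd_diff[OF \<delta>] rd_mult[OF \<delta>] c\<kappa> algebra_simps)
  then have eq: "\<rho> * \<kappa> * (ic * ic) * \<delta> (\<delta> y)
      = \<delta> e6 - \<rho> * \<kappa> * (\<delta> ic * ic + ic * \<delta> ic) * \<delta> y"
    by simp
  have "\<delta> e6 \<in> K 2" "\<delta> y \<in> K 2" "\<delta> ic \<in> K 2" "ic \<in> K 2"
    using K_\<delta>[OF e6] K_\<delta>[OF y1] K_mono[OF _ ic1, of 2] ic by (simp_all add: numeral_2_eq_2)
  then have "\<rho> * \<kappa> * (ic * ic) * \<delta> (\<delta> y) \<in> K 2"
    unfolding eq using \<kappa> \<rho> by (intro K) (simp_all add: K_Rats)
  moreover have "inverse (\<rho> * \<kappa>) * (c * c) \<in> K 2"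
    using \<kappa> \<rho> by (intro K) (simp add: K_Rats)
  ultimately have "inverse (\<rho> * \<kappa>) * (c * c) * (\<rho> * \<kappa> * (ic * ic) * \<delta> (\<delta> y)) \<in> K 2"
    by (rule subring_mult[OF K_subring, rotated])
  also have "inverse (\<rho> * \<kappa>) * (c * c) * (\<rho> * \<kappa> * (ic * ic) * \<delta> (\<delta> y)) = \<delta> (\<delta> y)"
    using \<kappa> \<rho> c_neq_0 by (simp add: ic_def field_simps)
  finally have "\<delta> (\<delta> y) \<in> K 2" .
  moreover have "y = - a (n - 2)"
    using n by (simp add: y_def P_def coeff_force)
  ultimately have "- (\<delta> ^^ 2) (a (n - 2)) \<in> K 2"
    by (simp add: rd_minus[OF \<delta>] numeral_2_eq_2)
  then have "(\<delta> ^^ 2) (a (n - 2)) \<in> K 2"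
    using subring_minus[OF K_subring] by force
  with not_in_K show False by blast
qed

end

end

section \<open>Order one subsets are finite\<close>

definition curve_eval :: "'a::comm_ring_1 poly poly \<Rightarrow> 'a \<Rightarrow> 'a \<Rightarrow> 'a" where
  "curve_eval g x y = poly (poly g [:y:]) x"

lemma curve_eval_pCons [simp]: "curve_eval (pCons a g) x y = poly a x + y * curve_eval g x y"
  by (simp add: curve_eval_def)

lemma curve_eval_0 [simp]: "curve_eval 0 x y = 0"
  by (simp add: curve_eval_def)

lemma curve_eval_add: "curve_eval (g + h) x y = curve_eval g x y + curve_eval h x y"
  by (simp add: curve_eval_def)

lemma curve_eval_mult: "curve_eval (g * h) x y = curve_eval g x y * curve_eval h x y"
  by (simp add: curve_eval_def)

lemma curve_eval_smult: "curve_eval (smult a g) x y = poly a x * curve_eval g x y"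
  by (simp add: curve_eval_def)

lemma derivation_curve_eval:
  fixes \<delta> :: "'a::field_char_0 \<Rightarrow> 'a"
  assumes "ring_derivation \<delta>" "\<delta> (\<delta> x) = poly P x"
  shows "\<delta> (curve_eval g x (\<delta> x)) = curve_eval (flow_derivation \<delta> P g) x (\<delta> x)"
proof (induction g)
  case 0
  show ?case
    using rd_0[OF assms(1)] by (simp add: flow_derivation_def)
next
  case (pCons a g)
  show ?case
    using pCons.IH assms(2)
    by (simp add: flow_derivation_pCons[of \<delta>, OF rd_0[OF assms(1)]] rd_add[OF assms(1)]
        rd_mult[OF assms(1)] rd_poly[OF assms(1)] curve_eval_add curve_eval_smult algebra_simps)
qed

text \<open>Among the curves with infinitely many points (x, x') on solutions, h has least degree in
  y. The pseudo-remainder of D h by h vanishes at the same points, so it is 0 by minimality, and h =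
  0 is invariant. Least degree thus replaces irreducibility.\<close>

lemma (in generic_coefficients) finite_order_one:
  assumes closed: "differentially_closed \<delta>" and "g \<noteq> 0"
  shows "finite {x. \<delta> (\<delta> x) = poly (force \<alpha> a n) x \<and> curve_eval g x (\<delta> x) = 0}"
proof (rule ccontr)
  let ?P = "force \<alpha> a n"
  define Z where "Z g = {x. \<delta> (\<delta> x) = poly ?P x \<and> curve_eval g x (\<delta> x) = 0}" for g
  assume "infinite {x. \<delta> (\<delta> x) = poly (force \<alpha> a n) x \<and> curve_eval g x (\<delta> x) = 0}"
  with \<open>g \<noteq> 0\<close> have "\<exists>d g. g \<noteq> 0 \<and> infinite (Z g) \<and> degree g = d"
    unfolding Z_def by blast
  define d where "d = (LEAST d. \<exists>g. g \<noteq> 0 \<and> infinite (Z g) \<and> degree g = d)"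
  obtain h where h: "h \<noteq> 0" "infinite (Z h)" "degree h = d"
    using LeastI_ex[OF \<open>\<exists>d g. g \<noteq> 0 \<and> infinite (Z g) \<and> degree g = d\<close>] unfolding d_def by blast
  have min: "\<not> degree r < d" if "r \<noteq> 0" "infinite (Z r)" for r
    using not_less_Least[of "degree r" "\<lambda>d. \<exists>g. g \<noteq> 0 \<and> infinite (Z g) \<and> degree g = d"] that
    unfolding d_def by blast
  have "d > 0"
  proof (rule ccontr)
    assume "\<not> d > 0"
    then obtain h0 where h0: "h = [:h0:]"
      using h(3) by (metis degree_eq_zeroE neq0_conv)
    with h(1) have "h0 \<noteq> 0" by auto
    then have "finite {x. poly h0 x = 0}"
      by (rule poly_roots_finite)
    then have "finite (Z h)"
      by (rule rev_finite_subset) (auto simp: Z_def h0)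
    with h(2) show False by blast
  qed
  obtain l q where l: "l \<noteq> 0" "smult l (flow_derivation \<delta> ?P h) = h * q + pseudo_mod (flow_derivation \<delta> ?P h) h"
    using pseudo_mod(1)[OF h(1), of "flow_derivation \<delta> ?P h"] by auto
  define r where "r = pseudo_mod (flow_derivation \<delta> ?P h) h"
  have "Z h \<subseteq> Z r"
  proof
    fix x assume x: "x \<in> Z h"
    then have "curve_eval (flow_derivation \<delta> ?P h) x (\<delta> x) = 0"
      using derivation_curve_eval[OF \<delta>, of x ?P h] rd_0[OF \<delta>] by (simp add: Z_def)
    then have "curve_eval (smult l (flow_derivation \<delta> ?P h)) x (\<delta> x) = 0"
      by (simp add: curve_eval_smult)
    then show "x \<in> Z r"
      using x unfolding l(2) by (simp add: Z_def curve_eval_add curve_eval_mult r_def)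
  qed
  with h(2) have "infinite (Z r)"
    using finite_subset by blast
  moreover have "r = 0 \<or> degree r < d"
    using pseudo_mod(2)[OF h(1), of "flow_derivation \<delta> ?P h"] h(3) by (auto simp: r_def)
  ultimately have "r = 0"
    using min by blast
  then have inv: "smult l (flow_derivation \<delta> ?P h) = q * h"
    using l(2) by (simp add: r_def mult.commute)
  let ?M = "Suc n"
  have "?M > 2" "degree ?P \<le> ?M - 1" "coeff ?P (?M - 1) \<noteq> 0" "degree h > 0"
    using n degree_force[of \<alpha> a n] p_neq_0 \<open>d > 0\<close> h(3) by (auto simp: p_def)
  from darboux_obstruction[OF \<delta> this l(1) inv algebraically_closed[OF closed]]
  obtain c where c: "coeff ?P (?M - 1) = of_nat ?M / 2 * c\<^sup>2"
    "\<And>f. f 0 = c \<Longrightarrow> formal_solution \<delta> ?P ?M f \<Longrightarrow> \<delta> (f (?M + 2)) = 0" by blast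
  then have pc: "p = of_nat ?M / 2 * c\<^sup>2"
    by (simp add: p_def)
  then have "c \<noteq> 0"
    using p_neq_0 by auto
  then have "formal_solution \<delta> ?P ?M (formal_coeff \<delta> ?P ?M c)"
    using \<open>?M > 2\<close> c(1) by (intro formal_solution_formal_coeff)
  moreover have "formal_coeff \<delta> ?P ?M c 0 = c"
    by (subst formal_coeff.simps) simp
  ultimately have "\<delta> (formal_coeff \<delta> ?P ?M c (?M + 2)) = 0"
    using c(2) by blast
  with generic_obstruction[OF refl pc] show False
    by blast
qed

section \<open>Partial isomorphisms of differential rings\<close>

text \<open>A partial isomorphism is represented by its graph, a subring of pairs.\<close>

definition pair_ring :: "('a::field_char_0 \<times> 'a) set \<Rightarrow> bool" where
  "pair_ring T \<longleftrightarrow> (1, 1) \<in> T \<and>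
     (\<forall>x x' y y'. (x, x') \<in> T \<and> (y, y') \<in> T \<longrightarrow> (x + y, x' + y') \<in> T \<and> (x * y, x' * y') \<in> T) \<and>
     (\<forall>x x'. (x, x') \<in> T \<longrightarrow> (- x, - x') \<in> T)"

text \<open>For a \<open>pair_ring\<close> this yields the graph of a ring isomorphism: two pairs
  that share a component differ by a pair with a zero component.\<close>

definition injective_graph :: "('a::zero \<times> 'a) set \<Rightarrow> bool" where
  "injective_graph T \<longleftrightarrow> (\<forall>x x'. (x, x') \<in> T \<longrightarrow> (x = 0 \<longleftrightarrow> x' = 0))"

context
  fixes T :: "('a::field_char_0 \<times> 'a) set"
  assumes T: "pair_ring T"
begin

lemma pair_ring_1: "(1, 1) \<in> T"
  and pair_ring_add: "(x, x') \<in> T \<Longrightarrow> (y, y') \<in> T \<Longrightarrow> (x + y, x' + y') \<in> T"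
  and pair_ring_mult: "(x, x') \<in> T \<Longrightarrow> (y, y') \<in> T \<Longrightarrow> (x * y, x' * y') \<in> T"
  and pair_ring_minus: "(x, x') \<in> T \<Longrightarrow> (- x, - x') \<in> T"
  using T unfolding pair_ring_def by blast+

lemma pair_ring_0: "(0, 0) \<in> T"
  using pair_ring_add[OF pair_ring_1 pair_ring_minus[OF pair_ring_1]] by simp

lemma pair_ring_diff: "(x, x') \<in> T \<Longrightarrow> (y, y') \<in> T \<Longrightarrow> (x - y, x' - y') \<in> T"
  using pair_ring_add[of x x' "- y" "- y'"] pair_ring_minus by simp

lemma pair_ring_sum: "(\<And>i. i \<in> I \<Longrightarrow> (f i, f' i) \<in> T) \<Longrightarrow> (sum f I, sum f' I) \<in> T"
  by (induction I rule: infinite_finite_induct) (auto intro: pair_ring_0 pair_ring_add)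

lemma pair_ring_prod: "(\<And>i. i \<in> I \<Longrightarrow> (f i, f' i) \<in> T) \<Longrightarrow> (prod f I, prod f' I) \<in> T"
  by (induction I rule: infinite_finite_induct) (auto intro: pair_ring_1 pair_ring_mult)

lemma pair_ring_power: "(x, x') \<in> T \<Longrightarrow> (x ^ k, x' ^ k) \<in> T"
  by (induction k) (auto intro: pair_ring_1 pair_ring_mult)

lemma pair_ring_poly:
  assumes "\<sigma> 0 = 0" "\<And>k. (coeff p k, \<sigma> (coeff p k)) \<in> T" "(z, z') \<in> T"
  shows "(poly p z, poly (map_poly \<sigma> p) z') \<in> T"
  using assms(2)
proof (induction p)
  case (pCons a p)
  have "(a, \<sigma> a) \<in> T" "\<And>k. (coeff p k, \<sigma> (coeff p k)) \<in> T"
    using pCons.prems[of 0] pCons.prems[of "Suc _"] by simp_all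
  with pCons.IH show ?case
    using assms(1,3) by (auto simp: map_poly_pCons intro!: pair_ring_add pair_ring_mult)
qed (simp add: pair_ring_0)

lemma subring_fst: "subring (fst ` T)"
  unfolding subring_def
proof (intro conjI ballI)
  show "1 \<in> fst ` T"
    using pair_ring_1 by force
  fix x assume x: "x \<in> fst ` T"
  then obtain x' where x': "(x, x') \<in> T" by auto
  show "- x \<in> fst ` T"
    using pair_ring_minus[OF x'] by force
  fix y assume "y \<in> fst ` T"
  then obtain y' where y': "(y, y') \<in> T" by auto
  show "x + y \<in> fst ` T"
    using pair_ring_add[OF x' y'] by force
  show "x * y \<in> fst ` T"
    using pair_ring_mult[OF x' y'] by force
qed

end

definition graph_map :: "('a \<times> 'a) set \<Rightarrow> 'a \<Rightarrow> 'a" where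
  "graph_map T x = (SOME x'. (x, x') \<in> T)"

locale partial_iso =
  fixes T :: "('a::field_char_0 \<times> 'a) set"
  assumes ring: "pair_ring T" and inj: "injective_graph T"
begin

abbreviation "S \<equiv> fst ` T"
abbreviation "\<sigma> \<equiv> graph_map T"

lemma functional: "(x, y) \<in> T \<Longrightarrow> (x, z) \<in> T \<Longrightarrow> y = z"
  using pair_ring_diff[OF ring, of x y x z] inj unfolding injective_graph_def
  by (metis cancel_comm_monoid_add_class.diff_cancel eq_iff_diff_eq_0)

lemma graph_map_eq: "(x, y) \<in> T \<Longrightarrow> \<sigma> x = y"
  unfolding graph_map_def by (rule some_equality) (auto intro: functional)

lemma graph_map_in: "x \<in> S \<Longrightarrow> (x, \<sigma> x) \<in> T"
  using graph_map_eq by fastforce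

lemma graph_map_0 [simp]: "\<sigma> 0 = 0"
  by (rule graph_map_eq[OF pair_ring_0[OF ring]])

lemma graph_map_add: "x \<in> S \<Longrightarrow> y \<in> S \<Longrightarrow> \<sigma> (x + y) = \<sigma> x + \<sigma> y"
  by (intro graph_map_eq pair_ring_add[OF ring] graph_map_in)

lemma graph_map_mult: "x \<in> S \<Longrightarrow> y \<in> S \<Longrightarrow> \<sigma> (x * y) = \<sigma> x * \<sigma> y"
  by (intro graph_map_eq pair_ring_mult[OF ring] graph_map_in)

lemma graph_map_minus: "x \<in> S \<Longrightarrow> \<sigma> (- x) = - \<sigma> x"
  by (intro graph_map_eq pair_ring_minus[OF ring] graph_map_in)

lemma graph_map_1 [simp]: "\<sigma> 1 = 1"
  by (rule graph_map_eq[OF pair_ring_1[OF ring]])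

lemma graph_map_eq_0_iff: "x \<in> S \<Longrightarrow> \<sigma> x = 0 \<longleftrightarrow> x = 0"
  using graph_map_in inj by (auto simp: injective_graph_def)

lemma graph_map_sum: "(\<And>i. i \<in> I \<Longrightarrow> f i \<in> S) \<Longrightarrow> \<sigma> (sum f I) = (\<Sum>i\<in>I. \<sigma> (f i))"
  by (intro graph_map_eq pair_ring_sum[OF ring] graph_map_in)

lemma S: "subring S"
  by (rule subring_fst[OF ring])

subsection \<open>Univariate polynomials\<close>

definition polys :: "'a poly set" where
  "polys = {p. \<forall>k. coeff p k \<in> S}"

abbreviation "\<sigma>p \<equiv> map_poly \<sigma>"

lemma polys_0: "0 \<in> polys"
  by (simp add: polys_def subring_0[OF S])

lemma polys_add: "p \<in> polys \<Longrightarrow> q \<in> polys \<Longrightarrow> p + q \<in> polys"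
  by (simp add: polys_def subring_add[OF S])

lemma polys_diff: "p \<in> polys \<Longrightarrow> q \<in> polys \<Longrightarrow> p - q \<in> polys"
  by (simp add: polys_def subring_diff[OF S])

lemma polys_smult: "x \<in> S \<Longrightarrow> p \<in> polys \<Longrightarrow> smult x p \<in> polys"
  by (simp add: polys_def subring_mult[OF S])

lemma polys_monom: "x \<in> S \<Longrightarrow> monom x k \<in> polys"
  by (simp add: polys_def subring_0[OF S])

lemma polys_mult: "p \<in> polys \<Longrightarrow> q \<in> polys \<Longrightarrow> p * q \<in> polys"
  by (auto simp: polys_def coeff_mult intro!: subring_sum[OF S] subring_mult[OF S])

lemma polys_pderiv: "p \<in> polys \<Longrightarrow> pderiv p \<in> polys"
  by (auto simp: polys_def coeff_pderiv
      intro!: subring_mult[OF S] subring_of_nat[OF S] simp del: of_nat_Suc)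

lemma coeff_in_S: "p \<in> polys \<Longrightarrow> coeff p k \<in> S"
  by (simp add: polys_def)

lemma \<sigma>p_add: "p \<in> polys \<Longrightarrow> q \<in> polys \<Longrightarrow> \<sigma>p (p + q) = \<sigma>p p + \<sigma>p q"
  by (intro poly_eqI) (simp add: coeff_map_poly graph_map_add coeff_in_S)

lemma \<sigma>p_smult: "x \<in> S \<Longrightarrow> p \<in> polys \<Longrightarrow> \<sigma>p (smult x p) = smult (\<sigma> x) (\<sigma>p p)"
  by (intro poly_eqI) (simp add: coeff_map_poly graph_map_mult coeff_in_S)

lemma \<sigma>p_mult: "p \<in> polys \<Longrightarrow> q \<in> polys \<Longrightarrow> \<sigma>p (p * q) = \<sigma>p p * \<sigma>p q"
  by (intro poly_eqI)
    (simp add: coeff_map_poly coeff_mult graph_map_sum graph_map_mult coeff_in_S subring_mult[OF S])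

lemma \<sigma>p_pderiv: "p \<in> polys \<Longrightarrow> \<sigma>p (pderiv p) = pderiv (\<sigma>p p)"
proof (intro poly_eqI)
  fix k assume p: "p \<in> polys"
  have n: "\<sigma> (of_nat k) = of_nat k" for k
    by (induction k) (simp_all add: graph_map_add subring_1[OF S] subring_of_nat[OF S])
  show "coeff (\<sigma>p (pderiv p)) k = coeff (pderiv (\<sigma>p p)) k"
    using p by (simp add: coeff_map_poly coeff_pderiv graph_map_mult coeff_in_S n
        subring_of_nat[OF S] del: of_nat_Suc)
qed

text \<open>Multiplier, quotient and remainder stay over \<open>S\<close>, so \<sigma> can be
  applied to the identity. Each step multiplies by the leading coefficient of q and cancels the top
  term.\<close>

lemma pseudo_division:
  assumes "q \<in> polys" "q \<noteq> 0" "p \<in> polys"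
  obtains l s r where "l \<in> S" "l \<noteq> 0" "s \<in> polys" "r \<in> polys" "smult l p = q * s + r"
    "r = 0 \<or> degree r < degree q"
proof -
  have "\<exists>l s r. l \<in> S \<and> l \<noteq> 0 \<and> s \<in> polys \<and> r \<in> polys \<and> smult l p = q * s + r \<and>
      (r = 0 \<or> degree r < degree q)"
    using assms(3)
  proof (induction "degree p" arbitrary: p rule: less_induct)
    case less
    show ?case
    proof (cases "p = 0 \<or> degree p < degree q")
      case True
      then show ?thesis
        using less.prems subring_1[OF S] polys_0
        by (intro exI[of _ 1] exI[of _ 0] exI[of _ p]) auto
    next
      case False
      let ?m = "monom (lead_coeff p) (degree p - degree q)"
      define p1 where "p1 = smult (lead_coeff q) p - q * ?m"
      have m: "?m \<in> polys" "lead_coeff q \<in> S"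
        using less.prems assms(1) by (simp_all add: polys_monom coeff_in_S)
      then have p1: "p1 \<in> polys"
        unfolding p1_def using less.prems assms(1) by (intro polys_diff polys_smult polys_mult)
      have "degree p1 \<le> degree p"
        unfolding p1_def using False
        by (intro degree_diff_le) (auto intro!: order_trans[OF degree_mult_le] simp: degree_monom_eq)
      moreover have "coeff p1 (degree p) = 0"
        using False by (simp add: p1_def mult.commute[of q] coeff_monom_mult)
      ultimately have "p1 = 0 \<or> degree p1 < degree p"
        by (metis le_neq_implies_less leading_coeff_0_iff)
      then obtain l s r where *: "l \<in> S" "l \<noteq> 0" "s \<in> polys" "r \<in> polys" "smult l p1 = q * s + r"
          "r = 0 \<or> degree r < degree q"
      proof
        assume "p1 = 0"
        then show thesis
          using that[of 1 0 0] subring_1[OF S] polys_0 by simp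
      next
        assume "degree p1 < degree p"
        from less.hyps[OF this p1] that show thesis by blast
      qed
      have "smult (l * lead_coeff q) p = q * (s + smult l ?m) + r"
        using *(5) by (simp add: p1_def smult_diff_right algebra_simps)
      moreover have "l * lead_coeff q \<in> S" "l * lead_coeff q \<noteq> 0" "s + smult l ?m \<in> polys"
        using * m assms(2) by (auto intro: subring_mult[OF S] polys_add polys_smult)
      ultimately show ?thesis
        using * by blast
    qed
  qed
  then show ?thesis
    using that by blast
qed

text \<open>Since \<open>f\<close> is a minimal polynomial of \<open>\<beta>\<close>, its image is one of \<open>\<xi>\<close>.\<close>

lemma algebraic_transfer:
  assumes f: "f \<in> polys" "f \<noteq> 0" "poly f \<beta> = 0" "poly (\<sigma>p f) \<xi> = 0"
    and min: "\<And>p. p \<in> polys \<Longrightarrow> p \<noteq> 0 \<Longrightarrow> poly p \<beta> = 0 \<Longrightarrow> degree f \<le> degree p"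
    and p: "p \<in> polys"
  shows "poly p \<beta> = 0 \<longleftrightarrow> poly (\<sigma>p p) \<xi> = 0"
proof -
  \<comment> \<open>Euclid's algorithm: if r vanished at \<xi>, so would the remainder of f modulo
    r, which has smaller degree. The descent ends at nonzero constants.\<close>
  have small: "poly (\<sigma>p r) \<xi> \<noteq> 0" if "r \<in> polys" "r \<noteq> 0" "degree r < degree f" for r
    using that
  proof (induction "degree r" arbitrary: r rule: less_induct)
    case less
    have r\<beta>: "poly r \<beta> \<noteq> 0"
      using min[of r] less.prems by auto
    show ?case
    proof (cases "degree r = 0")
      case True
      then obtain s where "r = [:s:]"
        by (elim degree_eq_zeroE)
      then show ?thesis
        using less.prems coeff_in_S[of r 0] by (simp add: map_poly_pCons graph_map_eq_0_iff)
    next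
      case False
      obtain l q r2 where *: "l \<in> S" "l \<noteq> 0" "q \<in> polys" "r2 \<in> polys" "smult l f = r * q + r2"
          "r2 = 0 \<or> degree r2 < degree r"
        using pseudo_division[OF less.prems(1,2) f(1)] by blast
      \<comment> \<open>A zero remainder would factor f up to l, and the cofactor q would vanish at
        \<beta> with a degree below that of f.\<close>
      have "r2 \<noteq> 0"
      proof
        assume "r2 = 0"
        then have rq: "smult l f = r * q"
          using * by simp
        then have "poly r \<beta> * poly q \<beta> = 0"
          using f(3) by (metis mult_zero_right poly_mult poly_smult)
        then have "poly q \<beta> = 0"
          using r\<beta> by simp
        moreover have "q \<noteq> 0"
          using rq *(2) f(2) by auto
        moreover have "degree f = degree r + degree q"
          using rq *(2) less.prems(2) \<open>q \<noteq> 0\<close> by (metis degree_mult_eq degree_smult_eq)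
        ultimately show False
          using min[OF *(3)] False by simp
      qed
      then have "poly (\<sigma>p r2) \<xi> \<noteq> 0"
        using *(4,6) less.hyps[of r2] less.prems(3) by auto
      moreover have "\<sigma>p (smult l f) = \<sigma>p r * \<sigma>p q + \<sigma>p r2"
        unfolding *(5) using * less.prems by (simp add: \<sigma>p_add \<sigma>p_mult polys_mult)
      then have "poly (\<sigma>p r) \<xi> * poly (\<sigma>p q) \<xi> + poly (\<sigma>p r2) \<xi> = 0"
        using f(4) *(1) f(1) by (metis \<sigma>p_smult mult_zero_right poly_add poly_mult poly_smult)
      ultimately show ?thesis
        by auto
    qed
  qed
  obtain l s r where *: "l \<in> S" "l \<noteq> 0" "s \<in> polys" "r \<in> polys" "smult l p = f * s + r"
      "r = 0 \<or> degree r < degree f"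
    using pseudo_division[OF f(1,2) p] by blast
  have "l * poly p \<beta> = poly r \<beta>"
    using arg_cong[OF *(5), of "\<lambda>p. poly p \<beta>"] f(3) by simp
  moreover have "\<sigma>p (smult l p) = \<sigma>p f * \<sigma>p s + \<sigma>p r"
    unfolding *(5) using * f by (simp add: \<sigma>p_add \<sigma>p_mult polys_mult)
  then have "\<sigma> l * poly (\<sigma>p p) \<xi> = poly (\<sigma>p r) \<xi>"
    using f(4) *(1) p by (metis \<sigma>p_smult add_0 mult_zero_left poly_add poly_mult poly_smult)
  moreover have "poly r \<beta> = 0 \<longleftrightarrow> r = 0"
    using min[OF *(4)] *(6) by (metis leD poly_0)
  moreover have "poly (\<sigma>p r) \<xi> = 0 \<longleftrightarrow> r = 0"
    using small[OF *(4)] *(6) by (metis map_poly_0 poly_0)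
  moreover have "\<sigma> l \<noteq> 0"
    using * by (simp add: graph_map_eq_0_iff)
  ultimately show ?thesis
    using *(2) by (metis mult_eq_0_iff)
qed

text \<open>As a relation this is a ring of pairs for any \<xi>. It is an isomorphism only if
  vanishing at \<beta> and at \<xi> correspond, as in \<open>algebraic_transfer\<close>.\<close>

definition adjoin :: "'a \<Rightarrow> 'a \<Rightarrow> ('a \<times> 'a) set" where
  "adjoin \<beta> \<xi> = {(poly p \<beta>, poly (\<sigma>p p) \<xi>) | p. p \<in> polys}"

lemma pair_ring_adjoin: "pair_ring (adjoin \<beta> \<xi>)"
  unfolding pair_ring_def
proof (intro conjI allI impI)
  have one: "1 \<in> polys"
    using polys_monom[OF subring_1[OF S], of 0] by simp
  show "(1, 1) \<in> adjoin \<beta> \<xi>"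
    unfolding adjoin_def using one by (auto intro!: exI[of _ 1])
next
  fix x x' assume "(x, x') \<in> adjoin \<beta> \<xi>"
  then obtain p where p: "p \<in> polys" "x = poly p \<beta>" "x' = poly (\<sigma>p p) \<xi>"
    by (auto simp: adjoin_def)
  have "- p \<in> polys"
    using polys_diff[OF polys_0 p(1)] by simp
  moreover have "\<sigma>p (- p) = - \<sigma>p p"
    by (intro poly_eqI) (simp add: coeff_map_poly graph_map_minus coeff_in_S[OF p(1)])
  ultimately show "(- x, - x') \<in> adjoin \<beta> \<xi>"
    unfolding adjoin_def using p by (auto intro!: exI[of _ "- p"])
next
  fix x x' y y' assume "(x, x') \<in> adjoin \<beta> \<xi> \<and> (y, y') \<in> adjoin \<beta> \<xi>"
  then obtain p q where p: "p \<in> polys" "x = poly p \<beta>" "x' = poly (\<sigma>p p) \<xi>"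
    and q: "q \<in> polys" "y = poly q \<beta>" "y' = poly (\<sigma>p q) \<xi>"
    by (auto simp: adjoin_def)
  show "(x + y, x' + y') \<in> adjoin \<beta> \<xi>"
    unfolding adjoin_def using p q by (auto intro!: exI[of _ "p + q"] simp: polys_add \<sigma>p_add)
  show "(x * y, x' * y') \<in> adjoin \<beta> \<xi>"
    unfolding adjoin_def using p q by (auto intro!: exI[of _ "p * q"] simp: polys_mult \<sigma>p_mult)
qed

lemma adjoin_superset: "T \<subseteq> adjoin \<beta> \<xi>"
proof clarify
  fix x x' assume x: "(x, x') \<in> T"
  then have "x \<in> S" by force
  then have "[:x:] \<in> polys"
    using polys_monom[of x 0] by (simp add: monom_0)
  then show "(x, x') \<in> adjoin \<beta> \<xi>"
    unfolding adjoin_def using graph_map_eq[OF x]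
    by (auto intro!: exI[of _ "[:x:]"] simp: map_poly_pCons)
qed

lemma adjoin_generator: "(\<beta>, \<xi>) \<in> adjoin \<beta> \<xi>"
proof -
  have "[:0, 1:] \<in> polys"
    using polys_monom[OF subring_1[OF S], of 1] by (simp add: monom_Suc monom_0)
  then show ?thesis
    unfolding adjoin_def by (auto intro!: exI[of _ "[:0, 1:]"] simp: map_poly_pCons)
qed

subsection \<open>Fractions\<close>

definition fractions :: "('a \<times> 'a) set" where
  "fractions = {(x / y, x' / y') | x y x' y'. (x, x') \<in> T \<and> (y, y') \<in> T \<and> y \<noteq> 0}"

lemma fractionsI: "(x, x') \<in> T \<Longrightarrow> (y, y') \<in> T \<Longrightarrow> y \<noteq> 0 \<Longrightarrow> z = x / y \<Longrightarrow> z' = x' / y' \<Longrightarrow> (z, z') \<in> fractions"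
  unfolding fractions_def by blast

lemma fractionsE:
  assumes "(z, z') \<in> fractions"
  obtains x x' y y' where "(x, x') \<in> T" "(y, y') \<in> T" "y \<noteq> 0" "y' \<noteq> 0" "z = x / y" "z' = x' / y'"
proof -
  obtain x x' y y' where *: "(x, x') \<in> T" "(y, y') \<in> T" "y \<noteq> 0" "z = x / y" "z' = x' / y'"
    using assms by (auto simp: fractions_def)
  then have "y' \<noteq> 0"
    using inj by (auto simp: injective_graph_def)
  with * that show ?thesis by blast
qed

lemma fractions_superset: "T \<subseteq> fractions"
  by (auto intro!: fractionsI[OF _ pair_ring_1[OF ring]])

lemma partial_iso_fractions: "partial_iso fractions"
proof
  show "pair_ring fractions"
    unfolding pair_ring_def
  proof (intro conjI allI impI)
    show "(1, 1) \<in> fractions"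
      using fractions_superset pair_ring_1[OF ring] by blast
  next
    fix z z' assume "(z, z') \<in> fractions"
    then obtain x x' y y' where "(x, x') \<in> T" "(y, y') \<in> T" "y \<noteq> 0" "y' \<noteq> 0" "z = x / y" "z' = x' / y'"
      by (elim fractionsE)
    then show "(- z, - z') \<in> fractions"
      by (intro fractionsI[OF pair_ring_minus[OF ring]]) auto
  next
    fix z z' w w' assume "(z, z') \<in> fractions \<and> (w, w') \<in> fractions"
    then obtain x x' y y' u u' t t'
      where 1: "(x, x') \<in> T" "(y, y') \<in> T" "y \<noteq> 0" "y' \<noteq> 0" "z = x / y" "z' = x' / y'"
      and 2: "(u, u') \<in> T" "(t, t') \<in> T" "t \<noteq> 0" "t' \<noteq> 0" "w = u / t" "w' = u' / t'"
      by (auto elim!: fractionsE)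
    show "(z + w, z' + w') \<in> fractions"
      by (rule fractionsI[of "x * t + u * y" "x' * t' + u' * y'" "y * t" "y' * t'"])
        (use 1 2 in \<open>auto intro: pair_ring_add[OF ring] pair_ring_mult[OF ring] simp: field_simps\<close>)
    show "(z * w, z' * w') \<in> fractions"
      by (rule fractionsI[of "x * u" "x' * u'" "y * t" "y' * t'"])
        (use 1 2 in \<open>auto intro: pair_ring_mult[OF ring]\<close>)
  qed
  show "injective_graph fractions"
    using inj unfolding injective_graph_def by (auto elim!: fractionsE)
qed

lemma fractions_divide:
  assumes "(z, z') \<in> fractions" "(w, w') \<in> fractions" "w \<noteq> 0"
  shows "(z / w, z' / w') \<in> fractions"
proof -
  obtain x x' y y' u u' t t'
    where 1: "(x, x') \<in> T" "(y, y') \<in> T" "y \<noteq> 0" "y' \<noteq> 0" "z = x / y" "z' = x' / y'"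
    and 2: "(u, u') \<in> T" "(t, t') \<in> T" "t \<noteq> 0" "t' \<noteq> 0" "w = u / t" "w' = u' / t'"
    using assms by (auto elim!: fractionsE)
  show ?thesis
    by (rule fractionsI[of "x * t" "x' * t'" "y * u" "y' * u'"])
      (use 1 2 assms(3) in \<open>auto intro: pair_ring_mult[OF ring]\<close>)
qed

text \<open>By the quotient rule. Derivatives of elements of T are allowed to be fractions, as
  happens for an algebraic generator.\<close>

lemma fractions_derivation:
  assumes \<delta>: "ring_derivation \<delta>"
    and "\<And>x x'. (x, x') \<in> T \<Longrightarrow> (\<delta> x, \<delta> x') \<in> fractions"
    and "(z, z') \<in> fractions"
  shows "(\<delta> z, \<delta> z') \<in> fractions"
proof -
  obtain x x' y y' where *: "(x, x') \<in> T" "(y, y') \<in> T" "y \<noteq> 0" "y' \<noteq> 0" "z = x / y" "z' = x' / y'"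
    using assms(3) by (elim fractionsE)
  interpret F: partial_iso fractions
    by (rule partial_iso_fractions)
  have quot: "\<delta> (x / y) = (\<delta> x * y - x * \<delta> y) / (y * y)" if "y \<noteq> 0" for x y :: 'a
    using that rd_inverse[OF \<delta> that]
    by (simp add: divide_inverse[of x] rd_mult[OF \<delta>]) (simp add: field_simps power2_eq_square)
  have T: "(x, x') \<in> fractions" "(y, y') \<in> fractions"
    using * fractions_superset by auto
  have "((\<delta> x * y - x * \<delta> y) / (y * y), (\<delta> x' * y' - x' * \<delta> y') / (y' * y')) \<in> fractions"
    using * assms(2) T
    by (intro fractions_divide pair_ring_diff[OF F.ring] pair_ring_mult[OF F.ring]) auto
  then show ?thesis
    using * by (simp add: quot)
qed

subsection \<open>Differential polynomials\<close>

definition tr :: "(unit, 'a) dpoly \<Rightarrow> (unit, 'a) dpoly" where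
  "tr g = Poly_Mapping.map \<sigma> g"

lemma lookup_tr: "lookup (tr g) m = \<sigma> (lookup g m)"
  by (simp add: tr_def Poly_Mapping.map.rep_eq when_def)

lemma lookup_in_S: "g \<in> dpolys S V \<Longrightarrow> lookup g m \<in> S"
  by (simp add: dpolys_def)

lemma keys_tr: "g \<in> dpolys S V \<Longrightarrow> keys (tr g) = keys g"
  by (auto simp: in_keys_iff lookup_tr graph_map_eq_0_iff lookup_in_S)

lemma tr_in:
  assumes "g \<in> dpolys S V"
  shows "tr g \<in> dpolys (snd ` T) V"
proof -
  have "lookup (tr g) m \<in> snd ` T" for m
    using graph_map_in[OF lookup_in_S[OF assms]] by (force simp: lookup_tr)
  moreover have "dpoly_vars (tr g) = dpoly_vars g"
    by (simp add: dpoly_vars_def keys_tr[OF assms])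
  ultimately show ?thesis
    using assms by (simp add: dpolys_def)
qed

lemma tr_eq_0_iff: "g \<in> dpolys S V \<Longrightarrow> tr g = 0 \<longleftrightarrow> g = 0"
  using keys_tr by (metis keys_eq_empty)

lemma tr_0 [simp]: "tr 0 = 0"
  by (rule poly_mapping_eqI) (simp add: lookup_tr)

lemma tr_add: "g \<in> dpolys S V \<Longrightarrow> h \<in> dpolys S V \<Longrightarrow> tr (g + h) = tr g + tr h"
  by (rule poly_mapping_eqI) (simp add: lookup_tr lookup_add graph_map_add lookup_in_S)

lemma tr_minus: "g \<in> dpolys S V \<Longrightarrow> tr (- g) = - tr g"
  by (rule poly_mapping_eqI) (simp add: lookup_tr graph_map_minus lookup_in_S)

lemma tr_mult:
  assumes "g \<in> dpolys S V" "h \<in> dpolys S V"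
  shows "tr (g * h) = tr g * tr h"
proof (rule poly_mapping_eqI)
  fix m
  have l: "lookup (p * q) m = (\<Sum>i\<in>keys p. \<Sum>j\<in>keys q.
      if i + j = m then lookup p i * lookup q j else 0)"
    for p q :: "(unit, 'a) dpoly"
    unfolding dpoly_mult_singles[of p q] lookup_sum by (simp only: lookup_single when_def)
  have in_S: "(if i + j = m then lookup g i * lookup h j else 0) \<in> S" for i j
    using lookup_in_S[OF assms(1)] lookup_in_S[OF assms(2)]
    by (auto intro: subring_mult[OF S] subring_0[OF S])
  have "\<sigma> (lookup (g * h) m) = (\<Sum>i\<in>keys g. \<Sum>j\<in>keys h.
      \<sigma> (if i + j = m then lookup g i * lookup h j else 0))"
    unfolding l using in_S
    by (subst graph_map_sum) (auto intro!: subring_sum[OF S] sum.cong graph_map_sum)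
  also have "\<dots> = lookup (tr g * tr h) m"
    unfolding l keys_tr[OF assms(1)] keys_tr[OF assms(2)]
    by (intro sum.cong refl)
      (simp add: lookup_tr graph_map_mult lookup_in_S[OF assms(1)] lookup_in_S[OF assms(2)])
  finally show "lookup (tr (g * h)) m = lookup (tr g * tr h) m"
    by (simp add: lookup_tr)
qed

lemma pair_ring_dpoly_eval:
  assumes W: "pair_ring W" "T \<subseteq> W" and g: "g \<in> dpolys S V"
    and z: "\<And>k. ((), k) \<in> V \<Longrightarrow> ((\<delta> ^^ k) b, (\<delta> ^^ k) x) \<in> W"
  shows "(dpoly_eval \<delta> g (\<lambda>_. b), dpoly_eval \<delta> (tr g) (\<lambda>_. x)) \<in> W"
  unfolding dpoly_eval_def keys_tr[OF g]
proof (intro pair_ring_sum[OF W(1)] pair_ring_mult[OF W(1)])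
  fix m assume m: "m \<in> keys g"
  show "(lookup g m, lookup (tr g) m) \<in> W"
    using graph_map_in[OF lookup_in_S[OF g]] W(2) by (auto simp: lookup_tr)
  have "keys m \<subseteq> V"
    by (rule dpolys_keys[OF g m])
  then show "(\<Prod>(i, k)\<in>keys m. (\<delta> ^^ k) b ^ lookup m (i, k),
      \<Prod>(i, k)\<in>keys m. (\<delta> ^^ k) x ^ lookup m (i, k)) \<in> W"
    using z by (intro pair_ring_prod[OF W(1)]) (auto intro!: pair_ring_power[OF W(1)])
qed

definition adjoin_generic :: "('a \<Rightarrow> 'a) \<Rightarrow> (unit \<times> nat) set \<Rightarrow> 'a \<Rightarrow> 'a \<Rightarrow> ('a \<times> 'a) set" where
  "adjoin_generic \<delta> V b x = {(dpoly_eval \<delta> g (\<lambda>_. b), dpoly_eval \<delta> (tr g) (\<lambda>_. x)) | g. g \<in> dpolys S V}"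

lemma adjoin_generic_superset: "T \<subseteq> adjoin_generic \<delta> V b x"
proof clarify
  fix y y' assume y: "(y, y') \<in> T"
  then have "y \<in> S" by force
  have "tr (dconst y) = dconst y'"
    by (rule poly_mapping_eqI) (simp add: lookup_tr lookup_single when_def graph_map_eq[OF y])
  then show "(y, y') \<in> adjoin_generic \<delta> V b x"
    unfolding adjoin_generic_def using dpolys_const[OF S \<open>y \<in> S\<close>, of V]
    by (auto intro!: exI[of _ "dconst y"])
qed

lemma adjoin_generic_generator:
  assumes "((), k) \<in> V"
  shows "((\<delta> ^^ k) b, (\<delta> ^^ k) x) \<in> adjoin_generic \<delta> V b x"
proof -
  have "tr (dvar ((), k)) = dvar ((), k)"
    by (rule poly_mapping_eqI) (simp add: dvar_def lookup_tr lookup_single when_def)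
  then show ?thesis
    unfolding adjoin_generic_def using dpolys_dvar[OF S assms]
    by (auto intro!: exI[of _ "dvar ((), k)"])
qed

text \<open>No nonzero polynomial vanishes at b or at x, so a value is 0 exactly if its polynomial
  is 0, and \<open>tr\<close> preserves this.\<close>

lemma partial_iso_adjoin_generic:
  assumes b: "\<And>g. g \<in> dpolys S V \<Longrightarrow> g \<noteq> 0 \<Longrightarrow> dpoly_eval \<delta> g (\<lambda>_. b) \<noteq> 0"
    and x: "\<And>g. g \<in> dpolys (snd ` T) V \<Longrightarrow> g \<noteq> 0 \<Longrightarrow> dpoly_eval \<delta> g (\<lambda>_. x) \<noteq> 0"
  shows "partial_iso (adjoin_generic \<delta> V b x)"
proof
  let ?G = "adjoin_generic \<delta> V b x"
  have minus: "dpoly_eval \<delta> (- p) x = - dpoly_eval \<delta> p x" for p :: "(unit, 'a) dpoly" and x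
    using dpoly_eval_add[of \<delta> p "- p" x] by (simp add: eq_neg_iff_add_eq_0 add.commute)
  note sub = subring_dpolys[OF S, of V]
  show "pair_ring ?G"
    unfolding pair_ring_def
  proof (intro conjI allI impI)
    show "(1, 1) \<in> ?G"
      using adjoin_generic_superset pair_ring_1[OF ring] by blast
  next
    fix y y' assume "(y, y') \<in> ?G"
    then obtain g where g: "g \<in> dpolys S V" "y = dpoly_eval \<delta> g (\<lambda>_. b)" "y' = dpoly_eval \<delta> (tr g) (\<lambda>_. x)"
      by (auto simp: adjoin_generic_def)
    then show "(- y, - y') \<in> ?G"
      unfolding adjoin_generic_def
      by (auto intro!: exI[of _ "- g"] simp: tr_minus minus subring_minus[OF sub])
  next
    fix y y' z z' assume "(y, y') \<in> ?G \<and> (z, z') \<in> ?G"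
    then obtain g h where g: "g \<in> dpolys S V" "y = dpoly_eval \<delta> g (\<lambda>_. b)" "y' = dpoly_eval \<delta> (tr g) (\<lambda>_. x)"
      and h: "h \<in> dpolys S V" "z = dpoly_eval \<delta> h (\<lambda>_. b)" "z' = dpoly_eval \<delta> (tr h) (\<lambda>_. x)"
      by (auto simp: adjoin_generic_def)
    show "(y + z, y' + z') \<in> ?G"
      unfolding adjoin_generic_def using g h
      by (auto intro!: exI[of _ "g + h"] simp: tr_add dpoly_eval_add subring_add[OF sub])
    show "(y * z, y' * z') \<in> ?G"
      unfolding adjoin_generic_def using g h
      by (auto intro!: exI[of _ "g * h"] simp: tr_mult dpoly_eval_mult subring_mult[OF sub])
  qed
  show "injective_graph ?G"
    unfolding injective_graph_def
  proof (intro allI impI)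
    fix y y' assume "(y, y') \<in> ?G"
    then obtain g where g: "g \<in> dpolys S V" "y = dpoly_eval \<delta> g (\<lambda>_. b)" "y' = dpoly_eval \<delta> (tr g) (\<lambda>_. x)"
      by (auto simp: adjoin_generic_def)
    have "y = 0 \<longleftrightarrow> g = 0"
      using b[OF g(1)] g(2) by auto
    moreover have "y' = 0 \<longleftrightarrow> tr g = 0"
      using x[OF tr_in[OF g(1)]] g(3) by auto
    ultimately show "y = 0 \<longleftrightarrow> y' = 0"
      by (simp add: tr_eq_0_iff[OF g(1)])
  qed
qed

end

section \<open>Realising types\<close>

text \<open>Saturation is used with finite parameter sets. Elements of the differential ring
  generated by \<open>A\<close> are values of terms over \<open>A\<close>, so conditions with such
  coefficients need no further parameters.\<close>

definition term_funs :: "('a::field_char_0 \<Rightarrow> 'a) \<Rightarrow> 'a set \<Rightarrow> ('a \<Rightarrow> 'a) set" where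
  "term_funs \<delta> A = {h. \<exists>t. term_params t \<subseteq> A \<and> term_vars t \<subseteq> {0} \<and> (\<forall>x. term_val \<delta> (\<lambda>_. x) t = h x)}"

lemma term_funs_add: "h \<in> term_funs \<delta> A \<Longrightarrow> k \<in> term_funs \<delta> A \<Longrightarrow> (\<lambda>x. h x + k x) \<in> term_funs \<delta> A"
proof -
  assume "h \<in> term_funs \<delta> A" "k \<in> term_funs \<delta> A"
  then obtain s t where "term_params s \<subseteq> A" "term_vars s \<subseteq> {0}" "\<forall>x. term_val \<delta> (\<lambda>_. x) s = h x"
    "term_params t \<subseteq> A" "term_vars t \<subseteq> {0}" "\<forall>x. term_val \<delta> (\<lambda>_. x) t = k x"
    by (auto simp: term_funs_def)
  then show ?thesis
    unfolding term_funs_def by (intro CollectI exI[of _ "Plus s t"]) auto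
qed

lemma term_funs_mult: "h \<in> term_funs \<delta> A \<Longrightarrow> k \<in> term_funs \<delta> A \<Longrightarrow> (\<lambda>x. h x * k x) \<in> term_funs \<delta> A"
proof -
  assume "h \<in> term_funs \<delta> A" "k \<in> term_funs \<delta> A"
  then obtain s t where "term_params s \<subseteq> A" "term_vars s \<subseteq> {0}" "\<forall>x. term_val \<delta> (\<lambda>_. x) s = h x"
    "term_params t \<subseteq> A" "term_vars t \<subseteq> {0}" "\<forall>x. term_val \<delta> (\<lambda>_. x) t = k x"
    by (auto simp: term_funs_def)
  then show ?thesis
    unfolding term_funs_def by (intro CollectI exI[of _ "Times s t"]) auto
qed

lemma term_funs_minus: "h \<in> term_funs \<delta> A \<Longrightarrow> (\<lambda>x. - h x) \<in> term_funs \<delta> A"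
proof -
  assume "h \<in> term_funs \<delta> A"
  then obtain t where "term_params t \<subseteq> A" "term_vars t \<subseteq> {0}" "\<forall>x. term_val \<delta> (\<lambda>_. x) t = h x"
    by (auto simp: term_funs_def)
  then show ?thesis
    unfolding term_funs_def by (intro CollectI exI[of _ "Uminus t"]) auto
qed

lemma term_funs_derivation: "h \<in> term_funs \<delta> A \<Longrightarrow> (\<lambda>x. \<delta> (h x)) \<in> term_funs \<delta> A"
proof -
  assume "h \<in> term_funs \<delta> A"
  then obtain t where "term_params t \<subseteq> A" "term_vars t \<subseteq> {0}" "\<forall>x. term_val \<delta> (\<lambda>_. x) t = h x"
    by (auto simp: term_funs_def)
  then show ?thesis
    unfolding term_funs_def by (intro CollectI exI[of _ "Der t"]) auto
qed

lemma term_funs_0: "(\<lambda>_. 0) \<in> term_funs \<delta> A"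
  unfolding term_funs_def by (intro CollectI exI[of _ Zero]) auto

lemma term_funs_1: "(\<lambda>_. 1) \<in> term_funs \<delta> A"
  unfolding term_funs_def by (intro CollectI exI[of _ One]) auto

lemma term_funs_id: "(\<lambda>x. x) \<in> term_funs \<delta> A"
  unfolding term_funs_def by (intro CollectI exI[of _ "Var 0"]) auto

lemma term_funs_param: "c \<in> A \<Longrightarrow> (\<lambda>_. c) \<in> term_funs \<delta> A"
  unfolding term_funs_def by (intro CollectI exI[of _ "Param c"]) auto

lemma term_funs_sum:
  "(\<And>i. i \<in> I \<Longrightarrow> h i \<in> term_funs \<delta> A) \<Longrightarrow> (\<lambda>x. \<Sum>i\<in>I. h i x) \<in> term_funs \<delta> A"
  by (induction I rule: infinite_finite_induct) (auto intro: term_funs_0 term_funs_add)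

lemma term_funs_prod:
  "(\<And>i. i \<in> I \<Longrightarrow> h i \<in> term_funs \<delta> A) \<Longrightarrow> (\<lambda>x. \<Prod>i\<in>I. h i x) \<in> term_funs \<delta> A"
  by (induction I rule: infinite_finite_induct) (auto intro: term_funs_1 term_funs_mult)

lemma term_funs_power: "h \<in> term_funs \<delta> A \<Longrightarrow> (\<lambda>x. h x ^ k) \<in> term_funs \<delta> A"
  by (induction k) (auto intro: term_funs_1 term_funs_mult)

lemma term_funs_funpow: "h \<in> term_funs \<delta> A \<Longrightarrow> (\<lambda>x. (\<delta> ^^ k) (h x)) \<in> term_funs \<delta> A"
  by (induction k) (auto intro: term_funs_derivation)

lemma term_funs_poly:
  assumes "\<And>k. (\<lambda>_. coeff p k) \<in> term_funs \<delta> A" "h \<in> term_funs \<delta> A"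
  shows "(\<lambda>x. poly p (h x)) \<in> term_funs \<delta> A"
  unfolding poly_altdef
  by (intro term_funs_sum term_funs_mult term_funs_power assms)

lemma term_funs_dpoly_eval:
  assumes "\<And>m. (\<lambda>_. lookup g m) \<in> term_funs \<delta> A"
  shows "(\<lambda>x. dpoly_eval \<delta> g (\<lambda>_::unit. x)) \<in> term_funs \<delta> A"
  unfolding dpoly_eval_def case_prod_unfold
  by (intro term_funs_sum term_funs_mult term_funs_prod term_funs_power term_funs_funpow
      term_funs_id assms)

text \<open>A finite parameter set is smaller than the infinite universe, so saturation applies.
  Only the inequations form an infinite family, whence finite satisfiability is asked for all of
  \<Phi> together with finitely many of them.\<close>

lemma realise:
  fixes \<delta> :: "'a::field_char_0 \<Rightarrow> 'a"
  assumes "saturated \<delta>" "finite A" "\<Phi> \<subseteq> unary_forms A"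
    and H: "H \<subseteq> term_funs \<delta> A"
    and fin: "\<And>H0. finite H0 \<Longrightarrow> H0 \<subseteq> H \<Longrightarrow>
      \<exists>x. (\<forall>\<phi>\<in>\<Phi>. holds \<delta> (\<lambda>_. x) \<phi>) \<and> (\<forall>h\<in>H0. h x \<noteq> 0)"
  obtains x where "\<And>\<phi>. \<phi> \<in> \<Phi> \<Longrightarrow> holds \<delta> (\<lambda>_. x) \<phi>" "\<And>h. h \<in> H \<Longrightarrow> h x \<noteq> 0"
proof -
  define tm where "tm h = (SOME t. term_params t \<subseteq> A \<and> term_vars t \<subseteq> {0} \<and>
      (\<forall>x. term_val \<delta> (\<lambda>_. x) t = h x))" for h
  have tm: "term_params (tm h) \<subseteq> A" "term_vars (tm h) \<subseteq> {0}" "term_val \<delta> (\<lambda>_. x) (tm h) = h x"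
    if "h \<in> H" for h x
  proof -
    have "\<exists>t. term_params t \<subseteq> A \<and> term_vars t \<subseteq> {0} \<and> (\<forall>x. term_val \<delta> (\<lambda>_. x) t = h x)"
      using H that by (auto simp: term_funs_def)
    from someI_ex[OF this] show "term_params (tm h) \<subseteq> A" "term_vars (tm h) \<subseteq> {0}"
      "term_val \<delta> (\<lambda>_. x) (tm h) = h x"
      unfolding tm_def[symmetric] by blast+
  qed
  define ne where "ne h = Neg (Equal (tm h) Zero)" for h
  have ne: "holds \<delta> (\<lambda>_. x) (ne h) \<longleftrightarrow> h x \<noteq> 0" if "h \<in> H" for h x
    using tm(3)[OF that] by (simp add: ne_def)
  have small: "A \<prec> (UNIV :: 'a set)"
    using assms(2) infinite_UNIV_char_0 by (intro finite_lesspoll_infinite)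
  have "ne h \<in> unary_forms A" if "h \<in> H" for h
    using tm(1,2)[OF that] by (simp add: unary_forms_def ne_def)
  then have sub: "\<Phi> \<union> ne ` H \<subseteq> unary_forms A"
    using assms(3) by auto
  have sat: "\<exists>x. \<forall>\<psi>\<in>\<Psi>. holds \<delta> (\<lambda>_. x) \<psi>" if \<Psi>: "finite \<Psi>" "\<Psi> \<subseteq> \<Phi> \<union> ne ` H" for \<Psi>
  proof -
    have "\<Psi> - \<Phi> \<subseteq> ne ` H"
      using \<Psi>(2) by auto
    then obtain H0 where H0: "H0 \<subseteq> H" "finite H0" "\<Psi> - \<Phi> = ne ` H0"
      using finite_subset_image[OF finite_Diff[OF \<Psi>(1)]] by metis
    obtain x where x: "\<forall>\<phi>\<in>\<Phi>. holds \<delta> (\<lambda>_. x) \<phi>" "\<forall>h\<in>H0. h x \<noteq> 0"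
      using fin[OF H0(2,1)] by blast
    have "holds \<delta> (\<lambda>_. x) \<psi>" if "\<psi> \<in> \<Psi>" for \<psi>
    proof (cases "\<psi> \<in> \<Phi>")
      case False
      then have "\<psi> \<in> ne ` H0"
        using that unfolding H0(3)[symmetric] by simp
      then obtain h where h: "h \<in> H0" "\<psi> = ne h"
        by (elim imageE)
      then have "h \<in> H"
        using H0(1) by auto
      then show ?thesis
        using x(2) h ne[of h x] by simp
    qed (use x in blast)
    then show ?thesis by blast
  qed
  have "\<exists>x. \<forall>\<phi>\<in>\<Phi> \<union> ne ` H. holds \<delta> (\<lambda>_. x) \<phi>"
    using assms(1)[unfolded saturated_def, rule_format, OF small, of "\<Phi> \<union> ne ` H"] sub sat by simp
  then obtain x where x: "\<forall>\<phi>\<in>\<Phi> \<union> ne ` H. holds \<delta> (\<lambda>_. x) \<phi>"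
    by blast
  show ?thesis
    by (rule that[of x]) (use x ne in auto)
qed

section \<open>Back and forth\<close>

text \<open>Closure of an extension under the derivation need only be checked on generators, because
  the pairs with derivatives in T' form a ring.\<close>

lemma derivation_closed_if_generators:
  assumes "pair_ring T'" "ring_derivation \<delta>"
  shows "pair_ring {(s, s'). (s, s') \<in> T' \<and> (\<delta> s, \<delta> s') \<in> T'}"
  unfolding pair_ring_def using pair_ring_1[OF assms(1)] pair_ring_0[OF assms(1)]
  by (auto simp: rd_1[OF assms(2)] rd_add[OF assms(2)] rd_mult[OF assms(2)] rd_minus[OF assms(2)]
      intro: pair_ring_add[OF assms(1)] pair_ring_mult[OF assms(1)] pair_ring_minus[OF assms(1)])

context partial_iso
begin

lemma generic_extension:
  assumes \<delta>: "ring_derivation \<delta>" and closed: "\<And>x x'. (x, x') \<in> T \<Longrightarrow> (\<delta> x, \<delta> x') \<in> T"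
    and b: "\<And>g :: (unit, 'a) dpoly. g \<in> dpolys S UNIV \<Longrightarrow> g \<noteq> 0 \<Longrightarrow> dpoly_eval \<delta> g (\<lambda>_. b) \<noteq> 0"
    and x: "\<And>g :: (unit, 'a) dpoly. g \<in> dpolys (snd ` T) UNIV \<Longrightarrow> g \<noteq> 0 \<Longrightarrow> dpoly_eval \<delta> g (\<lambda>_. x) \<noteq> 0"
  shows "\<exists>T'. partial_iso T' \<and> T \<subseteq> T' \<and> (b, x) \<in> T' \<and> (\<forall>(y, y')\<in>T'. (\<delta> y, \<delta> y') \<in> T')"
proof -
  define T' where "T' = adjoin_generic \<delta> UNIV b x"
  define W where "W = {(s, s'). (s, s') \<in> T' \<and> (\<delta> s, \<delta> s') \<in> T'}"
  have iso: "partial_iso T'"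
    unfolding T'_def by (rule partial_iso_adjoin_generic[OF b x])
  then interpret T': partial_iso T' .
  have W: "pair_ring W"
    unfolding W_def by (rule derivation_closed_if_generators[OF T'.ring \<delta>])
  have sup: "T \<subseteq> T'"
    unfolding T'_def by (rule adjoin_generic_superset)
  have gen: "((\<delta> ^^ k) b, (\<delta> ^^ k) x) \<in> T'" for k
    unfolding T'_def by (rule adjoin_generic_generator) simp
  have "T \<subseteq> W"
    using sup closed by (auto simp: W_def)
  moreover have "((\<delta> ^^ k) b, (\<delta> ^^ k) x) \<in> W" for k
    using gen[of k] gen[of "Suc k"] by (simp add: W_def)
  ultimately have "T' \<subseteq> W"
    unfolding T'_def adjoin_generic_def using pair_ring_dpoly_eval[OF W] by blast
  then show ?thesis
    using iso sup gen[of 0] by (intro exI[of _ T']) (auto simp: W_def)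
qed

text \<open>The case of b of order N: the derivatives of b below N are algebraically independent
  over \<open>S\<close>, and \<open>Q\<close> becomes a minimal polynomial of the N-th one. The
  isomorphism is extended to the independent derivatives, then to \<beta>, then to
  fractions.\<close>

lemma algebraic_extension:
  assumes \<delta>: "ring_derivation \<delta>" and closed: "\<And>x x'. (x, x') \<in> T \<Longrightarrow> (\<delta> x, \<delta> x') \<in> T"
    and b: "\<And>g. g \<in> dpolys S (below N) \<Longrightarrow> g \<noteq> 0 \<Longrightarrow> dpoly_eval \<delta> g (\<lambda>_. b) \<noteq> 0"
    and x: "\<And>g. g \<in> dpolys (snd ` T) (below N) \<Longrightarrow> g \<noteq> 0 \<Longrightarrow> dpoly_eval \<delta> g (\<lambda>_. x) \<noteq> 0"
    and Q: "\<And>k. coeff Q k \<in> dpolys S (below N)" "Q \<noteq> 0"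
    and Qb: "dpoly_eval \<delta> (poly Q (dvar ((), N))) (\<lambda>_. b) = 0"
    and Qx: "dpoly_eval \<delta> (poly (map_poly tr Q) (dvar ((), N))) (\<lambda>_. x) = 0"
    and min: "\<And>Q'. (\<And>k. coeff Q' k \<in> dpolys S (below N)) \<Longrightarrow> Q' \<noteq> 0 \<Longrightarrow>
      dpoly_eval \<delta> (poly Q' (dvar ((), N))) (\<lambda>_. b) = 0 \<Longrightarrow> degree Q \<le> degree Q'"
  shows "\<exists>T'. partial_iso T' \<and> T \<subseteq> T' \<and> (b, x) \<in> T' \<and> (\<forall>(y, y')\<in>T'. (\<delta> y, \<delta> y') \<in> T')"
proof -
  define T1 where "T1 = adjoin_generic \<delta> (below N) b x"
  define \<beta> \<xi> where "\<beta> = (\<delta> ^^ N) b" and "\<xi> = (\<delta> ^^ N) x"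
  interpret T1: partial_iso T1
    unfolding T1_def by (rule partial_iso_adjoin_generic[OF b x])
  have T1: "T \<subseteq> T1"
    unfolding T1_def by (rule adjoin_generic_superset)
  define ev where "ev g = dpoly_eval \<delta> g (\<lambda>_::unit. b)" for g
  have ev: "(ev g, dpoly_eval \<delta> (tr g) (\<lambda>_. x)) \<in> T1" if "g \<in> dpolys S (below N)" for g
    unfolding T1_def adjoin_generic_def ev_def using that by blast
  have ev_0: "ev g = 0 \<longleftrightarrow> g = 0" if "g \<in> dpolys S (below N)" for g
    using b[OF that] by (auto simp: ev_def)
  have [simp]: "ev 0 = 0" by (simp add: ev_def)
  define f where "f = map_poly ev Q"
  have f_poly: "f \<in> T1.polys"
    unfolding T1.polys_def f_def using ev[OF Q(1)] by (force simp: coeff_map_poly)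
  have deg_f: "degree f = degree Q"
  proof -
    have "ev (lead_coeff Q) \<noteq> 0"
      using ev_0[OF Q(1)] Q(2) by simp
    then show ?thesis
      unfolding f_def by (intro map_poly_degree_eq)
  qed
  have "f \<noteq> 0"
    using ev_0[OF Q(1), of "degree Q"] Q(2) by (auto simp: f_def poly_eq_iff coeff_map_poly)
  have f_\<beta>: "poly f \<beta> = 0"
    using Qb unfolding dpoly_eval_poly_dvar f_def ev_def \<beta>_def .
  have "T1.\<sigma>p f = map_poly (\<lambda>g. dpoly_eval \<delta> g (\<lambda>_. x)) (map_poly tr Q)"
    by (intro poly_eqI) (simp add: f_def coeff_map_poly T1.graph_map_eq[OF ev[OF Q(1)]])
  then have f_\<xi>: "poly (T1.\<sigma>p f) \<xi> = 0"
    using Qx unfolding dpoly_eval_poly_dvar \<xi>_def by simp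
  have f_min: "degree f \<le> degree p" if p: "p \<in> T1.polys" "p \<noteq> 0" "poly p \<beta> = 0" for p
  proof -
    \<comment> \<open>Minimality of \<open>Q\<close> refers to differential polynomials over
      \<open>S\<close>, that of f to polynomials over the ring of values. \<open>lift\<close> picks
      a preimage of each coefficient; its value at 0 is fixed because \<open>map_poly\<close> has to
      map 0 to 0.\<close>
    define lift where "lift s = (if s = 0 then 0 else SOME g. g \<in> dpolys S (below N) \<and> ev g = s)" for s
    have lift: "lift s \<in> dpolys S (below N) \<and> ev (lift s) = s" if "s \<in> fst ` T1" for s
    proof (cases "s = 0")
      case False
      have "\<exists>g. g \<in> dpolys S (below N) \<and> ev g = s"
        using that by (auto simp: T1_def adjoin_generic_def ev_def)
      from someI_ex[OF this] show ?thesis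
        using False by (simp add: lift_def)
    qed (simp add: lift_def dpolys_0[OF S])
    define Q' where "Q' = map_poly lift p"
    have l0: "lift 0 = 0" by (simp add: lift_def)
    have co: "coeff Q' k \<in> dpolys S (below N)" "ev (coeff Q' k) = coeff p k" for k
      using lift[OF T1.coeff_in_S[OF p(1)]] by (simp_all add: Q'_def coeff_map_poly l0)
    have "map_poly ev Q' = p"
      by (intro poly_eqI) (simp add: coeff_map_poly co)
    then have "dpoly_eval \<delta> (poly Q' (dvar ((), N))) (\<lambda>_. b) = 0"
      using p(3) unfolding dpoly_eval_poly_dvar ev_def[abs_def] \<beta>_def by simp
    moreover have "Q' \<noteq> 0"
      using \<open>map_poly ev Q' = p\<close> p(2) by auto
    ultimately have "degree Q \<le> degree Q'"
      using min[of Q'] co by blast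
    also have "degree Q' \<le> degree p"
      by (rule degree_le) (simp add: Q'_def coeff_map_poly l0 coeff_eq_0)
    finally show ?thesis
      by (simp add: deg_f)
  qed
  define T2 where "T2 = T1.adjoin \<beta> \<xi>"
  have transfer: "poly p \<beta> = 0 \<longleftrightarrow> poly (T1.\<sigma>p p) \<xi> = 0" if "p \<in> T1.polys" for p
    using T1.algebraic_transfer[OF f_poly \<open>f \<noteq> 0\<close> f_\<beta> f_\<xi> f_min that] .
  interpret T2: partial_iso T2
  proof
    show "pair_ring T2"
      unfolding T2_def by (rule T1.pair_ring_adjoin)
    show "injective_graph T2"
      using transfer by (auto simp: injective_graph_def T2_def T1.adjoin_def)
  qed
  \<comment> \<open>Fractions are needed since differentiating f (\<beta>) = 0 expresses \<delta>
    \<beta> as a quotient by f' (\<beta>).\<close>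
  define T3 where "T3 = T2.fractions"
  interpret T3: partial_iso T3
    unfolding T3_def by (rule T2.partial_iso_fractions)
  have T2: "T1 \<subseteq> T2"
    unfolding T2_def by (rule T1.adjoin_superset)
  have T3: "T2 \<subseteq> T3"
    unfolding T3_def by (rule T2.fractions_superset)
  define W where "W = {(s, s'). (s, s') \<in> T3 \<and> (\<delta> s, \<delta> s') \<in> T3}"
  have W: "pair_ring W"
    unfolding W_def by (rule derivation_closed_if_generators[OF T3.ring \<delta>])
  have gen: "((\<delta> ^^ k) b, (\<delta> ^^ k) x) \<in> T3" if "k \<le> N" for k
  proof (cases "k = N")
    case True
    then show ?thesis
      using T1.adjoin_generator[of \<beta> \<xi>] T3 by (auto simp: T2_def \<beta>_def \<xi>_def)
  next
    case False
    then have "((\<delta> ^^ k) b, (\<delta> ^^ k) x) \<in> T1"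
      unfolding T1_def using that by (intro adjoin_generic_generator) (simp add: below_def)
    then show ?thesis
      using T2 T3 by blast
  qed
  have "T \<subseteq> W"
    using T1 T2 T3 closed unfolding W_def by blast
  moreover have "((\<delta> ^^ k) b, (\<delta> ^^ k) x) \<in> W" if "((), k) \<in> below N" for k
    using that gen[of k] gen[of "Suc k"] by (simp add: W_def below_def)
  ultimately have T1_W: "T1 \<subseteq> W"
    unfolding T1_def adjoin_generic_def using pair_ring_dpoly_eval[OF W] by blast
  have \<beta>\<xi>: "(\<beta>, \<xi>) \<in> T3"
    using gen[of N] by (simp add: \<beta>_def \<xi>_def)
  have "(\<delta> \<beta>, \<delta> \<xi>) \<in> T3"
  proof -
    let ?f' = "T1.\<sigma>p f"
    have f'': "pderiv f \<in> T1.polys"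
      by (rule T1.polys_pderiv[OF f_poly])
    have "degree f \<noteq> 0"
      using \<open>f \<noteq> 0\<close> f_\<beta> by (metis degree_eq_zeroE pCons_0_0 poly_pCons mult_zero_right add.right_neutral poly_0)
    then have "pderiv f \<noteq> 0" "degree (pderiv f) < degree f"
      by (auto simp: pderiv_eq_0_iff degree_pderiv)
    \<comment> \<open>In characteristic 0 the derivative of f is nonzero of smaller degree, so
      minimality keeps it from vanishing at \<beta>.\<close>
    then have nz: "poly (pderiv f) \<beta> \<noteq> 0"
      using f_min[OF f''] by auto
    have d1: "(poly (pderiv f) \<beta>, poly (pderiv ?f') \<xi>) \<in> T3"
      using f'' T3 T1.\<sigma>p_pderiv[OF f_poly] unfolding T2_def T1.adjoin_def by force
    have d2: "(poly (map_poly \<delta> f) \<beta>, poly (map_poly \<delta> ?f') \<xi>) \<in> T3"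
    proof -
      have \<delta>0: "\<delta> 0 = 0" by (rule rd_0[OF \<delta>])
      have c: "(\<delta> (coeff f k), \<delta> (T1.\<sigma> (coeff f k))) \<in> T3" for k
        using T1_W T1.graph_map_in[OF T1.coeff_in_S[OF f_poly]] by (auto simp: W_def)
      then have "(coeff (map_poly \<delta> f) k, T3.\<sigma> (coeff (map_poly \<delta> f) k)) \<in> T3" for k
        using T3.graph_map_eq by (metis coeff_map_poly \<delta>0)
      then have "(poly (map_poly \<delta> f) \<beta>, poly (map_poly T3.\<sigma> (map_poly \<delta> f)) \<xi>) \<in> T3"
        using T3.graph_map_0 \<beta>\<xi> by (intro pair_ring_poly[OF T3.ring])
      moreover have "map_poly T3.\<sigma> (map_poly \<delta> f) = map_poly \<delta> ?f'"
        by (intro poly_eqI) (simp add: coeff_map_poly \<delta>0 T3.graph_map_eq[OF c])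
      ultimately show ?thesis by simp
    qed
    have e: "poly (map_poly \<delta> f) \<beta> + poly (pderiv f) \<beta> * \<delta> \<beta> = 0"
      "poly (map_poly \<delta> ?f') \<xi> + poly (pderiv ?f') \<xi> * \<delta> \<xi> = 0"
      using rd_poly[OF \<delta>, of f \<beta>] rd_poly[OF \<delta>, of ?f' \<xi>] rd_0[OF \<delta>] f_\<beta> f_\<xi> by simp_all
    have nz': "poly (pderiv ?f') \<xi> \<noteq> 0"
      using d1 nz T3.inj by (auto simp: injective_graph_def)
    have "\<delta> \<beta> = - poly (map_poly \<delta> f) \<beta> / poly (pderiv f) \<beta>"
      "\<delta> \<xi> = - poly (map_poly \<delta> ?f') \<xi> / poly (pderiv ?f') \<xi>"
      using e nz nz' by (simp_all add: field_simps eq_neg_iff_add_eq_0)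
    then show ?thesis
      using T2.fractions_divide[of "- poly (map_poly \<delta> f) \<beta>" "- poly (map_poly \<delta> ?f') \<xi>"
          "poly (pderiv f) \<beta>" "poly (pderiv ?f') \<xi>"] d1 nz pair_ring_minus[OF T3.ring d2]
      unfolding T3_def by simp
  qed
  then have \<beta>W: "(\<beta>, \<xi>) \<in> W"
    using \<beta>\<xi> by (simp add: W_def)
  have "T2 \<subseteq> W"
  proof clarify
    fix y y' assume "(y, y') \<in> T2"
    then obtain p where p: "p \<in> T1.polys" "y = poly p \<beta>" "y' = poly (T1.\<sigma>p p) \<xi>"
      by (auto simp: T2_def T1.adjoin_def)
    have "(coeff p k, T1.\<sigma> (coeff p k)) \<in> W" for k
      using T1_W T1.graph_map_in[OF T1.coeff_in_S[OF p(1)]] by blast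
    then show "(y, y') \<in> W"
      unfolding p using \<beta>W T1.graph_map_0 by (intro pair_ring_poly[OF W])
  qed
  then have "(\<delta> y, \<delta> y') \<in> T3" if "(y, y') \<in> T3" for y y'
    using T2.fractions_derivation[OF \<delta>, of y y'] that unfolding T3_def W_def by blast
  then show ?thesis
    using T1 T2 T3 gen[of 0] T3.partial_iso_axioms by (intro exI[of _ T3]) auto
qed

end

section \<open>Extension of partial isomorphisms and equality of types\<close>

lemma dpoly_finite_order:
  assumes "finite \<Gamma>"
  obtains N where "\<And>g. g \<in> \<Gamma> \<Longrightarrow> dpoly_vars g \<subseteq> below N"
proof -
  have "finite (\<Union>g\<in>\<Gamma>. dpoly_vars g)"
    using assms by (auto simp: dpoly_vars_def)
  then have fin: "finite (snd ` (\<Union>g\<in>\<Gamma>. dpoly_vars g))"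
    by (rule finite_imageI)
  show ?thesis
  proof (rule that[of "Suc (Max (insert 0 (snd ` (\<Union>g\<in>\<Gamma>. dpoly_vars g))))"], rule subsetI)
    fix g v assume "g \<in> \<Gamma>" "v \<in> dpoly_vars g"
    then have "snd v \<in> insert 0 (snd ` (\<Union>g\<in>\<Gamma>. dpoly_vars g))"
      by blast
    then have "snd v \<le> Max (insert 0 (snd ` (\<Union>g\<in>\<Gamma>. dpoly_vars g)))"
      using fin by (intro Max_ge) auto
    then show "v \<in> below (Suc (Max (insert 0 (snd ` (\<Union>g\<in>\<Gamma>. dpoly_vars g)))))"
      by (cases v) (simp add: below_def)
  qed
qed

lemma dpoly_eval_no_vars:
  assumes "g \<in> dpolys S {}" "g \<noteq> 0"
  shows "dpoly_eval \<delta> g x \<noteq> 0"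
proof -
  have g: "g = dconst (lookup g 0)"
  proof (rule poly_mapping_eqI)
    fix m
    show "lookup g m = lookup (dconst (lookup g 0)) m"
    proof (cases "m \<in> keys g")
      case True
      then have "m = 0"
        using dpolys_keys[OF assms(1)] by (metis keys_eq_empty subset_empty)
      then show ?thesis by simp
    next
      case False
      then show ?thesis
        by (cases "m = 0") (auto simp: in_keys_iff lookup_single when_def)
    qed
  qed
  have "dpoly_eval \<delta> g x = lookup g 0"
    by (subst g) simp
  then show ?thesis
    using g assms(2) by (metis single_zero)
qed

lemma finite_term_params: "finite (term_params t)"
  by (induction t) auto

lemma finite_params: "finite (params \<phi>)"
  by (induction \<phi>) (auto simp: finite_term_params)

lemma term_funs_term_val:
  "term_params t \<subseteq> A \<Longrightarrow> (\<lambda>_. term_val \<delta> v t) \<in> term_funs \<delta> (A \<union> range v)"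
  by (induction t)
    (auto intro: term_funs_param term_funs_0 term_funs_1 term_funs_add term_funs_mult
      term_funs_minus term_funs_derivation)

lemma term_funs_form:
  assumes "h \<in> term_funs \<delta> A"
  obtains \<phi> where "\<phi> \<in> unary_forms A" "\<And>x. holds \<delta> (\<lambda>_. x) \<phi> \<longleftrightarrow> h x = 0"
proof -
  obtain t where "term_params t \<subseteq> A" "term_vars t \<subseteq> {0}" "\<forall>x. term_val \<delta> (\<lambda>_. x) t = h x"
    using assms by (auto simp: term_funs_def)
  then show ?thesis
    by (intro that[of "Equal t Zero"]) (auto simp: unary_forms_def)
qed

text \<open>If b is differentially transcendental over \<open>S\<close>, x has to avoid all
  equations over the image. Otherwise b has an order N and a minimal polynomial for its N-th
  derivative, and x has to satisfy the image of that polynomial and no equation of order below N.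
  Finite parts of these types are realised by Blum's axioms.\<close>

lemma (in partial_iso) extend:
  assumes \<delta>: "ring_derivation \<delta>" and dc: "differentially_closed \<delta>" and sat: "saturated \<delta>"
    and A: "finite A" "\<And>c. c \<in> snd ` T \<Longrightarrow> (\<lambda>_. c) \<in> term_funs \<delta> A"
    and closed: "\<And>x x'. (x, x') \<in> T \<Longrightarrow> (\<delta> x, \<delta> x') \<in> T"
  shows "\<exists>x T'. partial_iso T' \<and> T \<subseteq> T' \<and> (b, x) \<in> T' \<and> (\<forall>(y, y')\<in>T'. (\<delta> y, \<delta> y') \<in> T')"
proof -
  define ev where "ev g x = dpoly_eval \<delta> g (\<lambda>_::unit. x)" for g x
  have UNIV_ring: "subring (UNIV :: 'a set)"
    by (simp add: subring_def)
  have S': "subring (snd ` T)"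
  proof -
    have "pair_ring (T\<inverse>)"
      using ring by (auto simp: pair_ring_def)
    moreover have "fst ` (T\<inverse>) = snd ` T"
      by force
    ultimately show ?thesis
      using subring_fst by metis
  qed
  have ev_fun: "ev g \<in> term_funs \<delta> A" if "g \<in> dpolys (snd ` T) V" for g V
    unfolding ev_def[abs_def] using that A(2) by (intro term_funs_dpoly_eval) (auto simp: dpolys_def)
  \<comment> \<open>Finitely many inequations are combined into one by multiplication. That the
    product is nonzero rests on a linear order of the monomials, hence on the lexicographic order of
    the pairs.\<close>
  have avoid: "\<exists>x. ev (poly Q (dvar ((), N))) x = 0 \<and> (\<forall>h\<in>H0. h x \<noteq> 0)"
    if H0: "finite H0" "H0 \<subseteq> ev ` (dpolys UNIV (below N) - {0})"
      and Q: "\<And>k. coeff Q k \<in> dpolys UNIV (below N)" "degree Q > 0" for H0 Q N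
  proof -
    obtain \<Gamma> where \<Gamma>: "finite \<Gamma>" "\<Gamma> \<subseteq> dpolys UNIV (below N) - {0}" "H0 = ev ` \<Gamma>"
      using H0 finite_subset_image by metis
    have "prod (\<lambda>g. g) \<Gamma> \<noteq> 0"
      using \<Gamma> by (auto simp: prod_zero_iff)
    moreover have "prod (\<lambda>g. g) \<Gamma> \<in> dpolys UNIV (below N)"
      using \<Gamma> by (intro subring_prod[OF subring_dpolys[OF UNIV_ring]]) auto
    ultimately obtain x where x: "ev (poly Q (dvar ((), N))) x = 0" "ev (prod (\<lambda>g. g) \<Gamma>) x \<noteq> 0"
      unfolding ev_def using blum[OF dc _ _ Q] by blast
    then have "(\<Prod>g\<in>\<Gamma>. ev g x) \<noteq> 0"
      by (simp add: ev_def dpoly_eval_prod)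
    then show ?thesis
      using x(1) \<Gamma> by auto
  qed
  show ?thesis
  proof (cases "\<exists>g\<in>dpolys S UNIV. g \<noteq> 0 \<and> ev g b = 0")
    case False
    define H where "H = ev ` (dpolys (snd ` T) UNIV - {0})"
    have "\<exists>x. (\<forall>\<phi>\<in>{}. holds \<delta> (\<lambda>_. x) \<phi>) \<and> (\<forall>h\<in>H0. h x \<noteq> 0)" if H0: "finite H0" "H0 \<subseteq> H" for H0
    proof -
      obtain \<Gamma> where \<Gamma>: "finite \<Gamma>" "\<Gamma> \<subseteq> dpolys (snd ` T) UNIV - {0}" "H0 = ev ` \<Gamma>"
        using H0 finite_subset_image unfolding H_def by metis
      obtain N where "\<And>g. g \<in> \<Gamma> \<Longrightarrow> dpoly_vars g \<subseteq> below N"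
        using dpoly_finite_order[OF \<Gamma>(1)] by blast
      then have "\<Gamma> \<subseteq> dpolys UNIV (below N) - {0}"
        using \<Gamma>(2) by (auto simp: dpolys_def)
      then have "H0 \<subseteq> ev ` (dpolys UNIV (below N) - {0})"
        using \<Gamma>(3) by blast
      moreover have "(1 :: (unit, 'a) dpoly) \<in> dpolys UNIV (below N)"
        "(0 :: (unit, 'a) dpoly) \<in> dpolys UNIV (below N)"
        by (rule subring_1[OF subring_dpolys[OF UNIV_ring]], rule dpolys_0[OF UNIV_ring])
      \<comment> \<open>Blum's axiom needs an equation of order above the inequations;
        \<open>[:0, 1:]\<close> says that the N-th derivative is 0.\<close>
      then have "coeff [:0, 1 :: (unit, 'a) dpoly:] k \<in> dpolys UNIV (below N)" for k
        by (simp add: coeff_pCons split: nat.split)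
      ultimately show ?thesis
        using avoid[OF H0(1), of N "[:0, 1:]"] by auto
    qed
    moreover have "H \<subseteq> term_funs \<delta> A"
      unfolding H_def using ev_fun by blast
    ultimately obtain x where x: "\<And>h. h \<in> H \<Longrightarrow> h x \<noteq> 0"
      using realise[OF sat A(1), of "{}" H] by (metis empty_subsetI)
    have "dpoly_eval \<delta> g (\<lambda>_. x) \<noteq> 0" if g: "g \<in> dpolys (snd ` T) UNIV" "g \<noteq> 0" for g :: "(unit, 'a) dpoly"
    proof -
      have "ev g \<in> H"
        using g by (simp add: H_def)
      from x[OF this] show ?thesis
        by (simp add: ev_def)
    qed
    then show ?thesis
      using False by (intro exI[of _ x] generic_extension[OF \<delta> closed]) (auto simp: ev_def)
  next
    case True
    \<comment> \<open>Passing from \<open>\<not> bad N\<close> to \<open>bad (Suc N)\<close> locates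
      the order N of b over \<open>S\<close>.\<close>
    define bad where "bad N \<longleftrightarrow> (\<exists>g\<in>dpolys S (below N). g \<noteq> 0 \<and> ev g b = 0)" for N
    obtain g where g: "g \<in> dpolys S UNIV" "g \<noteq> 0" "ev g b = 0"
      using True by blast
    obtain N0 where "dpoly_vars g \<subseteq> below N0"
      using dpoly_finite_order[of "{g}"] by auto
    then have "bad N0"
      unfolding bad_def using g by (intro bexI[of _ g]) (auto simp: dpolys_def)
    moreover have "\<not> bad 0"
      unfolding bad_def ev_def using dpoly_eval_no_vars by (auto simp: below_def)
    ultimately obtain N where N: "\<not> bad N" "bad (Suc N)"
      using ex_least_nat_less[of bad N0] by blast
    obtain g where g: "g \<in> dpolys S (below (Suc N))" "g \<noteq> 0" "ev g b = 0"
      using N(2) by (auto simp: bad_def)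
    have "below (Suc N) = insert ((), N) (below N)"
      by (auto simp: below_def)
    with g(1) have "g \<in> dpolys S (insert ((), N) (below N))"
      by simp
    then obtain Q0 where Q0: "\<And>k. coeff Q0 k \<in> dpolys S (below N)" "g = poly Q0 (dvar ((), N))"
      using dpolys_decompose[OF S] by blast
    define good where "good Q \<longleftrightarrow> (\<forall>k. coeff Q k \<in> dpolys S (below N)) \<and> Q \<noteq> 0
      \<and> ev (poly Q (dvar ((), N))) b = 0" for Q
    have "good Q0"
      using Q0 g by (auto simp: good_def)
    then have ex: "\<exists>d Q. good Q \<and> degree Q = d"
      by blast
    define d where "d = (LEAST d. \<exists>Q. good Q \<and> degree Q = d)"
    obtain Q where Q: "good Q" "degree Q = d"
      using LeastI_ex[OF ex] unfolding d_def by blast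
    have min: "degree Q \<le> degree Q'" if "good Q'" for Q'
      unfolding Q(2) d_def using that by (intro Least_le) blast
    have co: "coeff Q k \<in> dpolys S (below N)" for k
      using Q(1) by (simp add: good_def)
    have "degree Q > 0"
    proof (rule ccontr)
      assume "\<not> degree Q > 0"
      then obtain q where q: "Q = [:q:]"
        by (metis degree_eq_zeroE neq0_conv)
      then have "q \<in> dpolys S (below N)" "q \<noteq> 0" "ev q b = 0"
        using Q(1) co[of 0] by (auto simp: good_def)
      with N(1) show False
        by (auto simp: bad_def)
    qed
    define Q' where "Q' = map_poly tr Q"
    have co': "coeff Q' k \<in> dpolys (snd ` T) (below N)" for k
      using tr_in[OF co] by (simp add: Q'_def coeff_map_poly)
    have "degree Q' = degree Q"
      unfolding Q'_def using tr_eq_0_iff[OF co] \<open>degree Q > 0\<close> by (intro map_poly_degree_eq) auto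
    define H where "H = ev ` (dpolys (snd ` T) (below N) - {0})"
    have "poly Q' (dvar ((), N)) \<in> dpolys (snd ` T) UNIV"
      using co' by (intro subring_poly[OF subring_dpolys[OF S']] dpolys_dvar[OF S'])
        (auto intro: dpolys_mono[OF co'])
    then obtain \<phi> where \<phi>: "\<phi> \<in> unary_forms A"
      "\<And>x. holds \<delta> (\<lambda>_. x) \<phi> \<longleftrightarrow> ev (poly Q' (dvar ((), N))) x = 0"
      using term_funs_form[OF ev_fun] by blast
    have "\<exists>x. (\<forall>\<phi>\<in>{\<phi>}. holds \<delta> (\<lambda>_. x) \<phi>) \<and> (\<forall>h\<in>H0. h x \<noteq> 0)" if H0: "finite H0" "H0 \<subseteq> H" for H0
    proof -
      have "H0 \<subseteq> ev ` (dpolys UNIV (below N) - {0})"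
      proof -
        have "dpolys (snd ` T) (below N) \<subseteq> dpolys UNIV (below N)"
          by (auto simp: dpolys_def)
        then show ?thesis
          using H0(2) unfolding H_def by blast
      qed
      moreover have "coeff Q' k \<in> dpolys UNIV (below N)" for k
        using co' by (rule dpolys_mono) auto
      ultimately show ?thesis
        using avoid[OF H0(1), of N Q'] \<phi>(2) \<open>degree Q' = degree Q\<close> \<open>degree Q > 0\<close> by auto
    qed
    moreover have "H \<subseteq> term_funs \<delta> A"
      unfolding H_def using ev_fun by blast
    moreover have "{\<phi>} \<subseteq> unary_forms A"
      using \<phi>(1) by simp
    ultimately obtain x where x: "ev (poly Q' (dvar ((), N))) x = 0" "\<And>h. h \<in> H \<Longrightarrow> h x \<noteq> 0"
      using realise[OF sat A(1), of "{\<phi>}" H] \<phi>(2) by (metis singletonI)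
    show ?thesis
    proof (intro exI[of _ x] algebraic_extension[OF \<delta> closed, of N b x Q])
      show "dpoly_eval \<delta> g (\<lambda>_. b) \<noteq> 0" if "g \<in> dpolys S (below N)" "g \<noteq> 0" for g
        using N(1) that by (auto simp: bad_def ev_def)
      show "dpoly_eval \<delta> g (\<lambda>_. x) \<noteq> 0" if "g \<in> dpolys (snd ` T) (below N)" "g \<noteq> 0" for g
        using x(2)[of "ev g"] that unfolding H_def by (simp add: ev_def[of g])
      show "degree Q \<le> degree Q''" if "\<And>k. coeff Q'' k \<in> dpolys S (below N)" "Q'' \<noteq> 0"
        "dpoly_eval \<delta> (poly Q'' (dvar ((), N))) (\<lambda>_. b) = 0" for Q''
        using that by (intro min) (simp add: good_def ev_def)
    qed (use Q(1) x(1) in \<open>auto simp: good_def ev_def Q'_def\<close>)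
  qed
qed

text \<open>Equality of quantifier-free types over \<open>A\<close>; equations s = t are covered by
  the term s - t.\<close>

definition same_type :: "('a::field_char_0 \<Rightarrow> 'a) \<Rightarrow> 'a set \<Rightarrow> (nat \<Rightarrow> 'a) \<Rightarrow> (nat \<Rightarrow> 'a) \<Rightarrow> bool" where
  "same_type \<delta> A v v' \<longleftrightarrow>
     (\<forall>t. term_params t \<subseteq> A \<longrightarrow> (term_val \<delta> v t = 0 \<longleftrightarrow> term_val \<delta> v' t = 0))"

lemma same_type_sym: "same_type \<delta> A v v' \<Longrightarrow> same_type \<delta> A v' v"
  by (auto simp: same_type_def)

lemma same_type_extend:
  fixes \<delta> :: "'a::field_char_0 \<Rightarrow> 'a"
  assumes dc: "differentially_closed \<delta>" and sat: "saturated \<delta>"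
    and "finite A" "finite (range v')" "same_type \<delta> A v v'"
  obtains x where "same_type \<delta> A (v(k := b)) (v'(k := x))"
proof -
  have \<delta>: "ring_derivation \<delta>"
    using dc by (simp add: differentially_closed_def ring_derivation_if_derivation)
  \<comment> \<open>The correspondence of term values. Its image lies in the differential ring
    generated by \<open>A\<close> and the finitely many values of v', so the type to be realised has
    finitely many parameters.\<close>
  define T where "T = {(term_val \<delta> v t, term_val \<delta> v' t) | t. term_params t \<subseteq> A}"
  have TI: "term_params t \<subseteq> A \<Longrightarrow> (term_val \<delta> v t, term_val \<delta> v' t) \<in> T" for t
    by (auto simp: T_def)
  interpret T: partial_iso T
  proof
    show "pair_ring T"
      unfolding pair_ring_def
    proof (intro conjI allI impI)
      show "(1, 1) \<in> T"
        using TI[of One] by simp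
    next
      fix x x' assume "(x, x') \<in> T"
      then obtain t where "term_params t \<subseteq> A" "x = term_val \<delta> v t" "x' = term_val \<delta> v' t"
        by (auto simp: T_def)
      then show "(- x, - x') \<in> T"
        using TI[of "Uminus t"] by simp
    next
      fix x x' y y' assume "(x, x') \<in> T \<and> (y, y') \<in> T"
      then obtain s t where "term_params s \<subseteq> A" "x = term_val \<delta> v s" "x' = term_val \<delta> v' s"
        "term_params t \<subseteq> A" "y = term_val \<delta> v t" "y' = term_val \<delta> v' t"
        by (auto simp: T_def)
      then show "(x + y, x' + y') \<in> T" "(x * y, x' * y') \<in> T"
        using TI[of "Plus s t"] TI[of "Times s t"] by simp_all
    qed
    show "injective_graph T"
      using assms(5) by (auto simp: injective_graph_def T_def same_type_def)
  qed
  have "(\<lambda>_. c) \<in> term_funs \<delta> (A \<union> range v')" if "c \<in> snd ` T" for c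
    using that term_funs_term_val by (auto simp: T_def)
  moreover have "(\<delta> x, \<delta> x') \<in> T" if xx': "(x, x') \<in> T" for x x'
  proof -
    obtain t where "term_params t \<subseteq> A" "x = term_val \<delta> v t" "x' = term_val \<delta> v' t"
      using xx' by (auto simp: T_def)
    then show ?thesis
      using TI[of "Der t"] by simp
  qed
  moreover have "finite (A \<union> range v')"
    using assms by simp
  ultimately obtain x T' where T': "partial_iso T'" "T \<subseteq> T'" "(b, x) \<in> T'"
      "\<And>y y'. (y, y') \<in> T' \<Longrightarrow> (\<delta> y, \<delta> y') \<in> T'"
    using T.extend[OF \<delta> dc sat, of "A \<union> range v'" b] by blast
  interpret T': partial_iso T' by (rule T'(1))
  have "(term_val \<delta> (v(k := b)) t, term_val \<delta> (v'(k := x)) t) \<in> T'" if "term_params t \<subseteq> A" for t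
    using that
  proof (induction t)
    case (Var m)
    then show ?case
      using T'(2,3) TI[of "Var m"] by auto
  next
    case (Param c)
    then show ?case
      using T'(2) TI[of "Param c"] by auto
  qed (auto intro: pair_ring_0[OF T'.ring] pair_ring_1[OF T'.ring] pair_ring_add[OF T'.ring]
      pair_ring_minus[OF T'.ring] pair_ring_mult[OF T'.ring] T'(4))
  then have "same_type \<delta> A (v(k := b)) (v'(k := x))"
    using T'.inj by (auto simp: same_type_def injective_graph_def)
  then show ?thesis
    by (rule that)
qed

text \<open>Only the existential quantifier needs \<open>same_type_extend\<close>, and symmetry
  gives the other direction. Updates preserve the finite range of assignments, which keeps the
  parameter sets finite.\<close>

lemma same_type_holds:
  fixes \<delta> :: "'a::field_char_0 \<Rightarrow> 'a"
  assumes dc: "differentially_closed \<delta>" and sat: "saturated \<delta>" and A: "finite A"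
    and "params \<phi> \<subseteq> A" "finite (range v)" "finite (range v')" "same_type \<delta> A v v'"
  shows "holds \<delta> v \<phi> \<longleftrightarrow> holds \<delta> v' \<phi>"
  using assms(4-)
proof (induction \<phi> arbitrary: v v')
  case (Equal s t)
  then have "term_val \<delta> v (Plus s (Uminus t)) = 0 \<longleftrightarrow> term_val \<delta> v' (Plus s (Uminus t)) = 0"
    by (intro same_type_def[THEN iffD1, rule_format]) auto
  then show ?case
    by simp
next
  case (Exists k \<phi>)
  have fin: "finite (range (w(k := x)))" if "finite (range w)" for w :: "nat \<Rightarrow> 'a" and x
    by (rule finite_subset[of _ "insert x (range w)"]) (use that in auto)
  have "holds \<delta> w' (Exists k \<phi>)" if w: "finite (range w)" "finite (range w')" "same_type \<delta> A w w'"
    "holds \<delta> w (Exists k \<phi>)" for w w'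
  proof -
    obtain b where b: "holds \<delta> (w(k := b)) \<phi>"
      using w(4) by auto
    obtain x where x: "same_type \<delta> A (w(k := b)) (w'(k := x))"
      using same_type_extend[OF dc sat A w(2,3)] by blast
    have "holds \<delta> (w'(k := x)) \<phi>"
      using Exists.IH[OF _ fin[OF w(1)] fin[OF w(2)] x] Exists.prems(1) b unfolding dform.set by blast
    then show ?thesis by auto
  qed
  then show ?case
    using Exists.prems same_type_sym by metis
qed auto

section \<open>Strong minimality\<close>

definition coeffs_in :: "'r::comm_ring_1 set \<Rightarrow> 'r poly set" where
  "coeffs_in C = {p. \<forall>k. coeff p k \<in> C}"

lemma coeffs_inD: "p \<in> coeffs_in C \<Longrightarrow> coeff p k \<in> C"
  by (simp add: coeffs_in_def)

lemma subring_coeffs_in: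
  fixes C :: "'r::idom set"
  assumes "subring C"
  shows "subring (coeffs_in C)"
  unfolding subring_def
proof (intro conjI ballI)
  show "1 \<in> coeffs_in C"
    using subring_0[OF assms] subring_1[OF assms]
    by (simp add: coeffs_in_def one_pCons coeff_pCons split: nat.split)
  fix p q assume "p \<in> coeffs_in C" "q \<in> coeffs_in C"
  then show "p + q \<in> coeffs_in C" "p * q \<in> coeffs_in C"
    by (auto simp: coeffs_in_def coeff_mult
        intro!: subring_sum[OF assms] subring_add[OF assms] subring_mult[OF assms])
qed (auto simp: coeffs_in_def intro: subring_minus[OF assms])

lemma coeffs_in_pderiv:
  fixes C :: "'r::idom set"
  assumes "subring C" "p \<in> coeffs_in C"
  shows "pderiv p \<in> coeffs_in C"
  using assms by (auto simp: coeffs_in_def coeff_pderiv simp del: of_nat_Suc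
      intro: subring_mult subring_of_nat)

lemma flow_derivation_coeffs_in:
  fixes \<delta> :: "'a::field_char_0 \<Rightarrow> 'a"
  assumes C: "subring C" "\<And>c. c \<in> C \<Longrightarrow> \<delta> c \<in> C" and "\<delta> 0 = 0"
    and P: "P \<in> coeffs_in C" and G: "G \<in> coeffs_in (coeffs_in C)"
  shows "flow_derivation \<delta> P G \<in> coeffs_in (coeffs_in C)"
proof -
  note C1 = subring_coeffs_in[OF C(1)]
  note C2 = subring_coeffs_in[OF C1]
  have co: "coeff G k \<in> coeffs_in C" for k
    using G by (simp add: coeffs_in_def)
  have "map_poly (map_poly \<delta>) G \<in> coeffs_in (coeffs_in C)"
    using G C(2) assms(3) by (simp add: coeffs_in_def coeff_map_poly)
  moreover have "pCons 0 (map_poly pderiv G) \<in> coeffs_in (coeffs_in C)"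
    using coeffs_in_pderiv[OF C(1) co] subring_0[OF C1]
    by (simp add: coeffs_in_def[of "coeffs_in C"] coeff_map_poly coeff_pCons split: nat.split)
  moreover have "smult P (pderiv G) \<in> coeffs_in (coeffs_in C)"
    using coeffs_in_pderiv[OF C1 G] subring_mult[OF C1 P]
    by (simp add: coeffs_in_def[of "coeffs_in C"])
  ultimately show ?thesis
    unfolding flow_derivation_def by (intro subring_add[OF C2])
qed

lemma term_funs_curve_eval:
  assumes "\<And>c. c \<in> C \<Longrightarrow> (\<lambda>_. c) \<in> term_funs \<delta> A" "G \<in> coeffs_in (coeffs_in C)"
  shows "(\<lambda>x. curve_eval G x (\<delta> x)) \<in> term_funs \<delta> A"
  using assms(2)
proof (induction G)
  case 0
  show ?case
    by (simp add: term_funs_0)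
next
  case (pCons q G)
  have q: "coeff q k \<in> C" for k
    using coeffs_inD[OF coeffs_inD[OF pCons.prems, of 0], of k] by simp
  have "coeff G k \<in> coeffs_in C" for k
    using coeffs_inD[OF pCons.prems, of "Suc k"] by simp
  then have "G \<in> coeffs_in (coeffs_in C)"
    by (simp add: coeffs_in_def[of "coeffs_in C"])
  then have "(\<lambda>x. curve_eval G x (\<delta> x)) \<in> term_funs \<delta> A"
    by (rule pCons.IH)
  then show ?case
    using q assms(1) by (simp only: curve_eval_pCons)
      (intro term_funs_add term_funs_mult term_funs_derivation term_funs_id term_funs_poly; simp)
qed

context generic_coefficients
begin

text \<open>Each nonzero curve contains only finitely many solutions, so finitely many curves do not
  exhaust an infinite set of solutions; saturation then avoids all curves over C at once.\<close>

lemma generic_point: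
  assumes closed: "differentially_closed \<delta>" and sat: "saturated \<delta>" and "finite A"
    and C: "\<And>c. c \<in> C \<Longrightarrow> (\<lambda>_. c) \<in> term_funs \<delta> A"
    and \<phi>: "\<phi> \<in> unary_forms A" "infinite {x. holds \<delta> (\<lambda>_. x) \<phi>}"
    and sub: "{x. holds \<delta> (\<lambda>_. x) \<phi>} \<subseteq> {x. \<delta> (\<delta> x) = poly (force \<alpha> a n) x}"
  obtains x where "holds \<delta> (\<lambda>_. x) \<phi>"
    "\<And>G. G \<in> coeffs_in (coeffs_in C) \<Longrightarrow> G \<noteq> 0 \<Longrightarrow> curve_eval G x (\<delta> x) \<noteq> 0"
proof -
  define h where "h G x = curve_eval G x (\<delta> x)" for G x
  define H where "H = h ` (coeffs_in (coeffs_in C) - {0})"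
  have "\<exists>x. (\<forall>\<phi>\<in>{\<phi>}. holds \<delta> (\<lambda>_. x) \<phi>) \<and> (\<forall>k\<in>H0. k x \<noteq> 0)" if H0: "finite H0" "H0 \<subseteq> H" for H0
  proof -
    have "finite {x \<in> {x. holds \<delta> (\<lambda>_. x) \<phi>}. k x = 0}" if k: "k \<in> H0" for k
    proof -
      obtain G where G: "G \<noteq> 0" "k = h G"
        using k H0(2) by (auto simp: H_def)
      show ?thesis
        by (rule finite_subset[OF _ finite_order_one[OF closed G(1)]]) (use sub G(2) in \<open>auto simp: h_def\<close>)
    qed
    then have "finite (\<Union>k\<in>H0. {x \<in> {x. holds \<delta> (\<lambda>_. x) \<phi>}. k x = 0})"
      using H0(1) by blast
    then have "infinite ({x. holds \<delta> (\<lambda>_. x) \<phi>} - (\<Union>k\<in>H0. {x \<in> {x. holds \<delta> (\<lambda>_. x) \<phi>}. k x = 0}))"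
      using \<phi>(2) by (rule Diff_infinite_finite)
    then obtain x where "x \<in> {x. holds \<delta> (\<lambda>_. x) \<phi>} - (\<Union>k\<in>H0. {x \<in> {x. holds \<delta> (\<lambda>_. x) \<phi>}. k x = 0})"
      using infinite_imp_nonempty by blast
    then show ?thesis by auto
  qed
  moreover have "H \<subseteq> term_funs \<delta> A"
    unfolding H_def h_def[abs_def] using term_funs_curve_eval[OF C] by blast
  moreover have "{\<phi>} \<subseteq> unary_forms A"
    using \<phi>(1) by simp
  ultimately obtain x where x: "holds \<delta> (\<lambda>_. x) \<phi>" "\<And>k. k \<in> H \<Longrightarrow> k x \<noteq> 0"
    using realise[OF sat assms(3), of "{\<phi>}" H] by (metis singletonI)
  show ?thesis
  proof (rule that[OF x(1)])
    fix G assume "G \<in> coeffs_in (coeffs_in C)" "G \<noteq> 0"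
    then have "h G \<in> H"
      by (simp add: H_def)
    from x(2)[OF this] show "curve_eval G x (\<delta> x) \<noteq> 0"
      by (simp add: h_def)
  qed
qed

text \<open>If Y and X - Y were both infinite, each would contain a point on no curve over C. At
  both points a term takes the value of the same polynomial in x and x', which vanishes only if it
  is 0. So the points have the same type over \<open>A\<close>, although \<phi> separates
  them.\<close>

lemma definable_finite_or_cofinite:
  assumes closed: "differentially_closed \<delta>" and sat: "saturated \<delta>"
    and \<phi>: "\<phi> \<in> unary_forms UNIV"
    and X: "X = {x. \<delta> (\<delta> x) = poly (force \<alpha> a n) x}"
    and Y: "Y = {x. holds \<delta> (\<lambda>_. x) \<phi>}" "Y \<subseteq> X"
  shows "finite Y \<or> finite (X - Y)"
proof (rule ccontr)
  assume "\<not> (finite Y \<or> finite (X - Y))"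
  then have inf: "infinite Y" "infinite (X - Y)" by auto
  let ?P = "force \<alpha> a n"
  have \<delta>0: "\<delta> 0 = 0" by (rule rd_0[OF \<delta>])
  define A where "A = params \<phi> \<union> coeff ?P ` {..n}"
  have A: "finite A"
    by (simp add: A_def finite_params)
  \<comment> \<open>A subring closed under \<delta> that contains \<open>A\<close>; conditions with
    coefficients in it still use only the finitely many parameters from \<open>A\<close>.\<close>
  define C where "C = {c. (\<lambda>_. c) \<in> term_funs \<delta> A}"
  have C: "subring C"
    unfolding subring_def C_def
    by (auto intro: term_funs_1 term_funs_add term_funs_mult term_funs_minus)
  have C_\<delta>: "\<delta> c \<in> C" if "c \<in> C" for c
    using that term_funs_derivation unfolding C_def by fastforce
  have A_C: "c \<in> C" if "c \<in> A" for c
    using that by (simp add: C_def term_funs_param)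
  have P: "?P \<in> coeffs_in C"
    unfolding coeffs_in_def
  proof (intro CollectI allI)
    fix k
    show "coeff ?P k \<in> C"
    proof (cases "k \<le> n")
      case True
      then show ?thesis
        by (intro A_C) (simp add: A_def)
    qed (simp add: coeff_force subring_0[OF C])
  qed
  have C_funs: "c \<in> C \<Longrightarrow> (\<lambda>_. c) \<in> term_funs \<delta> A" for c
    by (simp add: C_def)
  have \<phi>A: "\<phi> \<in> unary_forms A"
    using \<phi> by (auto simp: unary_forms_def A_def)
  obtain \<xi> where \<xi>: "\<xi> \<in> unary_forms A" "\<And>x. holds \<delta> (\<lambda>_. x) \<xi> \<longleftrightarrow> \<delta> (\<delta> x) + - poly ?P x = 0"
  proof -
    have "(\<lambda>x. \<delta> (\<delta> x) + - poly ?P x) \<in> term_funs \<delta> A"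
      using P C_funs by (intro term_funs_add term_funs_minus term_funs_derivation term_funs_id
          term_funs_poly) (simp_all add: coeffs_in_def)
    then show thesis
      using term_funs_form that by blast
  qed
  have \<xi>X: "holds \<delta> (\<lambda>_. x) \<xi> \<longleftrightarrow> x \<in> X" for x
    by (simp add: \<xi>(2) X)
  obtain b where b: "b \<in> Y" "\<And>G. G \<in> coeffs_in (coeffs_in C) \<Longrightarrow> G \<noteq> 0 \<Longrightarrow> curve_eval G b (\<delta> b) \<noteq> 0"
    using generic_point[OF closed sat A C_funs \<phi>A] inf(1) Y X by auto
  have conj: "Conj \<xi> (Neg \<phi>) \<in> unary_forms A"
    using \<phi>A \<xi>(1) by (auto simp: unary_forms_def)
  have diff: "{x. holds \<delta> (\<lambda>_. x) (Conj \<xi> (Neg \<phi>))} = X - Y"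
    using \<xi>X Y by auto
  have "X - Y \<subseteq> {x. \<delta> (\<delta> x) = poly ?P x}"
    using X by blast
  with inf(2) obtain b' where b': "holds \<delta> (\<lambda>_. b') (Conj \<xi> (Neg \<phi>))"
    "\<And>G. G \<in> coeffs_in (coeffs_in C) \<Longrightarrow> G \<noteq> 0 \<Longrightarrow> curve_eval G b' (\<delta> b') \<noteq> 0"
    using generic_point[OF closed sat A C_funs conj] unfolding diff by blast
  have b'XY: "b' \<in> X - Y"
    unfolding diff[symmetric] using b'(1) by blast
  have bX: "\<delta> (\<delta> b) = poly ?P b" "\<delta> (\<delta> b') = poly ?P b'"
    using b(1) b'XY Y(2) by (auto simp: X)
  note C1 = subring_coeffs_in[OF C]
  note C2 = subring_coeffs_in[OF C1]
  have const: "[:q:] \<in> coeffs_in D" if "subring D" "q \<in> D" for q :: "'b::idom" and D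
    using that subring_0[OF that(1)] by (simp add: coeffs_in_def coeff_pCons split: nat.split)
  \<comment> \<open>Normal form of terms: derivatives of order two and more are eliminated by x'' =
    P x, in the same way at b and at b'.\<close>
  have nf: "\<exists>G\<in>coeffs_in (coeffs_in C). term_val \<delta> (\<lambda>_. b) t = curve_eval G b (\<delta> b)
      \<and> term_val \<delta> (\<lambda>_. b') t = curve_eval G b' (\<delta> b')" if "term_params t \<subseteq> A" for t
    using that
  proof (induction t)
    case (Var k)
    have "[:0, 1:] \<in> coeffs_in C"
      using subring_0[OF C] subring_1[OF C] by (simp add: coeffs_in_def coeff_pCons split: nat.split)
    from const[OF C1 this] show ?case
      by (intro bexI[of _ "[:[:0, 1:]:]"]) simp_all
  next
    case (Param c)
    then have "[:[:c:]:] \<in> coeffs_in (coeffs_in C)"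
      by (intro const C1 C A_C) auto
    then show ?case
      by (intro bexI[of _ "[:[:c:]:]"]) simp_all
  next
    case Zero
    show ?case
      by (rule bexI[OF _ subring_0[OF C2]]) simp
  next
    case One
    show ?case
      by (rule bexI[OF _ subring_1[OF C2]]) (simp add: curve_eval_def)
  next
    case (Plus s t)
    then obtain G H where "G \<in> coeffs_in (coeffs_in C)" "H \<in> coeffs_in (coeffs_in C)"
      "term_val \<delta> (\<lambda>_. b) s = curve_eval G b (\<delta> b)" "term_val \<delta> (\<lambda>_. b') s = curve_eval G b' (\<delta> b')"
      "term_val \<delta> (\<lambda>_. b) t = curve_eval H b (\<delta> b)" "term_val \<delta> (\<lambda>_. b') t = curve_eval H b' (\<delta> b')"
      by auto
    then show ?case
      by (intro bexI[of _ "G + H"] subring_add[OF C2]) (simp_all add: curve_eval_add)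
  next
    case (Uminus t)
    then obtain G where "G \<in> coeffs_in (coeffs_in C)"
      "term_val \<delta> (\<lambda>_. b) t = curve_eval G b (\<delta> b)" "term_val \<delta> (\<lambda>_. b') t = curve_eval G b' (\<delta> b')"
      by auto
    then show ?case
      by (intro bexI[of _ "- G"] subring_minus[OF C2]) (simp_all add: curve_eval_def)
  next
    case (Times s t)
    then obtain G H where "G \<in> coeffs_in (coeffs_in C)" "H \<in> coeffs_in (coeffs_in C)"
      "term_val \<delta> (\<lambda>_. b) s = curve_eval G b (\<delta> b)" "term_val \<delta> (\<lambda>_. b') s = curve_eval G b' (\<delta> b')"
      "term_val \<delta> (\<lambda>_. b) t = curve_eval H b (\<delta> b)" "term_val \<delta> (\<lambda>_. b') t = curve_eval H b' (\<delta> b')"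
      by auto
    then show ?case
      by (intro bexI[of _ "G * H"] subring_mult[OF C2]) (simp_all add: curve_eval_mult)
  next
    case (Der t)
    then obtain G where "G \<in> coeffs_in (coeffs_in C)"
      "term_val \<delta> (\<lambda>_. b) t = curve_eval G b (\<delta> b)" "term_val \<delta> (\<lambda>_. b') t = curve_eval G b' (\<delta> b')"
      by auto
    then show ?case
      using derivation_curve_eval[OF \<delta> bX(1)] derivation_curve_eval[OF \<delta> bX(2)]
      by (intro bexI[of _ "flow_derivation \<delta> ?P G"] flow_derivation_coeffs_in C C_\<delta> \<delta>0 P) simp_all
  qed
  have "same_type \<delta> A (\<lambda>_. b) (\<lambda>_. b')"
    unfolding same_type_def
  proof (intro allI impI)
    fix t assume "term_params t \<subseteq> A"
    from nf[OF this] obtain G where G: "G \<in> coeffs_in (coeffs_in C)"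
      "term_val \<delta> (\<lambda>_. b) t = curve_eval G b (\<delta> b)" "term_val \<delta> (\<lambda>_. b') t = curve_eval G b' (\<delta> b')"
      by blast
    show "term_val \<delta> (\<lambda>_. b) t = 0 \<longleftrightarrow> term_val \<delta> (\<lambda>_. b') t = 0"
      using b(2)[OF G(1)] b'(2)[OF G(1)] unfolding G(2,3) by (cases "G = 0") auto
  qed
  then have "holds \<delta> (\<lambda>_. b) \<phi> \<longleftrightarrow> holds \<delta> (\<lambda>_. b') \<phi>"
    by (intro same_type_holds[OF closed sat A]) (auto simp: A_def)
  then show False
    using b(1) b'XY Y(1) by blast
qed

end

theorem theorem4p1:
  fixes \<delta> :: "'a::field_char_0 \<Rightarrow> 'a" and n :: nat and \<alpha> :: 'a and a :: "nat \<Rightarrow> 'a"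
  assumes "differentially_closed \<delta>"
    and "saturated \<delta>"
    and "n \<ge> 8"
    and "diff_independent \<delta> \<rat> (\<alpha> # map a [0..<Suc n])"
  shows "strongly_minimal \<delta> {x. \<delta> (\<delta> x) + (\<Sum>i=1..n. a i * x ^ i) = \<alpha>}"
proof -
  interpret generic_coefficients \<delta> n \<alpha> a
    using assms by unfold_locales
      (auto simp: differentially_closed_def intro: ring_derivation_if_derivation)
  define X where "X = {x. \<delta> (\<delta> x) + (\<Sum>i=1..n. a i * x ^ i) = \<alpha>}"
  have X: "X = {x. \<delta> (\<delta> x) = poly (force \<alpha> a n) x}"
    unfolding X_def poly_force by (simp add: eq_diff_eq)
  have "(\<lambda>x. \<delta> (\<delta> x) + - poly (force \<alpha> a n) x) \<in> term_funs \<delta> UNIV"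
    by (intro term_funs_add term_funs_minus term_funs_derivation term_funs_id term_funs_poly
        term_funs_param) simp
  then obtain \<xi> where "\<xi> \<in> unary_forms UNIV"
    "\<And>x. holds \<delta> (\<lambda>_. x) \<xi> \<longleftrightarrow> \<delta> (\<delta> x) + - poly (force \<alpha> a n) x = 0"
    using term_funs_form by blast
  then have "definable \<delta> X"
    unfolding definable_def X by (intro bexI[of _ \<xi>]) auto
  moreover have "finite Y \<or> finite (X - Y)" if "definable \<delta> Y" "Y \<subseteq> X" for Y
    using that definable_finite_or_cofinite[OF assms(1,2) _ X] unfolding definable_def by blast
  ultimately show ?thesis
    unfolding strongly_minimal_def X_def by blast
qed

end
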